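(* Let $T>0$. Let $\mathbf{X}=(X(t),\,t\in\mathbb{R})$ be a stationary sample continuous process satisfying Assumption U$_T$ and Assumption L. Then the restriction of the law $F_{\mathbf{X},T}$ of the unique location of the supremum of the process in $[0,T]$ to the interior $(0,T)$ of the interval is absolutely continuous. The density $f_{\mathbf{X},T}$ has a càdlàg version with the following properties. (a) The density has bounded variation on $(0,T)$, hence the limits $$f_{\mathbf{X},T}(0+)=\lim_{t\downarrow 0} f_{\mathbf{X},T}(t)\quad\text{and}\quad f_{\mathbf{X},T}(T-)=\lim_{t\uparrow T} f_{\mathbf{X},T}(t)$$ exist and are finite. Furthermore, $$TV_{(0,T)}(f_{\mathbf{X},T})\le f_{\mathbf{X},T}(0+)+f_{\mathbf{X},T}(T-).$$ (b) The density is bounded away from zero, that is, $\inf_{0<t<T} f_{\mathbf{X},T}(t)>0$. (c) Either $f_{\mathbf{X},T}(t)=1/T$ for all $0<t<T$, or $\int_0^T f_{\mathbf{X},T}(t)\,dt<1$. Moreover, conversely, let $f:(0,T)\to[0,\infty)$ be a càdlàg function satisfying (a)-(c) with $f$ in place of $f_{\mathbf{X},T}$; that is: $f$ has bounded variation on $(0,T)$ with $TV_{(0,T)}(f)\le f(0+)+f(T-)$; $\inf_{0<t<T}f(t)>0$; and either $f(t)=1/T$ for all $0<t<T$ or $\int_0^T f(t)\,dt<1$. Then there is a stationary sample continuous process $\mathbf{X}$, satisfying Assumption U$_T$ and Assumption L, such that $f$ is the density in the interior $(0,T)$ of the unique location of the supremum of the process in $[0,T]$.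
   Context: A process $\mathbf{X}=(X(t),\,t\in\mathbb{R})$ is real-valued, defined on a probability space $(\Omega,\mathcal{F},P)$; it is sample continuous if its sample paths are continuous on $\mathbb{R}$, and stationary if its finite-dimensional distributions are invariant under time shifts. Assumption U$_T$ (for a given $T>0$): with $X_*(T)=\sup_{0\le t\le T}X(t)$, $$P\bigl(X(t_i)=X_*(T),\ i=1,2,\ \text{for two different } t_1,t_2\in[0,T]\bigr)=0.$$ Under this assumption the supremum over $[0,T]$ is, almost surely, attained at a unique point. Assumption L: $$K:=\lim_{\varepsilon\downarrow 0}\frac{P\bigl(\mathbf{X}\text{ has a local maximum in }(0,\varepsilon)\bigr)}{\varepsilon}<\infty$$ (the limit always exists). Let $\tau_{\mathbf{X},T}=\min\{t\in[0,T]: X(t)=\sup_{0\le s\le T}X(s)\}$ be the (leftmost) location of the supremum over $[0,T]$; under Assumption U$_T$ it is a.s. the unique location. $F_{\mathbf{X},T}$ denotes the law of $\tau_{\mathbf{X},T}$, a probability measure on $[0,T]$, which may have atoms at $0$ and at $T$. $f_{\mathbf{X},T}$ denotes the density of the restriction of $F_{\mathbf{X},T}$ to $(0,T)$ (so its integral over $(0,T)$ may be less than $1$). A function on $(0,T)$ is càdlàg if it is right continuous and has left limits at every point of $(0,T)$. $TV_{(0,T)}(f)$ is the total variation of $f$ on the open interval $(0,T)$, i.e. the supremum of $\sum_{i=1}^{n-1}|f(s_{i+1})-f(s_i)|$ over all $n$ and all $0<s_1<\dots<s_n<T$. $f(0+)$ and $f(T-)$ are the one-sided limits of $f$ at $0$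 and $T$. *)

theory Defs
  imports "HOL-Probability.Probability"
begin

definition sample_continuous_process :: "'a measure \<Rightarrow> (real \<Rightarrow> 'a \<Rightarrow> real) \<Rightarrow> bool" where
  "sample_continuous_process M X \<longleftrightarrow>
     prob_space M \<and> (\<forall>t. X t \<in> borel_measurable M) \<and>
     (\<forall>\<omega>\<in>space M. continuous_on UNIV (\<lambda>t. X t \<omega>))"

definition stationary_process :: "'a measure \<Rightarrow> (real \<Rightarrow> 'a \<Rightarrow> real) \<Rightarrow> bool" where
  "stationary_process M X \<longleftrightarrow>
     (\<forall>I h. finite I \<longrightarrow>
        distr M (Pi\<^sub>M I (\<lambda>_. borel)) (\<lambda>\<omega>. \<lambda>t\<in>I. X (t + h) \<omega>) =
        distr M (Pi\<^sub>M I (\<lambda>_. borel)) (\<lambda>\<omega>. \<lambda>t\<in>I. X t \<omega>))"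

text \<open>The event in Assumption U is measurable for a process with continuous paths;
  membership in \<open>null_sets M\<close> states both this and that its probability is 0.\<close>

definition assumption_U :: "'a measure \<Rightarrow> (real \<Rightarrow> 'a \<Rightarrow> real) \<Rightarrow> real \<Rightarrow> bool" where
  "assumption_U M X T \<longleftrightarrow>
     {\<omega> \<in> space M. \<exists>t\<^sub>1\<in>{0..T}. \<exists>t\<^sub>2\<in>{0..T}. t\<^sub>1 \<noteq> t\<^sub>2 \<and>
        X t\<^sub>1 \<omega> = (SUP t\<in>{0..T}. X t \<omega>) \<and> X t\<^sub>2 \<omega> = (SUP t\<in>{0..T}. X t \<omega>)} \<in> null_sets M"

definition local_max_at :: "(real \<Rightarrow> real) \<Rightarrow> real \<Rightarrow> bool" where
  "local_max_at x t \<longleftrightarrow> (\<forall>\<^sub>F s in nhds t. x s \<le> x t)"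

text \<open>For continuous paths, the event that there is a local maximum in \<open>(0, \<epsilon>)\<close> is measurable:
  it is the union, over rational \<open>0 < a < c \<le> d < b < \<epsilon>\<close>, of the events that the maxima
  over \<open>[a, b]\<close> and over \<open>[c, d]\<close> agree. The real limit \<open>K\<close> expresses that the limit,
  which always exists in \<open>[0, \<infinity>]\<close>, is finite.\<close>

definition assumption_L :: "'a measure \<Rightarrow> (real \<Rightarrow> 'a \<Rightarrow> real) \<Rightarrow> bool" where
  "assumption_L M X \<longleftrightarrow>
     (\<exists>K::real. ((\<lambda>\<epsilon>. measure M {\<omega> \<in> space M. \<exists>t\<in>{0<..<\<epsilon>}. local_max_at (\<lambda>s. X s \<omega>) t} / \<epsilon>)
        \<longlongrightarrow> K) (at_right 0))"

definition sup_location :: "(real \<Rightarrow> 'a \<Rightarrow> real) \<Rightarrow> real \<Rightarrow> 'a \<Rightarrow> real" where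
  "sup_location X T \<omega> = (LEAST t. t \<in> {0..T} \<and> X t \<omega> = (SUP s\<in>{0..T}. X s \<omega>))"

definition sup_location_law :: "'a measure \<Rightarrow> (real \<Rightarrow> 'a \<Rightarrow> real) \<Rightarrow> real \<Rightarrow> real measure" where
  "sup_location_law M X T = distr M borel (sup_location X T)"

text \<open>A function on \<open>(0, T)\<close> is represented by a function on the reals whose values
  outside \<open>(0, T)\<close> are irrelevant.\<close>

definition interior_density :: "'a measure \<Rightarrow> (real \<Rightarrow> 'a \<Rightarrow> real) \<Rightarrow> real \<Rightarrow> (real \<Rightarrow> real) \<Rightarrow> bool" where
  "interior_density M X T f \<longleftrightarrow>
     restrict_space (sup_location_law M X T) {0<..<T} =
     density (restrict_space lborel {0<..<T}) (\<lambda>t. ennreal (f t))"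

definition cadlag_interior :: "real \<Rightarrow> (real \<Rightarrow> real) \<Rightarrow> bool" where
  "cadlag_interior T f \<longleftrightarrow>
     (\<forall>t\<in>{0<..<T}. continuous (at_right t) f \<and> (\<exists>l. (f \<longlongrightarrow> l) (at_left t)))"

definition total_variation :: "real set \<Rightarrow> (real \<Rightarrow> real) \<Rightarrow> ereal" where
  "total_variation S f =
     (SUP s\<in>{s. sorted_wrt (<) s \<and> set s \<subseteq> S}.
        ereal (\<Sum>i<length s - 1. \<bar>f (s ! Suc i) - f (s ! i)\<bar>))"

definition variation_property :: "real \<Rightarrow> (real \<Rightarrow> real) \<Rightarrow> bool" where
  "variation_property T f \<longleftrightarrow>
     total_variation {0<..<T} f < \<infinity> \<and>
     (\<exists>f0 fT. (f \<longlongrightarrow> f0) (at_right 0) \<and> (f \<longlongrightarrow> fT) (at_left T) \<and>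
        total_variation {0<..<T} f \<le> ereal (f0 + fT))"

end

(* Let c_0, ..., c_{N-1} be the masses which the location of the maximum over a window of length T
   puts on the cells of a grid of mesh h. A maximum over a window stays the maximum over every
   subwindow that contains it, so by stationarity c_j and c_{j+1} are both dominated by the mass of
   one and the same cell of a window of length T - h, and comparing the total masses for T and
   T - h gives sum |c_{j+1} - c_j| <= c_0 + c_{N-1}. Assumption L makes the c_j of order h, hence the
   law is Lipschitz inside (0,T), and letting h tend to 0 produces a cadlag density with the
   variation bound. If the interior mass is 1, then a maximum that leaves a moving window must be
   replaced by one entering at the opposite end, which forces the uniform law. If inf f = 0, then
   maxima over longer windows avoid the middle, so the maxima over consecutive blocks form a
   quasi-convex stationary sequence; such a sequence is a.s. constant, which again forces mass 1 and
   the uniform density, a contradiction.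

   Conversely, let f = f(0+) + U - D be the Jordan decomposition of f. Matching the levels at which
   f(0+) + U rises with those at which D falls, first in first out, writes f as an integral over
   a level theta of finite sums of indicators of intervals (a_i, b_i), and the variation bound
   guarantees that intervals starting at 0 and intervals ending at T suffice. For fixed theta the
   intervals are realised by the peaks p_i of a periodic envelope of tents: the spacing of the peaks
   is chosen such that p_i is the maximum over [u, u + T] exactly when a_i < p_i - u < b_i. A random
   level together with a uniform phase gives the process. *)
theory Submission
  imports Defs
begin

section \<open>Leftmost maxima of continuous paths\<close>

text \<open>Two obstacles shape the direct half. Almost sure statements are available for countably
  many windows only, while the time at which a maximum leaves a moving window is random; a countable
  dense set of window positions and the local finiteness of local maxima bridge this gap. And the
  step densities of the grids are not monotone, so compactness comes from Helly selection applied
  separately to their positive and negative variations. For the lower bound, a quasi-convex sequence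
  crosses a level upwards at most once; by stationarity the crossing has the same probability at
  every place, so this probability is 0, and likewise for downward crossings. In the converse the
  number of levels is tied to inf f: with spacing m < inf f, level y of the rising part is reached
  before level y - m of the falling part, so matched intervals are never reversed. The mass missing
  from the interior is spent on differences of height between neighbouring peaks. These need a
  positive amount, and therefore the uniform density is realised separately, by equal peaks at
  distance T.\<close>

definition wsup :: "real \<Rightarrow> real \<Rightarrow> (real \<Rightarrow> real) \<Rightarrow> real" where
  "wsup a b x = (SUP t\<in>{a..b}. x t)"

text \<open>The notion behind \<open>sup_location\<close>, for an arbitrary window and a bare path:
  the direct half works by comparing different windows on one path.\<close>

definition wloc :: "real \<Rightarrow> real \<Rightarrow> (real \<Rightarrow> real) \<Rightarrow> real" where
  "wloc a b x = (LEAST t. t \<in> {a..b} \<and> x t = wsup a b x)"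

lemma wsup_ge:
  assumes "continuous_on UNIV x" "t \<in> {a..b}"
  shows "x t \<le> wsup a b x"
proof -
  have "compact (x ` {a..b})"
    using assms by (intro compact_continuous_image continuous_on_subset[OF assms(1)]) auto
  then have "bdd_above (x ` {a..b})"
    by (intro bounded_imp_bdd_above compact_imp_bounded)
  then show ?thesis
    unfolding wsup_def using assms(2) by (intro cSUP_upper)
qed

lemma wsup_eqI:
  fixes x :: "real \<Rightarrow> real"
  assumes "t \<in> {a..b}" "\<And>s. s \<in> {a..b} \<Longrightarrow> x s \<le> x t"
  shows "wsup a b x = x t"
  unfolding wsup_def using assms by (intro cSup_eq_maximum) auto

lemma wloc_eqI:
  assumes "t \<in> {a..b}" "\<And>s. s \<in> {a..b} \<Longrightarrow> x s \<le> x t" "\<And>s. s \<in> {a..<t} \<Longrightarrow> x s < x t"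
  shows "wloc a b x = t"
  unfolding wloc_def
proof (rule Least_equality)
  have w: "wsup a b x = x t" by (rule wsup_eqI) (fact assms)+
  show "t \<in> {a..b} \<and> x t = wsup a b x"
    using assms(1) w by simp
  fix s assume s: "s \<in> {a..b} \<and> x s = wsup a b x"
  show "t \<le> s"
  proof (rule ccontr)
    assume "\<not> t \<le> s"
    then have "x s < x t" using s by (intro assms(3)) auto
    then show False using s w by simp
  qed
qed

lemma wloc_ex:
  fixes x :: "real \<Rightarrow> real"
  assumes x: "continuous_on UNIV x" and "a \<le> b"
  obtains t where "t \<in> {a..b}" "\<And>s. s \<in> {a..b} \<Longrightarrow> x s \<le> x t" "\<And>s. s \<in> {a..<t} \<Longrightarrow> x s < x t"
proof -
  have c: "continuous_on {a..b} x" using x continuous_on_subset by blast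
  have "{a..b} \<noteq> {}" using \<open>a \<le> b\<close> by simp
  then obtain u where u: "u \<in> {a..b}" "\<forall>s\<in>{a..b}. x s \<le> x u"
    using continuous_attains_sup[OF compact_Icc _ c] by blast
  define A where "A = {a..b} \<inter> x -` {x u}"
  have "closed A"
    unfolding A_def by (intro continuous_closed_preimage c) auto
  moreover have "bounded A"
    unfolding A_def by (rule bounded_subset[OF bounded_closed_interval[of a b]]) simp
  ultimately have "compact A" by (simp add: compact_eq_bounded_closed)
  moreover have "A \<noteq> {}" using u(1) unfolding A_def by blast
  ultimately obtain t where t: "t \<in> A" "\<forall>s\<in>A. t \<le> s"
    using compact_attains_inf[of A] by blast
  have xt: "x t = x u" "t \<in> {a..b}" using t(1) by (simp_all add: A_def)
  show ?thesis
  proof (rule that[of t])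
    show "t \<in> {a..b}" by fact
    show "x s \<le> x t" if "s \<in> {a..b}" for s using xt u(2) that by simp
    show "x s < x t" if "s \<in> {a..<t}" for s
    proof -
      have "s \<in> {a..b}" using that xt by auto
      moreover have "s \<notin> A" using that t(2) by force
      ultimately have "x s \<noteq> x u" "x s \<le> x u" using u(2) by (auto simp: A_def)
      then show ?thesis using xt by simp
    qed
  qed
qed

lemma
  assumes x: "continuous_on UNIV x" and "a \<le> b"
  shows wloc_in: "wloc a b x \<in> {a..b}"
    and wloc_sup: "x (wloc a b x) = wsup a b x"
    and wloc_max: "s \<in> {a..b} \<Longrightarrow> x s \<le> x (wloc a b x)"
    and wloc_left: "s \<in> {a..<wloc a b x} \<Longrightarrow> x s < x (wloc a b x)"
proof -
  obtain t where t: "t \<in> {a..b}" "\<And>s. s \<in> {a..b} \<Longrightarrow> x s \<le> x t" "\<And>s. s \<in> {a..<t} \<Longrightarrow> x s < x t"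
    by (rule wloc_ex[OF assms]) (rule that)
  have e: "wloc a b x = t" by (rule wloc_eqI) (fact t)+
  have "wsup a b x = x t" by (rule wsup_eqI) (fact t)+
  then show "wloc a b x \<in> {a..b}" "x (wloc a b x) = wsup a b x"
    unfolding e using t(1) by simp_all
  show "s \<in> {a..b} \<Longrightarrow> x s \<le> x (wloc a b x)" "s \<in> {a..<wloc a b x} \<Longrightarrow> x s < x (wloc a b x)"
    unfolding e by (fact t)+
qed

text \<open>This is how measurability of \<open>wloc\<close> is obtained. The leftmost choice makes
  the comparison non-strict: a maximum attained on both sides of c has its leftmost point on the
  left.\<close>

lemma wloc_le_iff:
  assumes x: "continuous_on UNIV x" and "a \<le> c" "c \<le> b"
  shows "wloc a b x \<le> c \<longleftrightarrow> wsup c b x \<le> wsup a c x"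
proof
  have ab: "a \<le> b" using assms by auto
  assume le: "wloc a b x \<le> c"
  have "wsup a c x \<ge> x (wloc a b x)"
    using wloc_in[OF x ab] le by (intro wsup_ge[OF x]) auto
  moreover have "wsup c b x \<le> x (wloc a b x)"
    using wloc_sup[OF x \<open>c \<le> b\<close>] wloc_in[OF x \<open>c \<le> b\<close>] wloc_max[OF x ab, of "wloc c b x"] \<open>a \<le> c\<close> by auto
  ultimately show "wsup c b x \<le> wsup a c x" by simp
next
  have ab: "a \<le> b" using assms by auto
  assume le: "wsup c b x \<le> wsup a c x"
  show "wloc a b x \<le> c"
  proof (rule ccontr)
    assume n: "\<not> wloc a b x \<le> c"
    have "x (wloc a b x) \<le> wsup c b x"
      using wloc_in[OF x ab] n by (intro wsup_ge[OF x]) auto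
    moreover have "wsup a c x < x (wloc a b x)"
      using wloc_sup[OF x \<open>a \<le> c\<close>] wloc_in[OF x \<open>a \<le> c\<close>] wloc_left[OF x ab, of "wloc a c x"] n by auto
    ultimately show False using le by simp
  qed
qed

lemma wsup_shift: "wsup a b (\<lambda>t. x (t + h)) = wsup (a + h) (b + h) x"
proof -
  have "(\<lambda>t. x (t + h)) ` {a..b} = x ` ((\<lambda>t. t + h) ` {a..b})" by (simp only: image_image)
  then show ?thesis by (simp add: wsup_def)
qed

lemma continuous_shift:
  assumes "continuous_on UNIV (x :: real \<Rightarrow> real)"
  shows "continuous_on UNIV (\<lambda>t. x (t + h))"
  by (intro continuous_on_compose2[OF assms] continuous_intros) auto

lemma wloc_shift:
  assumes x: "continuous_on UNIV x" and "a \<le> b"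
  shows "wloc a b (\<lambda>t. x (t + h)) = wloc (a + h) (b + h) x - h"
proof -
  have ab: "a + h \<le> b + h" using assms by auto
  show ?thesis
  proof (rule wloc_eqI)
    show "wloc (a + h) (b + h) x - h \<in> {a..b}" using wloc_in[OF x ab] by auto
    show "x (s + h) \<le> x (wloc (a + h) (b + h) x - h + h)" if "s \<in> {a..b}" for s
      using wloc_max[OF x ab, of "s + h"] that by auto
    show "x (s + h) < x (wloc (a + h) (b + h) x - h + h)" if "s \<in> {a..<wloc (a + h) (b + h) x - h}" for s
      using wloc_left[OF x ab, of "s + h"] that by auto
  qed
qed

lemma wloc_subinterval:
  assumes x: "continuous_on UNIV x" and "a \<le> a'" "b' \<le> b" "wloc a b x \<in> {a'..b'}"
  shows "wloc a' b' x = wloc a b x"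
proof -
  have ab: "a \<le> b" using assms by auto
  show ?thesis
    by (rule wloc_eqI) (use assms in \<open>auto intro!: wloc_max[OF x ab] wloc_left[OF x ab]\<close>)
qed

lemma local_max_atI:
  assumes "a < t" "t < b" "\<And>s. s \<in> {a..b} \<Longrightarrow> x s \<le> x t"
  shows "local_max_at x t"
  unfolding local_max_at_def eventually_nhds
  by (rule exI[of _ "{a<..<b}"]) (auto simp: assms(1,2) intro!: assms(3))

lemma local_max_at_interval:
  assumes "local_max_at x t"
  obtains e where "e > 0" "\<And>s. s \<in> {t-e..t+e} \<Longrightarrow> x s \<le> x t"
proof -
  from assms obtain d where d: "d > 0" "\<And>s. dist s t < d \<Longrightarrow> x s \<le> x t"
    unfolding local_max_at_def eventually_nhds_metric by auto
  show ?thesis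
  proof (rule that[of "d/2"])
    show "x s \<le> x t" if "s \<in> {t-d/2..t+d/2}" for s
      using that d(1) by (intro d(2)) (auto simp: dist_real_def abs_less_iff)
  qed (use d(1) in simp)
qed

lemma local_max_wloc:
  assumes x: "continuous_on UNIV x" and "a < wloc a b x" "wloc a b x < b"
  shows "local_max_at x (wloc a b x)"
proof (rule local_max_atI)
  show "x s \<le> x (wloc a b x)" if "s \<in> {a..b}" for s
    using wloc_max[OF x _ that] that by auto
qed fact+

lemma local_max_shift: "local_max_at (\<lambda>t. x (t + h)) t \<longleftrightarrow> local_max_at x (t + h)"
proof
  assume "local_max_at x (t + h)"
  then obtain e where "e > 0" "\<And>s. s \<in> {t+h-e..t+h+e} \<Longrightarrow> x s \<le> x (t+h)"
    by (rule local_max_at_interval) (rule that)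
  then show "local_max_at (\<lambda>t. x (t + h)) t"
    by (intro local_max_atI[of "t-e" _ "t+e"]) auto
next
  assume "local_max_at (\<lambda>t. x (t + h)) t"
  then obtain e where "e > 0" and e: "\<And>s. s \<in> {t-e..t+e} \<Longrightarrow> x (s+h) \<le> x (t+h)"
    by (rule local_max_at_interval) (rule that)
  then show "local_max_at x (t + h)"
    using e[of "s - h" for s] by (intro local_max_atI[of "t+h-e" _ "t+h+e"]) auto
qed

text \<open>Rational quantifiers give measurability. Backwards, a maximiser over the inner window
  \<open>[p, q]\<close> dominates the outer window \<open>[a, b]\<close> and lies strictly inside
  it.\<close>

lemma ex_local_max_iff:
  assumes x: "continuous_on UNIV x"
  shows "(\<exists>t\<in>{c<..<d}. local_max_at x t) \<longleftrightarrow>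
    (\<exists>a\<in>\<rat>. \<exists>p\<in>\<rat>. \<exists>q\<in>\<rat>. \<exists>b\<in>\<rat>. c < a \<and> a < p \<and> p < q \<and> q < b \<and> b < d \<and> wsup a b x \<le> wsup p q x)"
proof (intro iffI)
  assume "\<exists>t\<in>{c<..<d}. local_max_at x t"
  then obtain t where t: "c < t" "t < d" "local_max_at x t" by auto
  obtain e where e: "e > 0" "\<And>s. s \<in> {t-e..t+e} \<Longrightarrow> x s \<le> x t"
    using t(3) by (rule local_max_at_interval) (rule that)
  obtain a where a: "a \<in> \<rat>" "max c (t - e) < a" "a < t" using Rats_dense_in_real[of "max c (t-e)" t] t e by auto
  obtain p where p: "p \<in> \<rat>" "a < p" "p < t" using Rats_dense_in_real[of a t] a by auto
  obtain b where b: "b \<in> \<rat>" "t < b" "b < min d (t + e)" using Rats_dense_in_real[of t "min d (t+e)"] t e by auto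
  obtain q where q: "q \<in> \<rat>" "t < q" "q < b" using Rats_dense_in_real[of t b] b by auto
  have "wsup a b x = x t" using a b e by (intro wsup_eqI) auto
  moreover have "x t \<le> wsup p q x" using p q by (intro wsup_ge[OF x]) auto
  ultimately show "\<exists>a\<in>\<rat>. \<exists>p\<in>\<rat>. \<exists>q\<in>\<rat>. \<exists>b\<in>\<rat>. c < a \<and> a < p \<and> p < q \<and> q < b \<and> b < d \<and> wsup a b x \<le> wsup p q x"
    using a b p q by (intro bexI[of _ a] bexI[of _ p] bexI[of _ q] bexI[of _ b]) auto
next
  assume "\<exists>a\<in>\<rat>. \<exists>p\<in>\<rat>. \<exists>q\<in>\<rat>. \<exists>b\<in>\<rat>. c < a \<and> a < p \<and> p < q \<and> q < b \<and> b < d \<and> wsup a b x \<le> wsup p q x"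
  then obtain a p q b where *: "c < a" "a < p" "p < q" "q < b" "b < d" "wsup a b x \<le> wsup p q x" by auto
  have pq: "p \<le> q" using * by auto
  have "x s \<le> x (wloc p q x)" if "s \<in> {a..b}" for s
    using wsup_ge[OF x that] * wloc_sup[OF x pq] by auto
  then have "local_max_at x (wloc p q x)"
    using * wloc_in[OF x pq] by (intro local_max_atI[of a _ b]) auto
  then show "\<exists>t\<in>{c<..<d}. local_max_at x t"
    using * wloc_in[OF x pq] by (intro bexI[of _ "wloc p q x"]) auto
qed

section \<open>How the maximum leaves a moving window\<close>

text \<open>If the new maximiser does not lie beyond T, then the old one, t, is maximal over all of
  \<open>[0, h + T]\<close>. Windows starting at r in \<open>D\<close> slightly after t have their
  maximisers at local maxima beyond t, and local finiteness keeps these away from t. Letting r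
  decrease to t yields a second point of height \<open>x t\<close> within distance T, hence a tie in
  a window that starts in \<open>D\<close>. The detour is necessary because t itself need not belong
  to \<open>D\<close>.\<close>

lemma argmax_jump:
  assumes x: "continuous_on UNIV x" and h: "0 < h" "h < T" "0 \<in> D" "h \<in> D"
    and dense: "\<And>u v. u < v \<Longrightarrow> \<exists>r\<in>D. u < r \<and> r < v"
    and uniq: "\<And>r s t. r \<in> D \<Longrightarrow> s \<in> {r..r+T} \<Longrightarrow> t \<in> {r..r+T} \<Longrightarrow> x s = wsup r (r+T) x \<Longrightarrow> x t = wsup r (r+T) x \<Longrightarrow> s = t"
    and int: "\<And>r. r \<in> D \<Longrightarrow> wloc r (r+T) x \<in> {r<..<r+T}"
    and fin: "\<And>c d. finite {t\<in>{c<..<d}. local_max_at x t}"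
    and less: "wloc 0 T x < h"
  shows "T < wloc h (h+T) x"
proof (rule ccontr)
  have T: "0 \<le> T" "h \<le> h + T" using h by auto
  define t where "t = wloc 0 T x"
  define s where "s = wloc h (h+T) x"
  assume "\<not> T < wloc h (h+T) x"
  then have sT: "s \<le> T" by (simp add: s_def)
  have t: "0 < t" "t < h" using int[OF h(3)] less by (auto simp: t_def)
  have s: "h \<le> s" using wloc_in[OF x T(2)] by (auto simp: s_def)
  have tm: "x y \<le> x t" if "y \<in> {0..T}" for y using wloc_max[OF x T(1) that] by (simp add: t_def)
  have tm2: "x y \<le> x t" if "y \<in> {0..h+T}" for y
  proof (cases "y \<le> T")
    case True then show ?thesis using tm that by auto
  next
    case False
    then have "y \<in> {h..h+T}" using that h by auto
    then have "x y \<le> x s" using wloc_max[OF x T(2)] by (simp add: s_def)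
    also have "x s \<le> x t" using tm[of s] s sT h by auto
    finally show ?thesis .
  qed
  define F where "F = {y\<in>{t<..<t+T+h+1}. local_max_at x y}"
  have "finite F" unfolding F_def by (rule fin)
  define \<theta> where "\<theta> r = wloc r (r+T) x" for r
  have \<theta>F: "\<theta> r \<in> F" if "r \<in> D" "t < r" "r < h" for r
    using int[OF that(1)] local_max_wloc[OF x, of r "r+T"] that h t by (auto simp: \<theta>_def F_def)
  obtain r0 where "r0 \<in> D" "t < r0" "r0 < h" using dense[of t h] t by auto
  then have "F \<noteq> {}" using \<theta>F by auto
  \<comment> \<open>The first local maximum after t. Without finiteness the maximisers of windows
    starting just after t could converge to t itself.\<close>
  define \<delta> where "\<delta> = Min F"
  have \<delta>: "t < \<delta>" using Min_in[OF \<open>finite F\<close> \<open>F \<noteq> {}\<close>] by (auto simp: \<delta>_def F_def)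
  have \<theta>\<delta>: "\<delta> \<le> \<theta> r" if "r \<in> D" "t < r" "r < h" for r
    unfolding \<delta>_def using \<theta>F[OF that] \<open>finite F\<close> by (intro Min_le)
  have \<theta>x: "x r \<le> x (\<theta> r)" "\<theta> r < r + T" if "r \<in> D" for r
    using wloc_max[OF x, of r "r+T" r] int[OF that] T by (auto simp: \<theta>_def)
  have \<delta>T: "\<delta> \<le> t + T"
  proof (rule ccontr)
    assume "\<not> \<delta> \<le> t + T"
    then obtain r where "r \<in> D" "t < r" "r < min h (\<delta> - T)" using dense[of t "min h (\<delta> - T)"] t by auto
    then show False using \<theta>\<delta>[of r] \<theta>x[of r] by auto
  qed
  \<comment> \<open>The best point of \<open>[\<delta>, t + T]\<close>. Each
    \<open>\<theta> r\<close> lies in this interval or beyond its right end by less than r - t, so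
    continuity gives \<open>x t \<le> x y\<close>.\<close>
  define y where "y = wloc \<delta> (t+T) x"
  have y: "y \<in> {\<delta>..t+T}" and ym: "\<And>z. z \<in> {\<delta>..t+T} \<Longrightarrow> x z \<le> x y"
    using wloc_in[OF x \<delta>T] wloc_max[OF x \<delta>T] by (auto simp: y_def)
  have "x t \<le> x y"
  proof (rule ccontr)
    assume "\<not> x t \<le> x y"
    define e where "e = x t - x y"
    have "e > 0" using \<open>\<not> x t \<le> x y\<close> by (simp add: e_def)
    have c: "isCont x z" for z using x by (simp add: continuous_on_eq_continuous_at)
    obtain d1 where d1: "d1 > 0" "\<And>z. \<bar>z - t\<bar> < d1 \<Longrightarrow> \<bar>x z - x t\<bar> < e/2"
      using c[of t] \<open>e > 0\<close> unfolding continuous_at_eps_delta dist_real_def by (meson half_gt_zero)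
    obtain d2 where d2: "d2 > 0" "\<And>z. \<bar>z - (t+T)\<bar> < d2 \<Longrightarrow> \<bar>x z - x (t+T)\<bar> < e/2"
      using c[of "t+T"] \<open>e > 0\<close> unfolding continuous_at_eps_delta dist_real_def by (meson half_gt_zero)
    obtain r where r: "r \<in> D" "t < r" "r < min h (t + min d1 d2)" using dense[of t "min h (t + min d1 d2)"] t d1 d2 by auto
    have rd: "\<bar>r - t\<bar> < d1" "r - t < d2" using r by (auto simp: min_def split: if_splits)
    have "x r > x t - e/2" using d1(2)[OF rd(1)] unfolding abs_diff_less_iff by simp
    moreover have "x (\<theta> r) < x y + e/2"
    proof (cases "\<theta> r \<le> t + T")
      case True
      then show ?thesis using ym[of "\<theta> r"] \<theta>\<delta>[of r] r \<open>e > 0\<close> by auto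
    next
      case False
      then have "\<bar>\<theta> r - (t+T)\<bar> < d2" using \<theta>x(2)[OF r(1)] rd by simp
      from d2(2)[OF this] have "x (\<theta> r) < x (t+T) + e/2" unfolding abs_diff_less_iff by simp
      moreover have "x (t+T) \<le> x y" using \<delta>T by (intro ym) simp
      ultimately show ?thesis by linarith
    qed
    ultimately show False using \<theta>x(1)[OF r(1)] by (simp add: e_def field_simps)
  qed
  then have xy: "x y = x t" using tm2[of y] y \<delta> t by auto
  show False
  \<comment> \<open>Below t + T both points fit into a window that starts in \<open>D\<close> just
    before t. In the extreme case y = t + T the point s has the same height and ties with t in
    \<open>[0, T]\<close>.\<close>
  proof (cases "y < t + T")
    case True
    obtain r where r: "r \<in> D" "max 0 (y - T) < r" "r < t" using dense[of "max 0 (y-T)" t] True t by auto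
    have "wsup r (r+T) x = x t"
    proof (rule wsup_eqI)
      show "t \<in> {r..r+T}" using r y \<delta> by auto
      show "x z \<le> x t" if "z \<in> {r..r+T}" for z
        using that r t by (intro tm2) auto
    qed
    moreover have "y - T < r" using r(2) by simp
    then have "y \<in> {r..r+T}" "t \<in> {r..r+T}" using r(3) y \<delta> unfolding atLeastAtMost_iff by linarith+
    ultimately have "y = t" using xy by - (rule uniq[OF r(1)], simp_all)
    then show False using y \<delta> by auto
  next
    case False
    then have "y = t + T" using y by auto
    then have "x s \<ge> x t" using wloc_max[OF x T(2), of y] t h xy by (auto simp: s_def)
    then have "x s = x t" using tm[of s] s sT h by auto
    moreover have "wsup 0 T x = x t" using wloc_sup[OF x T(1)] by (simp add: t_def)
    moreover have "s \<in> {0..0+T}" "t \<in> {0..0+T}" using s sT t h by auto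
    ultimately have "s = t" by - (rule uniq[OF h(3)], simp_all)
    then show False using s t by auto
  qed
qed

text \<open>Either both maximisers lie in the common part \<open>[h, T]\<close> and coincide by
  uniqueness, or the first lies before h and the second after T, and then neither is in
  \<open>(a, b]\<close>. Half of the second alternative is \<open>argmax_jump\<close>; the other
  half is the same lemma for the path reflected about (h + T) / 2. The reflection sends the window
  at r to the window at h - r, which explains the closure condition on \<open>D\<close>.\<close>

lemma argmax_shift_iff:
  assumes x: "continuous_on UNIV x" and h: "0 < h" "h < T" "0 \<in> D" "h \<in> D"
    and dense: "\<And>u v. u < v \<Longrightarrow> \<exists>r\<in>D. u < r \<and> r < v"
    and refl: "\<And>r. r \<in> D \<Longrightarrow> h - r \<in> D"
    and uniq: "\<And>r s t. r \<in> D \<Longrightarrow> s \<in> {r..r+T} \<Longrightarrow> t \<in> {r..r+T} \<Longrightarrow> x s = wsup r (r+T) x \<Longrightarrow> x t = wsup r (r+T) x \<Longrightarrow> s = t"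
    and int: "\<And>r. r \<in> D \<Longrightarrow> wloc r (r+T) x \<in> {r<..<r+T}"
    and fin: "\<And>c d. finite {t\<in>{c<..<d}. local_max_at x t}"
    and ab: "h < a" "b < T"
  shows "wloc 0 T x \<in> {a<..b} \<longleftrightarrow> wloc h (h+T) x \<in> {a<..b}"
proof -
  have T: "0 \<le> T" "h \<le> h + T" using h by auto
  define t where "t = wloc 0 T x"
  define s where "s = wloc h (h+T) x"
  have 1: "t < h \<Longrightarrow> T < s"
    unfolding t_def s_def by (rule argmax_jump[OF x h dense uniq int fin])
  have 2: "t < h" if "T < s"
  proof -
    define y where "y u = x (h + T - u)" for u
    have yc: "continuous_on UNIV y"
      unfolding y_def by (intro continuous_on_compose2[OF x] continuous_intros) auto
    have img: "(\<lambda>u. h + T - u) ` {r..r+T} = {h-r..h-r+T}" for r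
      by (simp add: algebra_simps)
    have ysup: "wsup r (r+T) y = wsup (h-r) (h-r+T) x" for r
    proof -
      have "y ` {r..r+T} = x ` {h-r..h-r+T}"
        unfolding y_def img[symmetric] by (simp only: image_image)
      then show ?thesis by (simp add: wsup_def)
    qed
    have yuniq: "s' = t'"
      if "r \<in> D" "s' \<in> {r..r+T}" "t' \<in> {r..r+T}" "y s' = wsup r (r+T) y" "y t' = wsup r (r+T) y" for r s' t'
      proof -
      have "h + T - s' = h + T - t'"
        using that unfolding ysup y_def by - (rule uniq[OF refl[OF that(1)]], simp_all)
      then show ?thesis by simp
    qed
    \<comment> \<open>Reflection turns leftmost maximisers into rightmost ones; uniqueness makes
      them the same point.\<close>
    have yloc: "wloc r (r+T) y = h + T - wloc (h-r) (h-r+T) x" if "r \<in> D" for r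
    proof -
      have rT: "r \<le> r + T" "h - r \<le> h-r+T" using T by auto
      show ?thesis
      proof (rule yuniq[OF that])
        show "wloc r (r+T) y \<in> {r..r+T}" "y (wloc r (r+T) y) = wsup r (r+T) y"
          by (rule wloc_in[OF yc rT(1)], rule wloc_sup[OF yc rT(1)])
        show "h + T - wloc (h-r) (h-r+T) x \<in> {r..r+T}"
          using wloc_in[OF x rT(2)] by auto
        show "y (h + T - wloc (h-r) (h-r+T) x) = wsup r (r+T) y"
          unfolding ysup by (simp add: y_def wloc_sup[OF x rT(2)])
      qed
    qed
    have ylm: "local_max_at y u \<Longrightarrow> local_max_at x (h + T - u)" for u
    proof -
      assume "local_max_at y u"
      then obtain e where "e > 0" and e: "\<And>s. s \<in> {u-e..u+e} \<Longrightarrow> y s \<le> y u"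
        by (rule local_max_at_interval) (rule that)
      then show ?thesis
      proof (intro local_max_atI[of "h+T-u-e" _ "h+T-u+e"])
        show "x s \<le> x (h + T - u)" if "s \<in> {h+T-u-e..h+T-u+e}" for s
          using e[of "h + T - s"] that by (simp add: y_def)
      qed auto
    qed
    have yfin: "finite {t\<in>{c<..<d}. local_max_at y t}" for c d
    proof (rule finite_subset)
      show "{t\<in>{c<..<d}. local_max_at y t} \<subseteq> (\<lambda>u. h + T - u) ` {t\<in>{h+T-d<..<h+T-c}. local_max_at x t}"
      proof
        fix u assume u: "u \<in> {t\<in>{c<..<d}. local_max_at y t}"
        show "u \<in> (\<lambda>u. h + T - u) ` {t\<in>{h+T-d<..<h+T-c}. local_max_at x t}"
          by (rule image_eqI[of _ _ "h + T - u"]) (use u ylm[of u] in auto)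
      qed
      show "finite ((\<lambda>u. h + T - u) ` {t\<in>{h+T-d<..<h+T-c}. local_max_at x t})"
        using fin by (intro finite_imageI)
    qed
    have yint: "wloc r (r+T) y \<in> {r<..<r+T}" if "r \<in> D" for r
      using int[OF refl[OF that]] by (auto simp: yloc[OF that])
    have "T < wloc h (h+T) y"
    proof (rule argmax_jump[OF yc h dense yuniq yint yfin])
      show "wloc 0 T y < h" using yloc[OF h(3)] \<open>T < s\<close> by (simp add: s_def)
    qed
    then show ?thesis using yloc[OF h(4)] by (simp add: t_def)
  qed
  have 3: "s = t" if "t \<in> {h..T}" "s \<in> {h..T}"
  proof -
    have "x t \<le> x s" using wloc_max[OF x T(2), of t] that h by (auto simp: s_def)
    moreover have "x s \<le> x t" using wloc_max[OF x T(1), of s] that h by (auto simp: t_def)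
    moreover have "wsup 0 T x = x t" using wloc_sup[OF x T(1)] by (simp add: t_def)
    moreover have "s \<in> {0..0+T}" "t \<in> {0..0+T}" using that h by auto
    ultimately show ?thesis by - (rule uniq[OF h(3)], simp_all)
  qed
  have "t \<in> {0..T}" "s \<in> {h..h+T}" using wloc_in[OF x T(1)] wloc_in[OF x T(2)] by (auto simp: s_def t_def)
  then show ?thesis unfolding s_def[symmetric] t_def[symmetric]
    using 1 2 3 ab by (cases "s \<le> T"; cases "t < h") auto
qed

section \<open>Stationary processes with continuous paths\<close>

abbreviation PiR :: "(real \<Rightarrow> real) measure" where
  "PiR \<equiv> Pi\<^sub>M UNIV (\<lambda>_. borel)"

text \<open>Restricting the product \<sigma>-algebra to continuous paths makes suprema over
  intervals measurable, since they reduce to countable suprema there.\<close>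

definition path_space :: "(real \<Rightarrow> real) measure" where
  "path_space = restrict_space PiR {x. continuous_on UNIV x}"

lemma space_path_space: "space path_space = {x. continuous_on UNIV x}"
  by (simp add: path_space_def space_restrict_space space_PiM)

lemma measurable_path_eval: "(\<lambda>x. x t) \<in> borel_measurable path_space"
  unfolding path_space_def by (rule measurable_restrict_space1) measurable

section \<open>Measurability of suprema, locations, local maxima and ties\<close>

text \<open>The endpoints are adjoined to cover a maximiser sitting there, in particular a window
  that consists of one irrational point.\<close>

lemma wsup_countable:
  assumes x: "continuous_on UNIV x" and ab: "a \<le> b"
  shows "wsup a b x = (SUP q\<in>insert a (insert b (\<rat> \<inter> {a..b})). x q)"
proof (rule antisym)
  let ?D = "insert a (insert b (\<rat> \<inter> {a..b}))"
  have D: "?D \<subseteq> {a..b}" using ab by auto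
  have bdd: "bdd_above (x ` ?D)"
    by (rule bdd_aboveI[of _ "wsup a b x"]) (use D wsup_ge[OF x] in blast)
  show "(SUP q\<in>?D. x q) \<le> wsup a b x"
    by (rule cSUP_least) (use D wsup_ge[OF x] in blast)+
  show "wsup a b x \<le> (SUP q\<in>?D. x q)"
  proof -
    let ?t = "wloc a b x"
    have t: "?t \<in> {a..b}" "x ?t = wsup a b x" using wloc_in[OF x ab] wloc_sup[OF x ab] by auto
    show ?thesis
    proof (cases "?t = a \<or> ?t = b")
      case True
      then have "?t \<in> ?D" by auto
      from cSUP_upper[OF this bdd] t show ?thesis by simp
    next
      case False
      then have tt: "a < ?t" "?t < b" using t by auto
      show ?thesis
      proof (rule field_le_epsilon)
        fix e :: real assume "e > 0"
        have "isCont x ?t" using x by (simp add: continuous_on_eq_continuous_at)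
        then obtain d where d: "d > 0" "\<forall>z. \<bar>z - ?t\<bar> < d \<longrightarrow> \<bar>x z - x ?t\<bar> < e"
          using \<open>e > 0\<close> unfolding continuous_at_eps_delta dist_real_def by blast
        obtain q where q: "q \<in> \<rat>" "?t < q" "q < min b (?t + d)"
          using Rats_dense_in_real[of ?t "min b (?t + d)"] d tt by auto
        have "\<bar>q - ?t\<bar> < d" using q by (simp add: min_less_iff_conj)
        then have "\<bar>x q - x ?t\<bar> < e" using d by blast
        then have "x ?t < x q + e" unfolding abs_diff_less_iff by simp
        moreover have "q \<in> ?D" using q tt by simp
        from cSUP_upper[OF this bdd] have "x q \<le> (SUP q\<in>?D. x q)" .
        ultimately show "wsup a b x \<le> (SUP q\<in>?D. x q) + e" using t by simp
      qed
    qed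
  qed
qed

lemma measurable_wsup [measurable]: "wsup a b \<in> borel_measurable path_space"
proof (cases "a \<le> b")
  case True
  have "(\<lambda>x. SUP q\<in>insert a (insert b (\<rat> \<inter> {a..b})). x q) \<in> borel_measurable path_space"
  proof (rule borel_measurable_cSUP)
    show "countable (insert a (insert b (\<rat> \<inter> {a..b})))" using countable_rat by auto
    show "bdd_above ((\<lambda>q. x q) ` insert a (insert b (\<rat> \<inter> {a..b})))" if "x \<in> space path_space" for x
    proof (rule bdd_aboveI[of _ "wsup a b x"])
      fix y assume "y \<in> x ` insert a (insert b (\<rat> \<inter> {a..b}))"
      then obtain q where "q \<in> {a..b}" "y = x q" using True by auto
      then show "y \<le> wsup a b x" using wsup_ge[of x q a b] that by (simp add: space_path_space)
    qed
  qed (rule measurable_path_eval)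
  then show ?thesis
    by (subst measurable_cong[OF wsup_countable]) (simp_all add: space_path_space True)
next
  case False
  then show ?thesis unfolding wsup_def by simp
qed

lemma measurable_wloc [measurable]: "wloc a b \<in> borel_measurable path_space" if "a \<le> b"
proof (rule borel_measurable_iff_le[THEN iffD2], rule allI)
  fix c
  consider "c < a" | "b < c" | "a \<le> c" "c \<le> b" by linarith
  then show "{x \<in> space path_space. wloc a b x \<le> c} \<in> sets path_space"
  proof cases
    case 1
    then have "\<not> wloc a b x \<le> c" if "x \<in> space path_space" for x
      using wloc_in[OF _ \<open>a \<le> b\<close>, of x] that by (simp add: space_path_space)
    then have e: "{x \<in> space path_space. wloc a b x \<le> c} = {}" by blast
    show ?thesis unfolding e by simp
  next
    case 2
    then have "wloc a b x \<le> c" if "x \<in> space path_space" for x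
      using wloc_in[OF _ \<open>a \<le> b\<close>, of x] that by (simp add: space_path_space)
    then have "{x \<in> space path_space. wloc a b x \<le> c} = space path_space" by blast
    then show ?thesis by simp
  next
    case 3
    then have "{x \<in> space path_space. wloc a b x \<le> c} = {x \<in> space path_space. wsup c b x \<le> wsup a c x}"
      using wloc_le_iff[of _ a c b] by (auto simp: space_path_space)
    then show ?thesis by simp
  qed
qed

lemma pred_Bex_Rats:
  assumes "\<And>a::real. Measurable.pred N (P a)"
  shows "Measurable.pred N (\<lambda>x. \<exists>a\<in>\<rat>. P a x)"
  using assms unfolding pred_def by (intro sets.sets_Collect_countable_Ex' countable_rat)

lemma pred_wsup_le [measurable]: "Measurable.pred path_space (\<lambda>x. wsup a b x \<le> wsup p q x)"
  unfolding pred_def by (rule borel_measurable_le) (rule measurable_wsup)+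

definition has_local_max :: "real \<Rightarrow> real \<Rightarrow> (real \<Rightarrow> real) \<Rightarrow> bool" where
  "has_local_max c d x \<longleftrightarrow> (\<exists>t\<in>{c<..<d}. local_max_at x t)"

lemma pred_has_local_max [measurable]: "Measurable.pred path_space (has_local_max c d)"
proof -
  have p: "Measurable.pred path_space (\<lambda>x. \<exists>a\<in>\<rat>. \<exists>p\<in>\<rat>. \<exists>q\<in>\<rat>. \<exists>b\<in>\<rat>. c < a \<and> a < p \<and> p < q \<and> q < b \<and> b < d \<and> wsup a b x \<le> wsup p q x)"
    by (rule pred_Bex_Rats, rule pred_Bex_Rats, rule pred_Bex_Rats, rule pred_Bex_Rats) (intro pred_intros_logic pred_wsup_le; simp)
  have "has_local_max c d x \<longleftrightarrow> (\<exists>a\<in>\<rat>. \<exists>p\<in>\<rat>. \<exists>q\<in>\<rat>. \<exists>b\<in>\<rat>. c < a \<and> a < p \<and> p < q \<and> q < b \<and> b < d \<and> wsup a b x \<le> wsup p q x)" if "x \<in> space path_space" for x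
    unfolding has_local_max_def using that by - (rule ex_local_max_iff, simp add: space_path_space)
  note e = this
  show ?thesis by (rule measurable_cong[OF e, THEN iffD2]) (assumption, rule p)
qed

definition has_tie :: "real \<Rightarrow> real \<Rightarrow> (real \<Rightarrow> real) \<Rightarrow> bool" where
  "has_tie a b x \<longleftrightarrow> (\<exists>s\<in>{a..b}. \<exists>t\<in>{a..b}. s \<noteq> t \<and> x s = wsup a b x \<and> x t = wsup a b x)"

text \<open>Two rationals separate the two maximisers, which turns the event into a countable union
  of comparisons of suprema.\<close>

lemma has_tie_iff:
  assumes x: "continuous_on UNIV x" and "a \<le> b"
  shows "has_tie a b x \<longleftrightarrow> (\<exists>c\<in>\<rat>. \<exists>d\<in>\<rat>. a \<le> c \<and> c < d \<and> d \<le> b \<and> wsup a b x \<le> wsup a c x \<and> wsup a b x \<le> wsup d b x)"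
proof
  assume "has_tie a b x"
  then obtain s t where *: "s \<in> {a..b}" "t \<in> {a..b}" "s < t" "x s = wsup a b x" "x t = wsup a b x"
    unfolding has_tie_def by (metis linorder_neqE_linordered_idom)
  obtain c where c: "c \<in> \<rat>" "s < c" "c < t" using Rats_dense_in_real[OF \<open>s < t\<close>] by auto
  obtain d where d: "d \<in> \<rat>" "c < d" "d < t" using Rats_dense_in_real[OF \<open>c < t\<close>] by auto
  have "wsup a b x \<le> wsup a c x" using wsup_ge[OF x, of s a c] * c by auto
  moreover have "wsup a b x \<le> wsup d b x" using wsup_ge[OF x, of t d b] * d by auto
  ultimately show "\<exists>c\<in>\<rat>. \<exists>d\<in>\<rat>. a \<le> c \<and> c < d \<and> d \<le> b \<and> wsup a b x \<le> wsup a c x \<and> wsup a b x \<le> wsup d b x"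
    using c d * by (intro bexI[of _ c] bexI[of _ d]) auto
next
  assume "\<exists>c\<in>\<rat>. \<exists>d\<in>\<rat>. a \<le> c \<and> c < d \<and> d \<le> b \<and> wsup a b x \<le> wsup a c x \<and> wsup a b x \<le> wsup d b x"
  then obtain c d where cd: "a \<le> c" "c < d" "d \<le> b" "wsup a b x \<le> wsup a c x" "wsup a b x \<le> wsup d b x" by blast
  have 1: "wloc a c x \<in> {a..c}" "x (wloc a c x) = wsup a c x" using wloc_in[OF x cd(1)] wloc_sup[OF x cd(1)] by auto
  have 2: "wloc d b x \<in> {d..b}" "x (wloc d b x) = wsup d b x" using wloc_in[OF x cd(3)] wloc_sup[OF x cd(3)] by auto
  have 3: "wloc a c x \<in> {a..b}" "wloc d b x \<in> {a..b}" "wloc a c x \<noteq> wloc d b x" using 1 2 cd by auto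
  show "has_tie a b x"
    unfolding has_tie_def
    using 3 1(2) 2(2) cd wsup_ge[OF x 3(1)] wsup_ge[OF x 3(2)]
    by (intro bexI[of _ "wloc a c x"] bexI[of _ "wloc d b x"]) auto
qed

lemma pred_has_tie [measurable]: "Measurable.pred path_space (has_tie a b)" if "a \<le> b"
proof -
  have p: "Measurable.pred path_space (\<lambda>x. \<exists>c\<in>\<rat>. \<exists>d\<in>\<rat>. a \<le> c \<and> c < d \<and> d \<le> b \<and> wsup a b x \<le> wsup a c x \<and> wsup a b x \<le> wsup d b x)"
    by (rule pred_Bex_Rats, rule pred_Bex_Rats) (intro pred_intros_logic pred_wsup_le; simp)
  have "has_tie a b x \<longleftrightarrow> (\<exists>c\<in>\<rat>. \<exists>d\<in>\<rat>. a \<le> c \<and> c < d \<and> d \<le> b \<and> wsup a b x \<le> wsup a c x \<and> wsup a b x \<le> wsup d b x)" if "x \<in> space path_space" for x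
    using that \<open>a \<le> b\<close> by - (rule has_tie_iff, simp_all add: space_path_space)
  note e = this
  show ?thesis by (rule measurable_cong[OF e, THEN iffD2]) (assumption, rule p)
qed

lemma has_tie_shift: "has_tie a b (\<lambda>t. x (t + h)) \<longleftrightarrow> has_tie (a + h) (b + h) x"
proof
  assume "has_tie a b (\<lambda>t. x (t + h))"
  then obtain s t where "s \<in> {a..b}" "t \<in> {a..b}" "s \<noteq> t" "x (s + h) = wsup (a + h) (b + h) x" "x (t + h) = wsup (a + h) (b + h) x"
    unfolding has_tie_def wsup_shift by blast
  then show "has_tie (a + h) (b + h) x"
    unfolding has_tie_def by (intro bexI[of _ "s + h"] bexI[of _ "t + h"]) auto
next
  assume "has_tie (a + h) (b + h) x"
  then obtain s t where "s \<in> {a+h..b+h}" "t \<in> {a+h..b+h}" "s \<noteq> t" "x s = wsup (a + h) (b + h) x" "x t = wsup (a + h) (b + h) x"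
    unfolding has_tie_def by blast
  then show "has_tie a b (\<lambda>t. x (t + h))"
    unfolding has_tie_def wsup_shift by (intro bexI[of _ "s - h"] bexI[of _ "t - h"]) auto
qed

lemma has_local_max_shift: "has_local_max c d (\<lambda>t. x (t + h)) \<longleftrightarrow> has_local_max (c + h) (d + h) x"
proof
  assume "has_local_max c d (\<lambda>t. x (t + h))"
  then obtain t where "t \<in> {c<..<d}" "local_max_at x (t + h)"
    unfolding has_local_max_def local_max_shift by blast
  then show "has_local_max (c + h) (d + h) x"
    unfolding has_local_max_def by (intro bexI[of _ "t + h"]) auto
next
  assume "has_local_max (c + h) (d + h) x"
  then obtain t where "t \<in> {c+h<..<d+h}" "local_max_at x t" unfolding has_local_max_def by blast
  then show "has_local_max c d (\<lambda>t. x (t + h))"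
    unfolding has_local_max_def local_max_shift by (intro bexI[of _ "t - h"]) auto
qed

section \<open>Shift invariance of path laws and of the location of the maximum\<close>

locale stationary_cont = prob_space M for M :: "'a measure" +
  fixes X :: "real \<Rightarrow> 'a \<Rightarrow> real"
  assumes meas [measurable]: "\<And>t. X t \<in> borel_measurable M"
    and cont: "\<And>\<omega>. \<omega> \<in> space M \<Longrightarrow> continuous_on UNIV (\<lambda>t. X t \<omega>)"
    and stat: "stationary_process M X"
begin

abbreviation path :: "'a \<Rightarrow> real \<Rightarrow> real" where
  "path \<omega> \<equiv> (\<lambda>t. X t \<omega>)"

lemma measurable_path_shift: "(\<lambda>\<omega> t. X (t + h) \<omega>) \<in> measurable M path_space"
  unfolding path_space_def
proof (rule measurable_restrict_space2)
  show "(\<lambda>\<omega> t. X (t + h) \<omega>) \<in> space M \<rightarrow> {x. continuous_on UNIV x}"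
    using continuous_shift[OF cont] by auto
  show "(\<lambda>\<omega> t. X (t + h) \<omega>) \<in> measurable M PiR"
    by (rule measurable_abs_UNIV) measurable
qed

lemma measurable_path [measurable]: "path \<in> measurable M path_space"
  using measurable_path_shift[of 0] by simp

lemma distr_PiR_shift: "distr M PiR (\<lambda>\<omega> t. X (t + h) \<omega>) = distr M PiR path"
proof (rule measure_eqI_PiM_infinite)
  have m: "(\<lambda>\<omega> t. X (t + h) \<omega>) \<in> measurable M PiR" for h
    by (rule measurable_abs_UNIV) measurable
  have m0: "path \<in> measurable M PiR" using m[of 0] by simp
  show "finite_measure (distr M PiR (\<lambda>\<omega> t. X (t + h) \<omega>))"
    using prob_space_distr[OF m] by (rule prob_space.finite_measure)
  fix A :: "real \<Rightarrow> real set" and J :: "real set"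
  assume J: "finite J" "J \<subseteq> UNIV" and A: "\<And>i. i \<in> J \<Longrightarrow> A i \<in> sets borel"
  have mJ: "(\<lambda>\<omega>. \<lambda>i\<in>J. X (i + h) \<omega>) \<in> measurable M (Pi\<^sub>M J (\<lambda>_. borel))" for h
    by (rule measurable_restrict) measurable
  have PE: "Pi\<^sub>E J A \<in> sets (Pi\<^sub>M J (\<lambda>_. borel))"
    using A J by (intro sets_PiM_I_finite) auto
  have emb: "prod_emb UNIV (\<lambda>_. borel) J (Pi\<^sub>E J A) \<in> sets PiR"
    by (rule sets_PiM_I) (use J A in auto)
  have *: "emeasure (distr M PiR (\<lambda>\<omega> t. X (t + h) \<omega>)) (prod_emb UNIV (\<lambda>_. borel) J (Pi\<^sub>E J A)) =
    emeasure (distr M (Pi\<^sub>M J (\<lambda>_. borel)) (\<lambda>\<omega>. \<lambda>i\<in>J. X (i + h) \<omega>)) (Pi\<^sub>E J A)" for h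
    unfolding emeasure_distr[OF m emb] emeasure_distr[OF mJ PE]
    by (intro arg_cong[of _ _ "emeasure M"]) (auto simp: prod_emb_def PiE_iff extensional_def restrict_def)
  show "emeasure (distr M PiR (\<lambda>\<omega> t. X (t + h) \<omega>)) (prod_emb UNIV (\<lambda>_. borel) J (Pi\<^sub>E J A)) =
    emeasure (distr M PiR path) (prod_emb UNIV (\<lambda>_. borel) J (Pi\<^sub>E J A))"
    using *[of h] *[of 0] stat J unfolding stationary_process_def by simp
qed simp_all

lemma distr_path_shift: "distr M path_space (\<lambda>\<omega> t. X (t + h) \<omega>) = distr M path_space path"
proof (rule measure_eqI)
  fix A assume "A \<in> sets (distr M path_space (\<lambda>\<omega> t. X (t + h) \<omega>))"
  then have A: "A \<in> sets path_space" by simp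
  then obtain B where B: "B \<in> sets PiR" "A = {x. continuous_on UNIV x} \<inter> B"
    unfolding path_space_def sets_restrict_space by auto
  have *: "emeasure (distr M path_space (\<lambda>\<omega> t. X (t + h) \<omega>)) A = emeasure (distr M PiR (\<lambda>\<omega> t. X (t + h) \<omega>)) B" for h
  proof -
    have m: "(\<lambda>\<omega> t. X (t + h) \<omega>) \<in> measurable M PiR"
      by (rule measurable_abs_UNIV) measurable
    show ?thesis
      unfolding emeasure_distr[OF measurable_path_shift A] emeasure_distr[OF m B(1)]
      unfolding B(2) using continuous_shift[OF cont] by (intro arg_cong[of _ _ "emeasure M"]) auto
  qed
  show "emeasure (distr M path_space (\<lambda>\<omega> t. X (t + h) \<omega>)) A = emeasure (distr M path_space path) A"
    using *[of h] *[of 0] distr_PiR_shift[of h] by simp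
qed simp

text \<open>The form in which stationarity is used: for every measurable property of the whole path,
  beyond finitely many coordinates.\<close>

lemma prob_path_shift:
  assumes [measurable]: "Measurable.pred path_space Q"
  shows "prob {\<omega>\<in>space M. Q (\<lambda>t. X (t + h) \<omega>)} = prob {\<omega>\<in>space M. Q (path \<omega>)}"
proof -
  have Q: "{x \<in> space path_space. Q x} \<in> sets path_space" by measurable
  have *: "measure (distr M path_space (\<lambda>\<omega> t. X (t + h) \<omega>)) {x \<in> space path_space. Q x} = prob {\<omega>\<in>space M. Q (\<lambda>t. X (t + h) \<omega>)}" for h
    unfolding measure_distr[OF measurable_path_shift Q]
    using continuous_shift[OF cont] by (intro arg_cong[of _ _ prob]) (auto simp: space_path_space)
  show ?thesis using *[of h] *[of 0] distr_path_shift[of h] by simp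
qed

lemma AE_path_shift:
  assumes Q [measurable]: "Measurable.pred path_space Q" and AE: "AE \<omega> in M. Q (path \<omega>)"
  shows "AE \<omega> in M. Q (\<lambda>t. X (t + h) \<omega>)"
proof -
  have 1: "{x \<in> space path_space. Q x} \<in> sets path_space" by measurable
  have "AE x in distr M path_space path. Q x"
    using AE by (subst AE_distr_iff[OF measurable_path 1])
  then have "AE x in distr M path_space (\<lambda>\<omega> t. X (t + h) \<omega>). Q x"
    by (simp only: distr_path_shift)
  then show ?thesis
    by (subst (asm) AE_distr_iff[OF measurable_path_shift 1])
qed

definition loc :: "real \<Rightarrow> real \<Rightarrow> 'a \<Rightarrow> real" where
  "loc a b \<omega> = wloc a b (path \<omega>)"

lemma measurable_loc [measurable]: "loc a b \<in> borel_measurable M" if "a \<le> b"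
  unfolding loc_def using that by measurable

lemma loc_in: "a \<le> b \<Longrightarrow> \<omega> \<in> space M \<Longrightarrow> a \<le> loc a b \<omega>" "a \<le> b \<Longrightarrow> \<omega> \<in> space M \<Longrightarrow> loc a b \<omega> \<le> b"
  unfolding loc_def using wloc_in[OF cont, of \<omega> a b] by auto

lemma prob_loc_shift:
  assumes ab: "a \<le> b" and B [measurable]: "B \<in> sets borel"
  shows "prob {\<omega>\<in>space M. loc (a + h) (b + h) \<omega> - h \<in> B} = prob {\<omega>\<in>space M. loc a b \<omega> \<in> B}"
proof -
  have "{x \<in> space path_space. wloc a b x \<in> B} = wloc a b -` B \<inter> space path_space" by auto
  also have "\<dots> \<in> sets path_space" by (rule measurable_sets[OF measurable_wloc[OF ab] B])
  finally have "Measurable.pred path_space (\<lambda>x. wloc a b x \<in> B)" by (simp add: pred_def)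
  from prob_path_shift[OF this, of h] have "prob {\<omega>\<in>space M. wloc a b (\<lambda>t. X (t + h) \<omega>) \<in> B} = prob {\<omega>\<in>space M. wloc a b (path \<omega>) \<in> B}" .
  moreover have "{\<omega>\<in>space M. wloc a b (\<lambda>t. X (t + h) \<omega>) \<in> B} = {\<omega>\<in>space M. loc (a + h) (b + h) \<omega> - h \<in> B}"
    using wloc_shift[OF cont ab, of _ h] unfolding loc_def by auto
  ultimately show ?thesis unfolding loc_def by simp
qed

lemma prob_has_local_max: "prob {\<omega>\<in>space M. has_local_max c d (path \<omega>)} = prob {\<omega>\<in>space M. has_local_max 0 (d - c) (path \<omega>)}"
  using prob_path_shift[OF pred_has_local_max, of 0 "d - c" c] has_local_max_shift[of 0 "d - c" "path \<omega>" c for \<omega>]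
  by simp

text \<open>Open intervals keep the possible atoms at 0 and T out of the interior mass
  \<open>\<nu> T 0 T\<close>. Interior points turn out to be null under Assumption L, so nothing
  else is lost.\<close>

definition \<nu> :: "real \<Rightarrow> real \<Rightarrow> real \<Rightarrow> real" where
  "\<nu> T c d = prob {\<omega>\<in>space M. loc 0 T \<omega> \<in> {c<..<d}}"

lemma prob_loc_window:
  assumes "0 \<le> T"
  shows "prob {\<omega>\<in>space M. loc a (a + T) \<omega> \<in> {a + c<..<a + d}} = \<nu> T c d"
proof -
  have "{\<omega>\<in>space M. loc a (a + T) \<omega> \<in> {a + c<..<a + d}} = {\<omega>\<in>space M. loc (0 + a) (T + a) \<omega> - a \<in> {c<..<d}}"
    by (auto simp: add.commute)
  then show ?thesis
    using prob_loc_shift[OF assms, of "{c<..<d}" a] by (simp add: \<nu>_def)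
qed

lemma loc_subinterval:
  assumes "\<omega> \<in> space M" "a \<le> a'" "b' \<le> b" "loc a b \<omega> \<in> {a'..b'}"
  shows "loc a' b' \<omega> = loc a b \<omega>"
  using wloc_subinterval[OF cont] assms unfolding loc_def by blast

text \<open>The window of length T starting at x - t lies inside \<open>[0, T']\<close> and shows x
  at relative position t; a maximum over the long window near x is also its maximum. This serves for
  neighbouring grid cells as well as for windows much longer than T.\<close>

lemma \<nu>_antimono:
  assumes "0 \<le> T" "T \<le> T'" "t \<le> x" "x \<le> t + (T' - T)" "0 \<le> t" "t + w \<le> T"
  shows "\<nu> T' x (x + w) \<le> \<nu> T t (t + w)"
proof -
  let ?a = "x - t"
  have [measurable]: "loc ?a (?a + T) \<in> borel_measurable M" using assms by (intro measurable_loc) auto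
  have "\<nu> T' x (x + w) \<le> prob {\<omega>\<in>space M. loc ?a (?a + T) \<omega> \<in> {?a + t<..<?a + (t + w)}}"
    unfolding \<nu>_def
  proof (rule finite_measure_mono)
    show "{\<omega> \<in> space M. loc 0 T' \<omega> \<in> {x<..<x + w}} \<subseteq> {\<omega> \<in> space M. loc ?a (?a + T) \<omega> \<in> {?a + t<..<?a + (t + w)}}"
    proof safe
      fix \<omega> assume w: "\<omega> \<in> space M" "loc 0 T' \<omega> \<in> {x<..<x + w}"
      have "loc ?a (?a + T) \<omega> = loc 0 T' \<omega>"
        by (rule loc_subinterval) (use w assms in auto)
      then show "loc ?a (?a + T) \<omega> \<in> {?a + t<..<?a + (t + w)}" using w by simp
    qed
  qed measurable
  then show ?thesis using prob_loc_window[OF \<open>0 \<le> T\<close>, of ?a t "t + w"] by simp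
qed

lemma \<nu>_mass_eq:
  assumes "0 < T"
  shows "\<nu> T 0 T = 1 - prob {\<omega>\<in>space M. loc 0 T \<omega> = 0} - prob {\<omega>\<in>space M. loc 0 T \<omega> = T}"
proof -
  have [measurable]: "loc 0 T \<in> borel_measurable M" using assms by simp
  have "space M = {\<omega>\<in>space M. loc 0 T \<omega> \<in> {0<..<T}} \<union> ({\<omega>\<in>space M. loc 0 T \<omega> = 0} \<union> {\<omega>\<in>space M. loc 0 T \<omega> = T})"
    using loc_in[of 0 T] assms by (auto simp: less_le)
  then have "1 = prob ({\<omega>\<in>space M. loc 0 T \<omega> \<in> {0<..<T}} \<union> ({\<omega>\<in>space M. loc 0 T \<omega> = 0} \<union> {\<omega>\<in>space M. loc 0 T \<omega> = T}))"
    using prob_space by simp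
  also have "\<dots> = \<nu> T 0 T + prob ({\<omega>\<in>space M. loc 0 T \<omega> = 0} \<union> {\<omega>\<in>space M. loc 0 T \<omega> = T})"
    unfolding \<nu>_def by (rule finite_measure_Union) auto
  also have "prob ({\<omega>\<in>space M. loc 0 T \<omega> = 0} \<union> {\<omega>\<in>space M. loc 0 T \<omega> = T}) = prob {\<omega>\<in>space M. loc 0 T \<omega> = 0} + prob {\<omega>\<in>space M. loc 0 T \<omega> = T}"
    by (rule finite_measure_Union) (use assms in auto)
  finally show ?thesis by simp
qed

text \<open>Only the atoms at the two endpoints can shrink when the window grows: a maximum at an
  end of the long window is also the maximum over the subwindow of length T sharing that
  end.\<close>

lemma \<nu>_mass_mono:
  assumes "0 < T" "T \<le> T'"
  shows "\<nu> T 0 T \<le> \<nu> T' 0 T'"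
proof -
  have [measurable]: "loc 0 T \<in> borel_measurable M" "loc 0 T' \<in> borel_measurable M" "loc (T' - T) T' \<in> borel_measurable M"
    using assms by simp_all
  have 1: "prob {\<omega>\<in>space M. loc 0 T' \<omega> = 0} \<le> prob {\<omega>\<in>space M. loc 0 T \<omega> = 0}"
  proof (rule finite_measure_mono)
    show "{\<omega>\<in>space M. loc 0 T' \<omega> = 0} \<subseteq> {\<omega>\<in>space M. loc 0 T \<omega> = 0}"
      using assms loc_subinterval[of _ 0 0 T T'] by auto
  qed measurable
  have "prob {\<omega>\<in>space M. loc 0 T' \<omega> = T'} \<le> prob {\<omega>\<in>space M. loc (T' - T) T' \<omega> = T'}"
  proof (rule finite_measure_mono)
    show "{\<omega>\<in>space M. loc 0 T' \<omega> = T'} \<subseteq> {\<omega>\<in>space M. loc (T' - T) T' \<omega> = T'}"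
      using assms loc_subinterval[of _ 0 "T' - T" T' T'] by auto
  qed measurable
  also have "{\<omega>\<in>space M. loc (T' - T) T' \<omega> = T'} = {\<omega>\<in>space M. loc (0 + (T' - T)) (T + (T' - T)) \<omega> - (T' - T) \<in> {T}}"
    by (auto simp: algebra_simps)
  also have "prob \<dots> = prob {\<omega>\<in>space M. loc 0 T \<omega> = T}"
    using prob_loc_shift[of 0 T "{T}" "T' - T"] assms by simp
  finally show ?thesis using 1 \<nu>_mass_eq[of T] \<nu>_mass_eq[of T'] assms by simp
qed

end

section \<open>Local maxima under Assumption L\<close>

locale stationary_L = stationary_cont +
  assumes L: "assumption_L M X"
begin

lemma sets_path: "Measurable.pred path_space Q \<Longrightarrow> {\<omega>\<in>space M. Q (path \<omega>)} \<in> events"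
  using measurable_compose[OF measurable_path, of Q "count_space UNIV"] by (simp add: pred_def)

lemma sets_has_local_max [measurable]: "{\<omega>\<in>space M. has_local_max c d (path \<omega>)} \<in> events"
  by (rule sets_path[OF pred_has_local_max])

definition lm_prob :: "real \<Rightarrow> real" where
  "lm_prob e = prob {\<omega>\<in>space M. has_local_max 0 e (path \<omega>)}"

text \<open>Assumption L speaks about short intervals; covering by n of them transports it to all
  lengths. The pieces overlap, since adjacent open cells would miss local maxima at grid
  points.\<close>

lemma lm_prob_subadditive:
  assumes e: "e > 0" and n: "n > (0::nat)"
  shows "lm_prob e \<le> real n * lm_prob (2 * e / n)"
proof -
  \<comment> \<open>Cell j of the grid with mesh e / n, widened by half a mesh on either side; hence
    the length 2 * e / n.\<close>
  define c where "c j = (real j - 1/2) * e / n" for j :: nat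
  define d where "d j = (real j + 3/2) * e / n" for j :: nat
  have dc: "d j - c j = 2 * e / n" for j
    unfolding c_def d_def diff_divide_distrib[symmetric] by (simp add: algebra_simps)
  have "lm_prob e \<le> prob (\<Union>j<n. {\<omega>\<in>space M. has_local_max (c j) (d j) (path \<omega>)})"
    unfolding lm_prob_def
  proof (rule finite_measure_mono)
    show "{\<omega>\<in>space M. has_local_max 0 e (path \<omega>)} \<subseteq> (\<Union>j<n. {\<omega>\<in>space M. has_local_max (c j) (d j) (path \<omega>)})"
    proof
      fix \<omega> assume "\<omega> \<in> {\<omega>\<in>space M. has_local_max 0 e (path \<omega>)}"
      then obtain t where t: "0 < t" "t < e" "local_max_at (path \<omega>) t" and w: "\<omega> \<in> space M" by (auto simp: has_local_max_def)
      define j where "j = nat \<lfloor>t * n / e\<rfloor>"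
      have nn: "0 \<le> t * n / e" using t e by simp
      have j: "real j \<le> t * n / e" "t * n / e < real j + 1" using nn unfolding j_def by linarith+
      have "t * n / e < n" using t e n by (simp add: field_simps)
      then have "j < n" using j by linarith
      moreover have "c j < t"
      proof -
        have "(real j - 1/2) * e < t * n" using j(1) e by (simp add: field_simps)
        then show ?thesis using n by (simp add: c_def field_simps)
      qed
      moreover have "t < d j"
      proof -
        have "t * n < (real j + 1) * e" using j(2) e by (simp add: field_simps)
        also have "\<dots> < (real j + 3/2) * e" using e by (intro mult_strict_right_mono) auto
        finally show ?thesis using n by (simp add: d_def field_simps)
      qed
      ultimately show "\<omega> \<in> (\<Union>j<n. {\<omega>\<in>space M. has_local_max (c j) (d j) (path \<omega>)})"
        using t w unfolding has_local_max_def by (intro UN_I[of j]) (auto intro!: bexI[of _ t])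
    qed
  qed auto
  also have "\<dots> \<le> (\<Sum>j<n. prob {\<omega>\<in>space M. has_local_max (c j) (d j) (path \<omega>)})"
    by (rule finite_measure_subadditive_finite) auto
  also have "\<dots> = real n * lm_prob (2 * e / n)"
    by (simp add: prob_has_local_max[of "c _" "d _"] dc lm_prob_def)
  finally show ?thesis .
qed

text \<open>As n grows, n * \<open>lm_prob (2 * e / n)\<close> tends to 2 * K0 * e, where K0 is the
  limit in Assumption L. The factor 2 is the price of the overlap.\<close>

lemma ex_lm_bound: "\<exists>K\<ge>0. \<forall>e>0. lm_prob e \<le> K * e"
proof -
  obtain K0 where K0: "((\<lambda>e. lm_prob e / e) \<longlongrightarrow> K0) (at_right 0)"
    using L unfolding assumption_L_def lm_prob_def has_local_max_def by auto
  have le: "lm_prob e \<le> 2 * K0 * e" if e: "e > 0" for e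
  proof -
    have f: "filterlim (\<lambda>n. 2 * e / real (Suc n)) (at_right 0) sequentially"
      unfolding filterlim_at
    proof
      show "(\<lambda>n. 2 * e / real (Suc n)) \<longlonglongrightarrow> 0"
        using tendsto_mult_left[OF LIMSEQ_inverse_real_of_nat, of "2 * e"] by (simp add: field_simps)
    qed (use e in simp)
    have "(\<lambda>n. lm_prob (2 * e / real (Suc n)) / (2 * e / real (Suc n)) * (2 * e)) \<longlonglongrightarrow> K0 * (2 * e)"
      by (intro tendsto_mult tendsto_const filterlim_compose[OF K0 f])
    moreover have "lm_prob (2 * e / real (Suc n)) / (2 * e / real (Suc n)) * (2 * e) = real (Suc n) * lm_prob (2 * e / real (Suc n))" for n
      using e by (simp del: of_nat_Suc)
    ultimately have "(\<lambda>n. real (Suc n) * lm_prob (2 * e / real (Suc n))) \<longlonglongrightarrow> K0 * (2 * e)"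
      by simp
    then have "lm_prob e \<le> K0 * (2 * e)"
      by (rule LIMSEQ_le_const) (use lm_prob_subadditive[OF e, of "Suc _"] in blast)
    then show ?thesis by (simp add: mult_ac)
  qed
  have "0 \<le> lm_prob 1" by (simp add: lm_prob_def)
  then have "0 \<le> 2 * K0" using le[of 1] by simp
  then show ?thesis using le by blast
qed

definition Kb :: real where "Kb = (SOME K. K \<ge> 0 \<and> (\<forall>e>0. lm_prob e \<le> K * e))"

lemma Kb: "Kb \<ge> 0" "e > 0 \<Longrightarrow> lm_prob e \<le> Kb * e"
proof -
  have "Kb \<ge> 0 \<and> (\<forall>e>0. lm_prob e \<le> Kb * e)"
    unfolding Kb_def by (rule someI_ex) (use ex_lm_bound in blast)
  then show "Kb \<ge> 0" "e > 0 \<Longrightarrow> lm_prob e \<le> Kb * e" by auto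
qed

lemma prob_local_max_le: "c < d \<Longrightarrow> prob {\<omega>\<in>space M. has_local_max c d (path \<omega>)} \<le> Kb * (d - c)"
  using prob_has_local_max[of c d] Kb(2)[of "d - c"] by (simp add: lm_prob_def)

text \<open>An interval of length 2 / n around t contains a local maximum with probability of order
  1 / n. Consequently the law has no interior atoms and masses of adjacent open intervals add
  up.\<close>

lemma AE_not_local_max: "AE \<omega> in M. \<not> local_max_at (path \<omega>) t"
proof -
  define A where "A n = {\<omega>\<in>space M. has_local_max (t - inverse (real (Suc n))) (t + inverse (real (Suc n))) (path \<omega>)}" for n
  have [measurable]: "A n \<in> events" for n unfolding A_def by simp
  have "prob (\<Inter>n. A n) \<le> Kb * (2 * inverse (real (Suc n)))" for n
  proof -
    have "prob (\<Inter>n. A n) \<le> prob (A n)" by (rule finite_measure_mono) auto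
    also have "\<dots> \<le> Kb * (2 * inverse (real (Suc n)))"
      unfolding A_def by (rule order_trans[OF prob_local_max_le]) simp_all
    finally show ?thesis .
  qed
  moreover have "(\<lambda>n. Kb * (2 * inverse (real (Suc n)))) \<longlonglongrightarrow> Kb * (2 * 0)"
    by (intro tendsto_mult tendsto_const LIMSEQ_inverse_real_of_nat)
  ultimately have "prob (\<Inter>n. A n) \<le> 0"
    by (intro LIMSEQ_le_const[where X = "\<lambda>n. Kb * (2 * inverse (real (Suc n)))"]) auto
  then have "prob (\<Inter>n. A n) = 0" by (simp add: measure_le_0_iff)
  then have "(\<Inter>n. A n) \<in> null_sets M" by (simp add: null_sets_def emeasure_eq_measure)
  then show ?thesis
  proof (rule AE_I')
    show "{\<omega> \<in> space M. \<not> \<not> local_max_at (path \<omega>) t} \<subseteq> (\<Inter>n. A n)"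
      by (auto simp: A_def has_local_max_def intro!: bexI[of _ t])
  qed
qed

lemma local_max_loc: "\<omega> \<in> space M \<Longrightarrow> a < loc a b \<omega> \<Longrightarrow> loc a b \<omega> < b \<Longrightarrow> local_max_at (path \<omega>) (loc a b \<omega>)"
  unfolding loc_def using local_max_wloc[OF cont] by blast

lemma AE_loc_neq:
  assumes "a < t" "t < b"
  shows "AE \<omega> in M. loc a b \<omega> \<noteq> t"
  using AE_not_local_max[of t]
  by (rule AE_mp) (rule AE_I2, use local_max_loc[of _ a b] assms in blast)

lemma \<nu>_nonneg: "0 \<le> \<nu> T c d" by (simp add: \<nu>_def)

lemma \<nu>_le_1: "\<nu> T c d \<le> 1" by (simp add: \<nu>_def)

lemma \<nu>_le:
  assumes "0 \<le> c" "c \<le> d" "d \<le> T"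
  shows "\<nu> T c d \<le> Kb * (d - c)"
proof (cases "c < d")
  case True
  have "\<nu> T c d \<le> prob {\<omega>\<in>space M. has_local_max c d (path \<omega>)}"
    unfolding \<nu>_def
  proof (rule finite_measure_mono)
    show "{\<omega> \<in> space M. loc 0 T \<omega> \<in> {c<..<d}} \<subseteq> {\<omega>\<in>space M. has_local_max c d (path \<omega>)}"
    proof safe
      fix \<omega> assume "\<omega> \<in> space M" "loc 0 T \<omega> \<in> {c<..<d}"
      then show "has_local_max c d (path \<omega>)"
        unfolding has_local_max_def using assms by (intro bexI[of _ "loc 0 T \<omega>"] local_max_loc) auto
    qed
  qed auto
  then show ?thesis using prob_local_max_le[OF True] by simp
next
  case False
  then show ?thesis using assms by (simp add: \<nu>_def)
qed

lemma \<nu>_add: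
  assumes "0 \<le> a" "a \<le> b" "b \<le> c" "c \<le> T"
  shows "\<nu> T a c = \<nu> T a b + \<nu> T b c"
proof (cases "a < b \<and> b < c")
  case True
  have [measurable]: "loc 0 T \<in> borel_measurable M" using assms by simp
  have "\<nu> T a c = prob ({\<omega>\<in>space M. loc 0 T \<omega> \<in> {a<..<b}} \<union> {\<omega>\<in>space M. loc 0 T \<omega> \<in> {b<..<c}})"
    unfolding \<nu>_def
  proof (rule finite_measure_eq_AE)
    show "AE \<omega> in M. (\<omega> \<in> {\<omega>\<in>space M. loc 0 T \<omega> \<in> {a<..<c}}) = (\<omega> \<in> {\<omega>\<in>space M. loc 0 T \<omega> \<in> {a<..<b}} \<union> {\<omega>\<in>space M. loc 0 T \<omega> \<in> {b<..<c}})"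
      using AE_loc_neq[of 0 b T] True assms by (auto elim!: eventually_mono)
  qed measurable
  also have "\<dots> = \<nu> T a b + \<nu> T b c"
    unfolding \<nu>_def by (rule finite_measure_Union) auto
  finally show ?thesis .
next
  case False
  have "{\<omega>\<in>space M. loc 0 T \<omega> \<in> {x<..<x}} = {}" for x by auto
  then have "\<nu> T x x = 0" for x by (simp only: \<nu>_def measure_empty)
  then show ?thesis using assms False by (cases "a = b") auto
qed

lemma \<nu>_sum:
  assumes "0 \<le> h" "real n * h \<le> T"
  shows "(\<Sum>j<n. \<nu> T (real j * h) (real (Suc j) * h)) = \<nu> T 0 (real n * h)"
  using assms(2)
proof (induction n)
  case 0
  then show ?case by (simp add: \<nu>_def)
next
  case (Suc n)
  have le: "real n * h \<le> real (Suc n) * h" using \<open>0 \<le> h\<close> by (intro mult_right_mono) auto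
  then have "(\<Sum>j<n. \<nu> T (real j * h) (real (Suc j) * h)) = \<nu> T 0 (real n * h)"
    using Suc by linarith
  then show ?case
    using \<nu>_add[of 0 "real n * h" "real (Suc n) * h" T] \<open>0 \<le> h\<close> Suc.prems le by simp
qed

lemma grid_variation:
  assumes "0 < T" "0 < N"
  defines "h \<equiv> T / real N" and "c \<equiv> (\<lambda>j. \<nu> T (real j * (T / real N)) (real (Suc j) * (T / real N)))"
  shows "(\<Sum>j<N - 1. \<bar>c (Suc j) - c j\<bar>) \<le> c 0 + c (N - 1)"
proof (cases "N = 1")
  case True
  then show ?thesis using \<nu>_nonneg by (simp add: c_def)
next
  case False
  obtain n where n: "N = Suc n" "0 < n" using \<open>0 < N\<close> False by (cases N) auto
  have hN: "real N * h = T" "0 < h" using assms by (auto simp: h_def)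
  have nh: "real n * h = T - h" using hN n by (simp add: algebra_simps)
  have Th: "0 < T - h" using nh hN n by (metis mult_pos_pos of_nat_0_less_iff)
  \<comment> \<open>Cell masses for the window shortened by exactly one cell: its cell j can be
    aligned with cell j or with cell j + 1 of the full window.\<close>
  define e where "e j = \<nu> (T - h) (real j * h) (real (Suc j) * h)" for j
  have c: "c j = \<nu> T (real j * h) (real j * h + h)" for j
    unfolding c_def h_def[symmetric] by (simp add: algebra_simps)
  have e: "e j = \<nu> (T - h) (real j * h) (real j * h + h)" for j by (simp add: e_def algebra_simps)
  have jh: "real j * h + h \<le> T - h" if "j < n" for j
  proof -
    have "real j + 1 \<le> real n" using that by linarith
    then have "(real j + 1) * h \<le> real n * h" using hN by (intro mult_right_mono) auto
    then show ?thesis using nh by (simp add: algebra_simps)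
  qed
  have ce: "c j \<le> e j" "c (Suc j) \<le> e j" if "j < n" for j
  proof -
    show "c j \<le> e j" unfolding c e
      using Th hN jh[OF that] by (intro \<nu>_antimono) auto
    show "c (Suc j) \<le> e j" unfolding c e
      using Th hN jh[OF that] by (intro \<nu>_antimono) (auto simp: algebra_simps)
  qed
  have sumc: "(\<Sum>j<Suc n. c j) = \<nu> T 0 T"
    using \<nu>_sum[of h N T] hN n by (simp add: c_def h_def del: sum.lessThan_Suc)
  have sume: "(\<Sum>j<n. e j) = \<nu> (T - h) 0 (T - h)"
    using \<nu>_sum[of h n "T - h"] hN nh by (simp add: e_def)
  have mass: "\<nu> (T - h) 0 (T - h) \<le> \<nu> T 0 T"
    using Th hN by (intro \<nu>_mass_mono) auto
  \<comment> \<open>If u and v are both at most e, then their distance is at most (e - u) + (e - v).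
    After summation the total of the \<open>e j\<close> is replaced by the larger total of the
    \<open>c j\<close>, and only the two end cells survive.\<close>
  have "(\<Sum>j<n. \<bar>c (Suc j) - c j\<bar>) \<le> (\<Sum>j<n. (e j - c j) + (e j - c (Suc j)))"
    by (rule sum_mono) (use ce in \<open>auto simp: abs_le_iff\<close>)
  also have "\<dots> = 2 * (\<Sum>j<n. e j) - (\<Sum>j<n. c j) - (\<Sum>j<n. c (Suc j))"
    unfolding sum.distrib sum_subtractf by simp
  also have "\<dots> \<le> 2 * (\<Sum>j<Suc n. c j) - (\<Sum>j<n. c j) - (\<Sum>j<n. c (Suc j))"
    using sumc sume mass by simp
  also have "\<dots> = c 0 + c n"
    using sum.lessThan_Suc_shift[of c n] by simp
  finally show ?thesis using n by simp
qed

text \<open>The number of cells of a dyadic grid that contain a local maximum has expectation at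
  most 2 * \<open>Kb\<close> * (d - c), whatever the mesh, so by Fatou its lower limit is almost
  surely finite. But m distinct local maxima occupy m distinct cells as soon as the mesh is below
  their distances, so infinitely many would make the lower limit infinite.\<close>

lemma AE_finite_local_max_interval:
  assumes cd: "c < d"
  shows "AE \<omega> in M. finite {t\<in>{c<..<d}. local_max_at (path \<omega>) t}"
proof -
  define \<delta> where "\<delta> n = (d - c) / 2 ^ n" for n :: nat
  have \<delta>: "\<delta> n > 0" for n using cd by (simp add: \<delta>_def)
  define A where "A n j = {\<omega>\<in>space M. has_local_max (c + (real j - 1) * \<delta> n) (c + (real j + 1) * \<delta> n) (path \<omega>)}" for n j
  have [measurable]: "A n j \<in> events" for n j unfolding A_def by simp
  define N :: "nat \<Rightarrow> 'a \<Rightarrow> ennreal" where "N n \<omega> = (\<Sum>j<2^n. indicator (A n j) \<omega>)" for n \<omega>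
  have [measurable]: "N n \<in> borel_measurable M" for n unfolding N_def by measurable
  have intN: "(\<integral>\<^sup>+\<omega>. N n \<omega> \<partial>M) \<le> ennreal (2 * Kb * (d - c))" for n
  proof -
    have "(\<integral>\<^sup>+\<omega>. N n \<omega> \<partial>M) = (\<Sum>j<2^n. emeasure M (A n j))"
      unfolding N_def by (subst nn_integral_sum) auto
    also have "\<dots> \<le> (\<Sum>j<(2::nat)^n. ennreal (Kb * (2 * \<delta> n)))"
    proof (rule sum_mono)
      fix j
      have lt: "c + (real j - 1) * \<delta> n < c + (real j + 1) * \<delta> n" using \<delta>[of n] by (simp add: algebra_simps)
      show "emeasure M (A n j) \<le> ennreal (Kb * (2 * \<delta> n))"
        unfolding emeasure_eq_measure A_def
        using prob_local_max_le[OF lt] by (intro ennreal_leI) (simp add: algebra_simps)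
    qed
    also have "\<dots> = ennreal (2 ^ n * (Kb * (2 * \<delta> n)))"
      using Kb(1) \<delta>[of n] by (simp add: ennreal_mult ennreal_power[symmetric])
    also have "2 ^ n * (Kb * (2 * \<delta> n)) = 2 * Kb * (d - c)" by (simp add: \<delta>_def)
    finally show ?thesis .
  qed
  have "(\<integral>\<^sup>+\<omega>. liminf (\<lambda>n. N n \<omega>) \<partial>M) \<le> liminf (\<lambda>n. \<integral>\<^sup>+\<omega>. N n \<omega> \<partial>M)"
    by (rule nn_integral_liminf) measurable
  also have "\<dots> \<le> liminf (\<lambda>n::nat. ennreal (2 * Kb * (d - c)))"
    by (rule Liminf_mono) (simp add: intN)
  also have "\<dots> < \<infinity>" by (simp add: Liminf_const)
  finally have "AE \<omega> in M. liminf (\<lambda>n. N n \<omega>) \<noteq> \<infinity>"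
    by (intro nn_integral_PInf_AE) auto
  then show ?thesis
  proof (rule AE_mp, intro AE_I2 impI)
    fix \<omega> assume w: "\<omega> \<in> space M" and fin: "liminf (\<lambda>n. N n \<omega>) \<noteq> \<infinity>"
    show "finite {t\<in>{c<..<d}. local_max_at (path \<omega>) t}"
    proof (rule ccontr)
      assume inf: "infinite {t\<in>{c<..<d}. local_max_at (path \<omega>) t}"
      have "of_nat m \<le> liminf (\<lambda>n. N n \<omega>)" for m
      proof (rule Liminf_bounded)
        obtain B where B: "finite B" "card B = m" "B \<subseteq> {t\<in>{c<..<d}. local_max_at (path \<omega>) t}"
          using infinite_arbitrarily_large[OF inf] by blast
        have "\<delta> \<longlonglongrightarrow> 0"
          unfolding \<delta>_def by (rule LIMSEQ_divide_realpow_zero) simp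
        then have "\<forall>\<^sub>F n in sequentially. \<delta> n < \<bar>s - t\<bar>" if "s \<noteq> t" for s t
          using that by (intro order_tendstoD(2)[of \<delta> 0]) auto
        then have "\<forall>\<^sub>F n in sequentially. \<forall>s\<in>B. \<forall>t\<in>B. s \<noteq> t \<longrightarrow> \<delta> n < \<bar>s - t\<bar>"
          using B(1) by (intro eventually_ball_finite ballI) auto
        then show "\<forall>\<^sub>F n in sequentially. of_nat m \<le> N n \<omega>"
        proof (rule eventually_mono)
          fix n assume sep: "\<forall>s\<in>B. \<forall>t\<in>B. s \<noteq> t \<longrightarrow> \<delta> n < \<bar>s - t\<bar>"
          define j where "j t = nat \<lfloor>(t - c) / \<delta> n\<rfloor>" for t
          have j: "real (j t) \<le> (t - c) / \<delta> n" "(t - c) / \<delta> n < real (j t) + 1" if "t \<in> B" for t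
          proof -
            have "0 \<le> (t - c) / \<delta> n" using that B(3) \<delta>[of n] by auto
            then show "real (j t) \<le> (t - c) / \<delta> n" "(t - c) / \<delta> n < real (j t) + 1"
              unfolding j_def by linarith+
          qed
          have inj: "inj_on j B"
          proof (rule inj_onI, rule ccontr)
            fix s t assume st: "s \<in> B" "t \<in> B" "j s = j t" "s \<noteq> t"
            then have "\<bar>(s - c) / \<delta> n - (t - c) / \<delta> n\<bar> < 1" using j[OF st(1)] j[OF st(2)] by linarith
            also have "(s - c) / \<delta> n - (t - c) / \<delta> n = (s - t) / \<delta> n" by (simp add: diff_divide_distrib)
            finally have "\<bar>s - t\<bar> < \<delta> n" using \<delta>[of n] by (simp add: abs_divide field_simps)
            then show False using sep st by force
          qed
          have jr: "j t < 2 ^ n" if "t \<in> B" for t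
          proof -
            have "(t - c) / \<delta> n < 2 ^ n"
            proof -
              have "t - c < d - c" using that B(3) by auto
              also have "d - c = 2 ^ n * \<delta> n" by (simp add: \<delta>_def)
              finally show ?thesis using \<delta>[of n] by (simp add: field_simps)
            qed
            then have "real (j t) < 2 ^ n" using j(1)[OF that] by linarith
            then show ?thesis by (metis of_nat_less_iff of_nat_numeral of_nat_power)
          qed
          have jA: "\<omega> \<in> A n (j t)" if "t \<in> B" for t
          proof -
            have "real (j t) * \<delta> n \<le> t - c" "t - c < (real (j t) + 1) * \<delta> n"
              using j[OF that] \<delta>[of n] by (simp_all add: field_simps)
            moreover have "(real (j t) - 1) * \<delta> n < real (j t) * \<delta> n" using \<delta>[of n] by simp
            ultimately have "t \<in> {c + (real (j t) - 1) * \<delta> n<..<c + (real (j t) + 1) * \<delta> n}" by auto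
            then show ?thesis using w B(3) that unfolding A_def has_local_max_def by blast
          qed
          have "of_nat m = (\<Sum>i\<in>j ` B. (1::ennreal))" using B(2) card_image[OF inj] by simp
          also have "\<dots> = (\<Sum>i\<in>j ` B. indicator (A n i) \<omega>)"
            by (rule sum.cong) (use jA in auto)
          also have "\<dots> \<le> N n \<omega>"
            unfolding N_def by (rule sum_mono2) (use jr in auto)
          finally show "of_nat m \<le> N n \<omega>" .
        qed
      qed
      then have le: "of_nat m \<le> liminf (\<lambda>n. N n \<omega>)" for m .
      obtain m where "liminf (\<lambda>n. N n \<omega>) < of_nat m"
        using ennreal_Ex_less_of_nat[of "liminf (\<lambda>n. N n \<omega>)"] fin by (auto simp: less_top)
      then show False using le[of m] by simp
    qed
  qed
qed

lemma AE_finite_local_max: "AE \<omega> in M. \<forall>c d. finite {t\<in>{c<..<d}. local_max_at (path \<omega>) t}"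
proof -
  have "AE \<omega> in M. \<forall>n::nat. finite {t\<in>{- real (Suc n)<..<real (Suc n)}. local_max_at (path \<omega>) t}"
    unfolding AE_all_countable by (intro allI AE_finite_local_max_interval) simp
  then show ?thesis
  proof (rule AE_mp, intro AE_I2 impI allI)
    fix \<omega> c d assume *: "\<forall>n::nat. finite {t\<in>{- real (Suc n)<..<real (Suc n)}. local_max_at (path \<omega>) t}"
    obtain n :: nat where "max \<bar>c\<bar> \<bar>d\<bar> < real n" using reals_Archimedean2 by blast
    then have "{t\<in>{c<..<d}. local_max_at (path \<omega>) t} \<subseteq> {t\<in>{- real (Suc n)<..<real (Suc n)}. local_max_at (path \<omega>) t}"
      by auto
    then show "finite {t\<in>{c<..<d}. local_max_at (path \<omega>) t}" using * finite_subset by blast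
  qed
qed

end

section \<open>Densities from grid variation\<close>

lemma mono_left_limit:
  fixes f :: "real \<Rightarrow> real"
  assumes "mono f"
  shows "\<exists>l. (f \<longlongrightarrow> l) (at_left x)"
  using Lim_left_bound[of UNIV x f "f x"] assms by (auto simp: mono_def)

lemma increment_bounds:
  fixes f F :: "real \<Rightarrow> real"
  assumes xy: "x \<le> y" and int: "(f has_integral (F y - F x)) {x..y}"
    and bnd: "\<And>t. x < t \<Longrightarrow> t < y \<Longrightarrow> A \<le> f t \<and> f t \<le> B"
  shows "A * (y - x) \<le> F y - F x" "F y - F x \<le> B * (y - x)"
proof -
  have i: "(f has_integral (F y - F x)) {x<..<y}" using int by (simp add: has_integral_Icc_iff_Ioo)
  have c: "((\<lambda>_. z) has_integral (y - x) * z) {x<..<y}" for z :: real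
    using has_integral_const_real[of z x y] xy by (simp add: has_integral_Icc_iff_Ioo)
  show "A * (y - x) \<le> F y - F x"
    using has_integral_le[OF c i, of A] bnd by (auto simp: mult.commute)
  show "F y - F x \<le> B * (y - x)"
    using has_integral_le[OF i c, of B] bnd by (auto simp: mult.commute)
qed

text \<open>Recovers a one-sided limit of the density from the masses of shrinking intervals. Only
  the limit enters, so this works at the ends of \<open>[0, T]\<close> and at jumps.\<close>

lemma quotient_at_right:
  fixes f F :: "real \<Rightarrow> real"
  assumes "a < b" and int: "\<And>y. a \<le> y \<Longrightarrow> y \<le> b \<Longrightarrow> (f has_integral (F y - F a)) {a..y}"
    and lim: "(f \<longlongrightarrow> l) (at_right a)"
  shows "((\<lambda>h. (F (a + h) - F a) / h) \<longlongrightarrow> l) (at_right 0)"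
proof (rule tendstoI)
  fix e :: real assume "e > 0"
  then have "\<forall>\<^sub>F t in at_right a. dist (f t) l < e / 2" using tendstoD[OF lim, of "e/2"] by simp
  then obtain c where c: "c > a" "\<And>t. a < t \<Longrightarrow> t < c \<Longrightarrow> dist (f t) l < e / 2"
    unfolding eventually_at_right_field by blast
  show "\<forall>\<^sub>F h in at_right 0. dist ((F (a + h) - F a) / h) l < e"
    unfolding eventually_at_right_field
  proof (rule exI[of _ "min c b - a"], intro conjI allI impI)
    show "min c b - a > 0" using c \<open>a < b\<close> by simp
    fix h assume h: "0 < h" "h < min c b - a"
    have bnd: "l - e/2 \<le> f t \<and> f t \<le> l + e/2" if "a < t" "t < a + h" for t
    proof -
      have "\<bar>f t - l\<bar> < e/2" using c(2)[of t] that h by (simp add: dist_real_def)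
      then show ?thesis unfolding abs_diff_less_iff by simp
    qed
    have i: "(f has_integral (F (a + h) - F a)) {a..a+h}" using h by (intro int) auto
    have "(l - e/2) * h \<le> F (a + h) - F a" "F (a + h) - F a \<le> (l + e/2) * h"
      using increment_bounds[OF _ i bnd] h by simp_all
    then have "l - e/2 \<le> (F (a + h) - F a) / h" "(F (a + h) - F a) / h \<le> l + e/2"
      using h by (simp_all add: pos_le_divide_eq pos_divide_le_eq)
    then show "dist ((F (a + h) - F a) / h) l < e"
      using \<open>e > 0\<close> unfolding dist_real_def abs_diff_less_iff by linarith
  qed
qed

lemma quotient_at_left:
  fixes f F :: "real \<Rightarrow> real"
  assumes "b < a" and int: "\<And>y. b \<le> y \<Longrightarrow> y \<le> a \<Longrightarrow> (f has_integral (F a - F y)) {y..a}"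
    and lim: "(f \<longlongrightarrow> l) (at_left a)"
  shows "((\<lambda>h. (F a - F (a - h)) / h) \<longlongrightarrow> l) (at_right 0)"
proof -
  have "((\<lambda>h. ((\<lambda>x. - F (- x)) (- a + h) - (\<lambda>x. - F (- x)) (- a)) / h) \<longlongrightarrow> l) (at_right 0)"
  proof (rule quotient_at_right[where b = "- b" and f = "\<lambda>x. f (- x)"])
    show "- a < - b" using \<open>b < a\<close> by simp
    show "((\<lambda>x. f (- x)) \<longlongrightarrow> l) (at_right (- a))"
      using lim unfolding filterlim_at_left_to_right[of f _ a] .
    fix y assume "- a \<le> y" "y \<le> - b"
    then have "(f has_integral (F a - F (- y))) {- y..a}" by (intro int) auto
    then have "((\<lambda>x. f (- x)) has_integral (F a - F (- y))) {- a..- (- y)}"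
      by (rule has_integral_reflect_real[THEN iffD2])
    then show "((\<lambda>x. f (- x)) has_integral (- F (- y) - - F (- (- a)))) {- a..y}"
      by simp
  qed
  then show ?thesis by (simp add: algebra_simps)
qed

text \<open>Used to extend inequalities from continuity points to arbitrary points: a finite chain
  is moved slightly to the right, off the discontinuities, by one common amount.\<close>

lemma sorted_shift_avoiding:
  fixes D :: "real set"
  assumes "countable D" "finite S" "e > 0"
  obtains \<epsilon> where "0 < \<epsilon>" "\<epsilon> < e" "\<And>s. s \<in> S \<Longrightarrow> s + \<epsilon> \<notin> D"
proof -
  have "countable (\<Union>s\<in>S. (\<lambda>d. d - s) ` D)" using assms by (auto intro: countable_finite)
  then obtain \<epsilon> where \<epsilon>: "\<epsilon> \<in> {0<..<e}" "\<epsilon> \<notin> (\<Union>s\<in>S. (\<lambda>d. d - s) ` D)"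
    using uncountable_open_interval[of 0 e] \<open>e > 0\<close> by (metis countable_subset subsetI)
  show ?thesis
  proof (rule that[of \<epsilon>])
    show "s + \<epsilon> \<notin> D" if "s \<in> S" for s
    proof
      assume "s + \<epsilon> \<in> D"
      then have "\<epsilon> \<in> (\<lambda>d. d - s) ` D" by (rule rev_image_eqI) simp
      then show False using \<epsilon>(2) that by blast
    qed
  qed (use \<epsilon> in auto)
qed

section \<open>Step densities on dyadic grids and their limit\<close>

text \<open>\<open>F\<close> stands for the mass of \<open>(0, x)\<close>, and the second
  differences in \<open>grid\<close> are the jumps between neighbouring cell masses. From here to
  the end of the locale everything is deterministic analysis.\<close>

locale step_density =
  fixes F :: "real \<Rightarrow> real" and T K :: real
  assumes T: "T > 0" and F0: "F 0 = 0"
    and mono_F: "\<And>x y. 0 \<le> x \<Longrightarrow> x \<le> y \<Longrightarrow> y \<le> T \<Longrightarrow> F x \<le> F y"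
    and lip_F: "\<And>x y. 0 \<le> x \<Longrightarrow> x \<le> y \<Longrightarrow> y \<le> T \<Longrightarrow> F y - F x \<le> K * (y - x)"
    and grid: "\<And>N. 0 < N \<Longrightarrow>
      (\<Sum>j<N - 1. \<bar>(F (real (Suc (Suc j)) * (T / real N)) - F (real (Suc j) * (T / real N))) -
                  (F (real (Suc j) * (T / real N)) - F (real j * (T / real N)))\<bar>)
      \<le> F (T / real N) + (F T - F (T - T / real N))"
begin

lemma K: "0 \<le> K"
proof -
  have "0 \<le> K * T" using mono_F[of 0 T] lip_F[of 0 T] T F0 by simp
  then show ?thesis using T by (simp add: zero_le_mult_iff)
qed

definition N :: "nat \<Rightarrow> nat" where "N n = 2 ^ n"
definition hh :: "nat \<Rightarrow> real" where "hh n = T / real (N n)"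
definition a :: "nat \<Rightarrow> nat \<Rightarrow> real" where
  "a n j = (F (real (Suc j) * hh n) - F (real j * hh n)) / hh n"
text \<open>The minimum and \<open>nat\<close> continue the step function constantly beyond both
  ends of \<open>[0, T)\<close>, so that its variations are monotone on the whole line.\<close>

definition idx :: "nat \<Rightarrow> real \<Rightarrow> nat" where
  "idx n x = min (N n - 1) (nat \<lfloor>x / hh n\<rfloor>)"
text \<open>Positive and negative variation of the step density, with the starting value put into
  \<open>Pn\<close>; these are the monotone functions for Helly selection.\<close>

definition Pn :: "nat \<Rightarrow> real \<Rightarrow> real" where
  "Pn n x = a n 0 + (\<Sum>j<idx n x. max 0 (a n (Suc j) - a n j))"
definition Qn :: "nat \<Rightarrow> real \<Rightarrow> real" where
  "Qn n x = (\<Sum>j<idx n x. max 0 (a n j - a n (Suc j)))"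

lemma N: "0 < N n" by (simp add: N_def)
lemma hh: "0 < hh n" "real (N n) * hh n = T" using T N[of n] by (auto simp: hh_def)

lemma hh_tendsto: "hh \<longlonglongrightarrow> 0"
  unfolding hh_def N_def using LIMSEQ_divide_realpow_zero[of 2 T] by simp

lemma grid_le:
  assumes "j \<le> N n" shows "real j * hh n \<le> T"
proof -
  have "real j * hh n \<le> real (N n) * hh n" using assms hh(1)[of n] by (intro mult_right_mono) auto
  then show ?thesis using hh by simp
qed

lemma a_bounds: assumes "j < N n" shows "0 \<le> a n j" "a n j \<le> K"
proof -
  have j: "real (Suc j) * hh n \<le> T" using assms by (intro grid_le) simp
  have le: "real j * hh n \<le> real (Suc j) * hh n" using hh(1)[of n] by (intro mult_right_mono) auto
  have j0: "0 \<le> real j * hh n" using hh(1)[of n] by simp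
  show "0 \<le> a n j" using mono_F[OF j0 le j] hh(1)[of n] by (simp add: a_def)
  show "a n j \<le> K" using lip_F[OF j0 le j] hh(1)[of n] by (simp add: a_def divide_le_eq algebra_simps)
qed

lemma idx_mono: "x \<le> y \<Longrightarrow> idx n x \<le> idx n y"
  unfolding idx_def using hh(1)[of n] by (intro min.mono nat_mono floor_mono divide_right_mono) auto

lemma idx_less: "idx n x < N n" using N[of n] unfolding idx_def by linarith

lemma variation_a: "(\<Sum>j<N n - 1. \<bar>a n (Suc j) - a n j\<bar>) \<le> a n 0 + a n (N n - 1)"
proof -
  have "\<bar>a n (Suc j) - a n j\<bar> = \<bar>(F (real (Suc (Suc j)) * hh n) - F (real (Suc j) * hh n)) -
                  (F (real (Suc j) * hh n) - F (real j * hh n))\<bar> / hh n" for j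
    using hh(1)[of n] unfolding a_def diff_divide_distrib[symmetric] by (simp add: abs_divide)
  then have "(\<Sum>j<N n - 1. \<bar>a n (Suc j) - a n j\<bar>) \<le> (F (hh n) + (F T - F (T - hh n))) / hh n"
    using grid[OF N, of n] hh(1)[of n] unfolding hh_def[symmetric]
    by (simp only: sum_divide_distrib[symmetric]) (simp add: divide_right_mono)
  also have "\<dots> = a n 0 + a n (N n - 1)"
  proof -
    have "real (Suc (N n - 1)) * hh n = T" "real (N n - 1) * hh n = T - hh n"
      using N[of n] hh(2)[of n] by (simp_all add: of_nat_diff algebra_simps)
    then show ?thesis by (simp add: a_def F0 add_divide_distrib)
  qed
  finally show ?thesis .
qed

lemma Pn_Qn: "Pn n x - Qn n x = a n (idx n x)"
proof -
  have "Pn n x - Qn n x = a n 0 + (\<Sum>j<idx n x. max 0 (a n (Suc j) - a n j) - max 0 (a n j - a n (Suc j)))"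
    by (simp add: Pn_def Qn_def sum_subtractf)
  also have "(\<Sum>j<idx n x. max 0 (a n (Suc j) - a n j) - max 0 (a n j - a n (Suc j))) = (\<Sum>j<idx n x. a n (Suc j) - a n j)"
    by (rule sum.cong) auto
  also have "\<dots> = a n (idx n x) - a n 0" by (rule sum_lessThan_telescope)
  finally show ?thesis by simp
qed

lemma sum_idx_le:
  assumes "\<And>j. 0 \<le> g j" shows "(\<Sum>j<idx n x. g j) \<le> (\<Sum>j<N n - 1. g j :: real)"
  using assms by (intro sum_mono2) (auto simp: idx_def)

lemma Pn_plus_Qn: "Pn n x + Qn n x - a n 0 \<le> a n 0 + a n (N n - 1)"
proof -
  have "Pn n x + Qn n x - a n 0 = (\<Sum>j<idx n x. max 0 (a n (Suc j) - a n j) + max 0 (a n j - a n (Suc j)))"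
    by (simp add: Pn_def Qn_def sum.distrib)
  also have "\<dots> = (\<Sum>j<idx n x. \<bar>a n (Suc j) - a n j\<bar>)"
    by (rule sum.cong) auto
  also have "\<dots> \<le> (\<Sum>j<N n - 1. \<bar>a n (Suc j) - a n j\<bar>)" by (rule sum_idx_le) simp
  finally show ?thesis using variation_a[of n] by simp
qed

lemma Pn_ge: "a n 0 \<le> Pn n x" unfolding Pn_def by (simp add: sum_nonneg)
lemma Qn_ge: "0 \<le> Qn n x" unfolding Qn_def by (simp add: sum_nonneg)

lemma mono_Pn: "mono (Pn n)"
  unfolding Pn_def by (intro monoI add_left_mono sum_mono2) (use idx_mono in \<open>auto intro: less_le_trans\<close>)

lemma mono_Qn: "mono (Qn n)"
  unfolding Qn_def by (intro monoI sum_mono2) (use idx_mono in \<open>auto intro: less_le_trans\<close>)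

text \<open>Together the two variations are at most 2 * \<open>a n 0\<close> +
  \<open>a n (N n - 1)\<close>, that is, three slopes of F, each at most K.\<close>

lemma Pn_bound: "\<bar>Pn n x\<bar> \<le> 3 * K" and Qn_bound: "\<bar>Qn n x\<bar> \<le> 3 * K"
proof -
  have "0 \<le> a n 0" "a n 0 \<le> K" "a n (N n - 1) \<le> K" using a_bounds[of _ n] N[of n] by auto
  then show "\<bar>Pn n x\<bar> \<le> 3 * K" "\<bar>Qn n x\<bar> \<le> 3 * K"
    using Pn_plus_Qn[of n x] Pn_ge[of n x] Qn_ge[of n x] by linarith+
qed

lemma idx_right: "\<forall>\<^sub>F y in at_right x. idx n y = idx n x"
proof -
  define z where "z = (of_int (\<lfloor>x / hh n\<rfloor> + 1)) * hh n"
  have "x / hh n < of_int (\<lfloor>x / hh n\<rfloor> + 1)" by linarith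
  then have z: "x < z" using pos_divide_less_eq[OF hh(1)[of n], of x] unfolding z_def by blast
  show ?thesis
    unfolding eventually_at_right_field
  proof (rule exI[of _ z], intro conjI allI impI)
    fix y assume y: "x < y" "y < z"
    have "x / hh n \<le> y / hh n" using y hh(1)[of n] by (simp add: divide_right_mono)
    moreover have "y / hh n < of_int (\<lfloor>x / hh n\<rfloor> + 1)"
      using y pos_divide_less_eq[OF hh(1)[of n], of y] unfolding z_def by blast
    ultimately have "\<lfloor>y / hh n\<rfloor> = \<lfloor>x / hh n\<rfloor>" by linarith
    then show "idx n y = idx n x" by (simp add: idx_def)
  qed (fact z)
qed

lemma rcont_Pn: "continuous (at_right x) (Pn n)"
  unfolding continuous_within
  by (rule tendsto_eventually) (use idx_right[of n x] in \<open>auto elim!: eventually_mono simp: Pn_def\<close>)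

lemma rcont_Qn: "continuous (at_right x) (Qn n)"
  unfolding continuous_within
  by (rule tendsto_eventually) (use idx_right[of n x] in \<open>auto elim!: eventually_mono simp: Qn_def\<close>)

abbreviation phi :: "nat \<Rightarrow> real \<Rightarrow> real" where "phi n x \<equiv> a n (idx n x)"

lemma idx_cell:
  assumes "j < N n" "real j * hh n \<le> x" "x < real (Suc j) * hh n"
  shows "idx n x = j"
proof -
  have "real j \<le> x / hh n" "x / hh n < real (Suc j)"
    using assms hh(1)[of n] by (simp_all add: le_divide_eq divide_less_eq)
  then have "\<lfloor>x / hh n\<rfloor> = int j" by linarith
  then show ?thesis using assms(1) by (simp add: idx_def)
qed

lemma phi_cell:
  assumes "j < N n" "real j * hh n \<le> x" "x \<le> y" "y \<le> real (Suc j) * hh n"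
  shows "(phi n has_integral (y - x) * a n j) {x..y}"
proof (rule has_integral_spike_finite[of "{y}"])
  show "((\<lambda>_. a n j) has_integral (y - x) * a n j) {x..y}"
    using has_integral_const_real[of "a n j" x y] assms by simp
  show "phi n z = a n j" if "z \<in> {x..y} - {y}" for z
    using that assms by (subst idx_cell[of j]) auto
qed simp

lemma phi_grid:
  assumes "j \<le> N n"
  shows "(phi n has_integral F (real j * hh n)) {0..real j * hh n}"
  using assms
proof (induction j)
  case 0
  then show ?case using F0 by (simp add: has_integral_refl)
next
  case (Suc j)
  have 1: "(phi n has_integral F (real j * hh n)) {0..real j * hh n}" using Suc by simp
  have le: "real j * hh n \<le> real (Suc j) * hh n" using hh(1)[of n] by (intro mult_right_mono) auto
  have 2: "(phi n has_integral (real (Suc j) * hh n - real j * hh n) * a n j) {real j * hh n..real (Suc j) * hh n}"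
    using Suc.prems le by (intro phi_cell) auto
  have "(real (Suc j) * hh n - real j * hh n) * a n j = F (real (Suc j) * hh n) - F (real j * hh n)"
  proof -
    have "real (Suc j) * hh n - real j * hh n = hh n" by (simp add: algebra_simps)
    then show ?thesis using hh(1)[of n] by (simp add: a_def)
  qed
  then show ?case
    using has_integral_combine[OF _ le 1 2] hh(1)[of n] by simp
qed

text \<open>At grid points the integral of the step density equals F exactly; inside a cell both
  quantities move by at most K * \<open>hh n\<close>.\<close>

lemma phi_integral:
  assumes "0 \<le> x" "x \<le> T"
  shows "\<exists>I. (phi n has_integral I) {0..x} \<and> \<bar>I - F x\<bar> \<le> 2 * K * hh n"
proof (cases "x = T")
  case True
  then show ?thesis using phi_grid[of "N n" n] hh[of n] K by (intro exI[of _ "F T"]) auto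
next
  case False
  define j where "j = nat \<lfloor>x / hh n\<rfloor>"
  have "0 \<le> x / hh n" using assms hh(1)[of n] by simp
  then have j: "real j \<le> x / hh n" "x / hh n < real (Suc j)" unfolding j_def by linarith+
  have jx: "real j * hh n \<le> x" "x < real (Suc j) * hh n"
    using j hh(1)[of n] by (simp_all add: le_divide_eq divide_less_eq)
  have "x / hh n < real (N n)" using False assms hh[of n] by (simp add: divide_less_eq)
  then have jN: "j < N n" using j by linarith
  have j0: "0 \<le> real j * hh n" using hh(1)[of n] by simp
  have "(phi n has_integral F (real j * hh n) + (x - real j * hh n) * a n j) {0..x}"
    using has_integral_combine[OF j0 jx(1) phi_grid phi_cell[OF jN _ jx(1)]] jN jx by simp
  moreover have "\<bar>F (real j * hh n) + (x - real j * hh n) * a n j - F x\<bar> \<le> 2 * K * hh n"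
  proof -
    have "x - real j * hh n \<le> hh n" using jx by (simp add: algebra_simps)
    then have "(x - real j * hh n) * a n j \<le> hh n * K" "0 \<le> (x - real j * hh n) * a n j"
      "K * (x - real j * hh n) \<le> K * hh n"
      using a_bounds[OF jN] jx K hh(1)[of n] by (auto intro!: mult_mono mult_nonneg_nonneg mult_left_mono)
    moreover have "F (real j * hh n) \<le> F x" "F x - F (real j * hh n) \<le> K * (x - real j * hh n)"
      using mono_F[OF j0 jx(1)] lip_F[OF j0 jx(1)] assms by auto
    moreover have "0 \<le> K * hh n" using K hh(1)[of n] by simp
    ultimately show ?thesis by (simp add: abs_le_iff algebra_simps)
  qed
  ultimately show ?thesis by blast
qed

text \<open>Each increment is dominated by the increment of the monotone function
  \<open>Pn n\<close> + \<open>Qn n\<close>, so the sum telescopes for every chain.\<close>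

lemma phi_variation:
  assumes "sorted_wrt (<) s"
  shows "(\<Sum>i<length s - 1. \<bar>phi n (s ! Suc i) - phi n (s ! i)\<bar>) \<le> a n 0 + a n (N n - 1)"
proof (cases "length s = 0")
  case True
  then show ?thesis using a_bounds[of _ n] N[of n] by (simp add: add_nonneg_nonneg)
next
  case False
  then obtain m where m: "length s = Suc m" by (cases "length s") auto
  have "(\<Sum>i<length s - 1. \<bar>phi n (s ! Suc i) - phi n (s ! i)\<bar>) \<le>
     (\<Sum>i<m. (Pn n (s ! Suc i) + Qn n (s ! Suc i)) - (Pn n (s ! i) + Qn n (s ! i)))"
    unfolding m diff_Suc_1
  proof (rule sum_mono)
    fix i assume "i \<in> {..<m}"
    then have "s ! i < s ! Suc i" using assms m by (auto simp: sorted_wrt_iff_nth_less)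
    then have "Pn n (s ! i) \<le> Pn n (s ! Suc i)" "Qn n (s ! i) \<le> Qn n (s ! Suc i)"
      using mono_Pn[of n] mono_Qn[of n] by (auto simp: mono_def)
    then show "\<bar>phi n (s ! Suc i) - phi n (s ! i)\<bar> \<le> (Pn n (s ! Suc i) + Qn n (s ! Suc i)) - (Pn n (s ! i) + Qn n (s ! i))"
      unfolding Pn_Qn[symmetric] by linarith
  qed
  also have "\<dots> = (Pn n (s ! m) + Qn n (s ! m)) - (Pn n (s ! 0) + Qn n (s ! 0))"
    by (rule sum_lessThan_telescope)
  also have "\<dots> \<le> a n 0 + a n (N n - 1)"
    using Pn_plus_Qn[of n "s ! m"] Pn_ge[of n "s ! 0"] Qn_ge[of n "s ! 0"] by linarith
  finally show ?thesis .
qed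

text \<open>Helly selection along a common subsequence gives P and Q, and dominated convergence
  identifies the integrals of P - Q with increments of F. The first and last cell densities are not
  controlled by this convergence, as the endpoints may be discontinuities; their limits come from
  difference quotients of F at 0 and T.\<close>

theorem ex_cadlag_density:
  obtains P Q :: "real \<Rightarrow> real" and l where
    "mono P" "mono Q" "\<And>x. continuous (at_right x) P" "\<And>x. continuous (at_right x) Q"
    "\<And>x. 0 \<le> P x - Q x"
    "\<And>x y. 0 \<le> x \<Longrightarrow> x \<le> y \<Longrightarrow> y \<le> T \<Longrightarrow> ((\<lambda>t. P t - Q t) has_integral (F y - F x)) {x..y}"
    "((\<lambda>t. P t - Q t) \<longlongrightarrow> l) (at_left T)"
    "total_variation {0<..<T} (\<lambda>t. P t - Q t) \<le> ereal (P 0 - Q 0 + l)"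
proof -
  obtain s1 P where s1: "strict_mono (s1 :: nat \<Rightarrow> nat)" and P: "\<And>x. continuous (at_right x) P" "mono P"
    "\<And>x. isCont P x \<Longrightarrow> (\<lambda>n. Pn (s1 n) x) \<longlonglongrightarrow> P x"
    using Helly_selection[of Pn, OF rcont_Pn mono_Pn Pn_bound] by blast
  obtain s2 Q where s2: "strict_mono (s2 :: nat \<Rightarrow> nat)" and Q: "\<And>x. continuous (at_right x) Q" "mono Q"
    "\<And>x. isCont Q x \<Longrightarrow> (\<lambda>n. Qn (s1 (s2 n)) x) \<longlonglongrightarrow> Q x"
    using Helly_selection[of "\<lambda>n. Qn (s1 n)", OF rcont_Qn mono_Qn Qn_bound] by blast
  define r where "r n = s1 (s2 n)" for n
  have r: "strict_mono r" unfolding r_def using s1 s2 by (simp add: strict_mono_def)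
  have hr: "(\<lambda>n. hh (r n)) \<longlonglongrightarrow> 0" using LIMSEQ_subseq_LIMSEQ[OF hh_tendsto r] by (simp add: o_def)
  define f where "f x = P x - Q x" for x
  \<comment> \<open>Convergence is known only off this countable set; right continuity takes care of
    its points.\<close>
  define D where "D = {x. \<not> isCont P x} \<union> {x. \<not> isCont Q x}"
  have D: "countable D" unfolding D_def using mono_ctble_discont P(2) Q(2) by auto
  have lim: "(\<lambda>n. phi (r n) x) \<longlonglongrightarrow> f x" if "x \<notin> D" for x
  proof -
    have "(\<lambda>n. Pn (s1 (s2 n)) x) \<longlonglongrightarrow> P x"
      using LIMSEQ_subseq_LIMSEQ[OF P(3) s2, of x] that by (simp add: D_def o_def)
    then show ?thesis unfolding f_def r_def Pn_Qn[symmetric]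
      using that by (intro tendsto_diff Q(3)) (simp_all add: D_def)
  qed
  have f_right: "(f \<longlongrightarrow> f x) (at_right x)" for x
    unfolding f_def using P(1)[of x] Q(1)[of x] by (intro tendsto_diff) (simp_all add: continuous_within)
  have bounds: "0 \<le> phi n x" "phi n x \<le> K" for n x using a_bounds[OF idx_less] by auto
  have f_nonneg': "0 \<le> f x" if "x \<notin> D" for x
    using LIMSEQ_le_const[OF lim[OF that]] bounds by blast
  have f_nonneg: "0 \<le> f x" for x
  proof (rule ccontr)
    assume "\<not> 0 \<le> f x"
    then have "\<forall>\<^sub>F y in at_right x. f y < 0" using order_tendstoD(2)[OF f_right, of x 0] by simp
    then obtain b where b: "b > x" "\<And>y. x < y \<Longrightarrow> y < b \<Longrightarrow> f y < 0" unfolding eventually_at_right_field by blast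
    obtain \<epsilon> where "0 < \<epsilon>" "\<epsilon> < b - x" "x + \<epsilon> \<notin> D"
      using sorted_shift_avoiding[OF D, of "{x}" "b - x"] b(1) by auto
    then show False using b(2)[of "x + \<epsilon>"] f_nonneg'[of "x + \<epsilon>"] by auto
  qed
  have [measurable]: "P \<in> borel_measurable borel" "Q \<in> borel_measurable borel"
    using P(2) Q(2) by (auto intro: borel_measurable_mono)
  have [measurable]: "f \<in> borel_measurable borel" unfolding f_def by measurable
  have [measurable]: "phi n \<in> borel_measurable borel" for n
    unfolding Pn_Qn[symmetric] using mono_Pn mono_Qn by (intro borel_measurable_diff borel_measurable_mono)
  have int0: "set_integrable lborel {0..x} f \<and> (LINT t:{0..x}|lborel. f t) = F x" if x: "0 \<le> x" "x \<le> T" for x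
  proof -
    have AE: "AE t in lborel. t \<notin> D"
      using countable_imp_null_set_lborel[OF D] by (rule AE_not_in)
    have dom: "integrable lborel (\<lambda>t. indicator {0..x} t *\<^sub>R f t)"
       "(\<lambda>n. LINT t|lborel. indicator {0..x} t *\<^sub>R phi (r n) t) \<longlonglongrightarrow> (LINT t|lborel. indicator {0..x} t *\<^sub>R f t)"
    proof -
      have w: "integrable lborel (\<lambda>t. indicator {0..x} t *\<^sub>R K)"
        by (rule integrableI_bounded_set_indicator[where B = K]) (use K x in auto)
      have l: "AE t in lborel. (\<lambda>n. indicator {0..x} t *\<^sub>R phi (r n) t) \<longlonglongrightarrow> indicator {0..x} t *\<^sub>R f t"
        using AE by eventually_elim (intro tendsto_scaleR tendsto_const lim)
      have b: "AE t in lborel. norm (indicator {0..x} t *\<^sub>R phi (r n) t) \<le> indicator {0..x} t *\<^sub>R K" for n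
        using bounds by (auto simp: indicator_def)
      show "integrable lborel (\<lambda>t. indicator {0..x} t *\<^sub>R f t)"
        by (rule integrable_dominated_convergence[OF _ _ w l b]) measurable
      show "(\<lambda>n. LINT t|lborel. indicator {0..x} t *\<^sub>R phi (r n) t) \<longlonglongrightarrow> (LINT t|lborel. indicator {0..x} t *\<^sub>R f t)"
        by (rule integral_dominated_convergence[OF _ _ w l b]) measurable
    qed
    have "\<bar>(LINT t|lborel. indicator {0..x} t *\<^sub>R phi (r n) t) - F x\<bar> \<le> 2 * K * hh (r n)" for n
    proof -
      have "integrable lborel (\<lambda>t. indicator {0..x} t *\<^sub>R phi (r n) t)"
        by (rule integrableI_bounded_set_indicator[where B = K]) (use bounds x in auto)
      then have "set_integrable lborel {0..x} (phi (r n))" by (simp add: set_integrable_def)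
      from set_borel_integral_eq_integral[OF this]
      have "(LINT t|lborel. indicator {0..x} t *\<^sub>R phi (r n) t) = integral {0..x} (phi (r n))"
        by (simp add: set_lebesgue_integral_def)
      then show ?thesis using phi_integral[OF x, of "r n"] by (auto dest!: integral_unique)
    qed
    then have le: "norm ((LINT t|lborel. indicator {0..x} t *\<^sub>R phi (r n) t) - F x) \<le> 2 * K * hh (r n)" for n
      by (simp only: real_norm_def)
    have z: "(\<lambda>n. 2 * K * hh (r n)) \<longlonglongrightarrow> 0"
      using tendsto_mult[OF tendsto_const[of "2 * K"] hr] by simp
    have "(\<lambda>n. (LINT t|lborel. indicator {0..x} t *\<^sub>R phi (r n) t) - F x) \<longlonglongrightarrow> 0"
      by (rule Lim_null_comparison[OF always_eventually z]) (intro allI le)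
    then have "(\<lambda>n. LINT t|lborel. indicator {0..x} t *\<^sub>R phi (r n) t) \<longlonglongrightarrow> F x"
      using LIM_zero_iff by blast
    then show ?thesis using dom LIMSEQ_unique unfolding set_integrable_def set_lebesgue_integral_def by blast
  qed
  have int: "(f has_integral (F y - F x)) {x..y}" if "0 \<le> x" "x \<le> y" "y \<le> T" for x y
  proof -
    have hi: "(f has_integral F z) {0..z}" if "0 \<le> z" "z \<le> T" for z
      using int0[OF that] set_borel_integral_eq_integral[of "{0..z}" f] by (metis integrable_integral)
    have "f integrable_on {x..y}"
      using integrable_on_subinterval[of f "{0..y}" x y] hi[of y] that by (auto simp: has_integral_iff)
    then obtain I where I: "(f has_integral I) {x..y}" by blast
    have "(f has_integral (F x + I)) {0..y}"
      by (rule has_integral_combine[OF that(1,2) hi I]) (use that in auto)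
    then have "F x + I = F y" using has_integral_unique[OF _ hi[of y]] that by simp
    then have "I = F y - F x" by simp
    then show ?thesis using I by simp
  qed
  obtain lP lQ where "(P \<longlongrightarrow> lP) (at_left T)" "(Q \<longlongrightarrow> lQ) (at_left T)"
    using mono_left_limit[OF P(2)] mono_left_limit[OF Q(2)] by blast
  then have lT: "(f \<longlongrightarrow> lP - lQ) (at_left T)" unfolding f_def by (intro tendsto_diff)
  have hr0: "filterlim (\<lambda>n. hh (r n)) (at_right 0) sequentially"
    unfolding filterlim_at
  proof
    show "\<forall>\<^sub>F n in sequentially. hh (r n) \<in> {0<..} \<and> hh (r n) \<noteq> 0"
      by (intro always_eventually allI) (simp add: hh(1) less_imp_neq[OF hh(1), symmetric])
  qed (fact hr)
  have "((\<lambda>h. (F (0 + h) - F 0) / h) \<longlongrightarrow> f 0) (at_right 0)"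
    by (rule quotient_at_right[OF T _ f_right]) (use int in auto)
  from filterlim_compose[OF this hr0] have lim0: "(\<lambda>n. a (r n) 0) \<longlonglongrightarrow> f 0"
    by (simp add: a_def)
  have "((\<lambda>h. (F T - F (T - h)) / h) \<longlongrightarrow> lP - lQ) (at_right 0)"
    by (rule quotient_at_left[OF T _ lT]) (use int in auto)
  from filterlim_compose[OF this hr0] have limT: "(\<lambda>n. a (r n) (N (r n) - 1)) \<longlonglongrightarrow> lP - lQ"
  proof -
    have "real (Suc (N n - 1)) * hh n = T" "real (N n - 1) * hh n = T - hh n" for n
      using N[of n] hh(2)[of n] by (simp_all add: of_nat_diff algebra_simps)
    then show "(\<lambda>n. (F T - F (T - hh (r n))) / hh (r n)) \<longlonglongrightarrow> lP - lQ \<Longrightarrow> ?thesis"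
      by (simp add: a_def)
  qed
  have var1: "(\<Sum>i<length s - 1. \<bar>f (s ! Suc i + \<epsilon>) - f (s ! i + \<epsilon>)\<bar>) \<le> f 0 + (lP - lQ)"
    if s: "sorted_wrt (<) s" and \<epsilon>: "\<And>z. z \<in> set s \<Longrightarrow> z + \<epsilon> \<notin> D" for s \<epsilon>
  proof (rule LIMSEQ_le)
    show "(\<lambda>n. \<Sum>i<length s - 1. \<bar>phi (r n) (s ! Suc i + \<epsilon>) - phi (r n) (s ! i + \<epsilon>)\<bar>) \<longlonglongrightarrow>
        (\<Sum>i<length s - 1. \<bar>f (s ! Suc i + \<epsilon>) - f (s ! i + \<epsilon>)\<bar>)"
      by (intro tendsto_sum tendsto_rabs tendsto_diff lim \<epsilon>) auto
    show "(\<lambda>n. a (r n) 0 + a (r n) (N (r n) - 1)) \<longlonglongrightarrow> f 0 + (lP - lQ)"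
      by (intro tendsto_add lim0 limT)
    have "sorted_wrt (<) (map (\<lambda>z. z + \<epsilon>) s)" using s by (simp add: sorted_wrt_map)
    from phi_variation[OF this]
    have "(\<Sum>i<length s - 1. \<bar>phi n (s ! Suc i + \<epsilon>) - phi n (s ! i + \<epsilon>)\<bar>) \<le> a n 0 + a n (N n - 1)" for n
      by (rule order_trans[OF eq_refl, rotated]) (auto intro!: sum.cong)
    then show "\<exists>n0. \<forall>n\<ge>n0. (\<Sum>i<length s - 1. \<bar>phi (r n) (s ! Suc i + \<epsilon>) - phi (r n) (s ! i + \<epsilon>)\<bar>) \<le> a (r n) 0 + a (r n) (N (r n) - 1)"
      by blast
  qed
  \<comment> \<open>Shift the chain to the right by small amounts that avoid D, use
    \<open>var1\<close> there, and let the shift tend to 0.\<close>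
  have var2: "(\<Sum>i<length s - 1. \<bar>f (s ! Suc i) - f (s ! i)\<bar>) \<le> f 0 + (lP - lQ)" if s: "sorted_wrt (<) s" for s
  proof -
    have "\<exists>\<epsilon>. 0 < \<epsilon> \<and> \<epsilon> < inverse (real (Suc k)) \<and> (\<forall>z\<in>set s. z + \<epsilon> \<notin> D)" for k
      by (rule sorted_shift_avoiding[OF D finite_set[of s], of "inverse (real (Suc k))"]) auto
    then obtain \<epsilon> where \<epsilon>: "\<And>k. 0 < \<epsilon> k" "\<And>k. \<epsilon> k < inverse (real (Suc k))" "\<And>k z. z \<in> set s \<Longrightarrow> z + \<epsilon> k \<notin> D"
      by metis
    have e0: "\<epsilon> \<longlonglongrightarrow> 0"
      by (rule tendsto_sandwich[OF _ _ tendsto_const LIMSEQ_inverse_real_of_nat]) (intro always_eventually allI less_imp_le \<epsilon>)+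
    have e: "filterlim (\<lambda>k. z + \<epsilon> k) (at_right z) sequentially" for z
      unfolding filterlim_at
    proof
      show "\<forall>\<^sub>F k in sequentially. z + \<epsilon> k \<in> {z<..} \<and> z + \<epsilon> k \<noteq> z"
        by (rule always_eventually) (use \<epsilon>(1) in \<open>simp add: less_imp_neq[symmetric]\<close>)
      show "(\<lambda>k. z + \<epsilon> k) \<longlonglongrightarrow> z"
        using tendsto_add[OF tendsto_const[of z] e0] by simp
    qed
    have "(\<lambda>k. \<Sum>i<length s - 1. \<bar>f (s ! Suc i + \<epsilon> k) - f (s ! i + \<epsilon> k)\<bar>) \<longlonglongrightarrow> (\<Sum>i<length s - 1. \<bar>f (s ! Suc i) - f (s ! i)\<bar>)"
      by (intro tendsto_sum tendsto_rabs tendsto_diff filterlim_compose[OF f_right e])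
    then show ?thesis
      by (rule LIMSEQ_le_const2) (use var1[OF s \<epsilon>(3)] in blast)
  qed
  show ?thesis
  proof (rule that[OF P(2) Q(2) P(1) Q(1)])
    show "total_variation {0<..<T} (\<lambda>t. P t - Q t) \<le> ereal (P 0 - Q 0 + (lP - lQ))"
      unfolding total_variation_def using var2 unfolding f_def by (intro SUP_least) simp
  qed (use f_nonneg int lT in \<open>auto simp: f_def[abs_def]\<close>)
qed

end

section \<open>The density of the location of the supremum\<close>

text \<open>\<open>interior_density\<close> sees f on \<open>(0, T)\<close> only, so f may be
  arbitrary outside; g is a globally measurable function that agrees with it inside.\<close>

lemma interior_densityI:
  assumes loc [measurable]: "sup_location X T \<in> borel_measurable M"
    and g [measurable]: "g \<in> borel_measurable borel" and gf: "\<And>t. t \<in> {0<..<T} \<Longrightarrow> g t = f t"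
    and eq: "\<And>B. B \<in> sets borel \<Longrightarrow> B \<subseteq> {0<..<T} \<Longrightarrow>
      emeasure M {\<omega>\<in>space M. sup_location X T \<omega> \<in> B} = (\<integral>\<^sup>+t. ennreal (g t) * indicator B t \<partial>lborel)"
  shows "interior_density M X T f"
  unfolding interior_density_def sup_location_law_def
proof (rule measure_eqI)
  show "sets (restrict_space (distr M borel (sup_location X T)) {0<..<T}) = sets (density (restrict_space lborel {0<..<T}) (\<lambda>t. ennreal (f t)))"
    by (simp add: sets_restrict_space)
  fix B assume "B \<in> sets (restrict_space (distr M borel (sup_location X T)) {0<..<T})"
  then have B [measurable]: "B \<in> sets borel" and BT: "B \<subseteq> {0<..<T}"
    by (auto simp: sets_restrict_space)
  have BR: "B \<in> sets (restrict_space lborel {0<..<T})" using B BT by (auto simp: sets_restrict_space)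
  have f: "(\<lambda>t. ennreal (f t)) \<in> borel_measurable (restrict_space lborel {0<..<T})"
  proof (subst measurable_cong)
    show "(\<lambda>t. ennreal (g t)) \<in> borel_measurable (restrict_space lborel {0<..<T})"
      by (rule measurable_restrict_space1) measurable
  qed (simp add: space_restrict_space gf)
  have "emeasure (restrict_space (distr M borel (sup_location X T)) {0<..<T}) B = emeasure (distr M borel (sup_location X T)) B"
    by (rule emeasure_restrict_space) (use BT in auto)
  also have "\<dots> = emeasure M {\<omega>\<in>space M. sup_location X T \<omega> \<in> B}"
    by (subst emeasure_distr) (auto intro!: arg_cong[where f = "emeasure M"])
  also have "\<dots> = (\<integral>\<^sup>+t. ennreal (g t) * indicator B t \<partial>lborel)" by (rule eq[OF B BT])
  also have "\<dots> = (\<integral>\<^sup>+t. ennreal (f t) * indicator B t * indicator {0<..<T} t \<partial>lborel)"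
    by (rule nn_integral_cong) (use BT gf in \<open>auto simp: indicator_def\<close>)
  also have "\<dots> = (\<integral>\<^sup>+t. ennreal (f t) * indicator B t \<partial>restrict_space lborel {0<..<T})"
    by (subst nn_integral_restrict_space) auto
  also have "\<dots> = emeasure (density (restrict_space lborel {0<..<T}) (\<lambda>t. ennreal (f t))) B"
    by (rule emeasure_density[OF f BR, symmetric])
  finally show "emeasure (restrict_space (distr M borel (sup_location X T)) {0<..<T}) B = emeasure (density (restrict_space lborel {0<..<T}) (\<lambda>t. ennreal (f t))) B" .
qed

lemma sup_location_eq_wloc: "sup_location X T \<omega> = wloc 0 T (\<lambda>t. X t \<omega>)"
  by (simp add: sup_location_def wloc_def wsup_def)

context stationary_L
begin

lemma \<nu>_diff:
  assumes "0 \<le> x" "x \<le> y" "y \<le> T" shows "\<nu> T 0 y - \<nu> T 0 x = \<nu> T x y"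
  using \<nu>_add[of 0 x y T] assms by simp

lemma step_density_\<nu>:
  assumes T: "0 < T"
  shows "step_density (\<lambda>x. \<nu> T 0 x) T Kb"
proof
  show "0 < T" by fact
  have "{\<omega> \<in> space M. loc 0 T \<omega> \<in> {0<..<0}} = {}" by auto
  then show "\<nu> T 0 0 = 0" by (simp only: \<nu>_def measure_empty)
  show "\<nu> T 0 x \<le> \<nu> T 0 y" if "0 \<le> x" "x \<le> y" "y \<le> T" for x y
    using \<nu>_diff[OF that] \<nu>_nonneg[of T x y] by simp
  show "\<nu> T 0 y - \<nu> T 0 x \<le> Kb * (y - x)" if "0 \<le> x" "x \<le> y" "y \<le> T" for x y
    using \<nu>_diff[OF that] \<nu>_le[OF that] by simp
  fix N :: nat assume N: "0 < N"
  define h where "h = T / real N"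
  have h: "0 < h" "real N * h = T" using N T by (auto simp: h_def)
  have c: "\<nu> T 0 (real (Suc j) * h) - \<nu> T 0 (real j * h) = \<nu> T (real j * h) (real (Suc j) * h)" if "j < N" for j
  proof (rule \<nu>_diff)
    have "real (Suc j) * h \<le> real N * h" using that h by (intro mult_right_mono) auto
    then show "real (Suc j) * h \<le> T" using h by simp
  qed (use h in \<open>auto intro!: mult_right_mono\<close>)
  have "(\<Sum>j<N - 1. \<bar>\<nu> T 0 (real (Suc (Suc j)) * h) - \<nu> T 0 (real (Suc j) * h) - (\<nu> T 0 (real (Suc j) * h) - \<nu> T 0 (real j * h))\<bar>)
     = (\<Sum>j<N - 1. \<bar>\<nu> T (real (Suc j) * h) (real (Suc (Suc j)) * h) - \<nu> T (real j * h) (real (Suc j) * h)\<bar>)"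
    by (rule sum.cong[OF refl]) (simp add: c del: of_nat_Suc)
  also have "\<dots> \<le> \<nu> T (real 0 * h) (real (Suc 0) * h) + \<nu> T (real (N - 1) * h) (real (Suc (N - 1)) * h)"
    using grid_variation[OF T N] unfolding h_def by simp
  also have "\<nu> T (real 0 * h) (real (Suc 0) * h) = \<nu> T 0 h" by simp
  also have "\<nu> T (real (N - 1) * h) (real (Suc (N - 1)) * h) = \<nu> T 0 T - \<nu> T 0 (T - h)"
    using c[of "N - 1"] N h by (simp add: of_nat_diff algebra_simps)
  finally show "(\<Sum>j<N - 1. \<bar>\<nu> T 0 (real (Suc (Suc j)) * (T / real N)) - \<nu> T 0 (real (Suc j) * (T / real N)) - (\<nu> T 0 (real (Suc j) * (T / real N)) - \<nu> T 0 (real j * (T / real N)))\<bar>)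
    \<le> \<nu> T 0 (T / real N) + (\<nu> T 0 T - \<nu> T 0 (T - T / real N))"
    unfolding h_def .
qed

lemma ex_density:
  assumes T: "0 < T"
  obtains f where "f \<in> borel_measurable borel" "\<And>x. 0 \<le> f x" "\<And>x. (f \<longlongrightarrow> f x) (at_right x)"
    "\<And>x y. 0 \<le> x \<Longrightarrow> x \<le> y \<Longrightarrow> y \<le> T \<Longrightarrow> (f has_integral \<nu> T x y) {x..y}"
    "cadlag_interior T f" "variation_property T f"
proof -
  interpret S: step_density "\<lambda>x. \<nu> T 0 x" T Kb by (rule step_density_\<nu>[OF T])
  obtain P Q l where PQ: "mono P" "mono Q" "\<And>x. continuous (at_right x) P" "\<And>x. continuous (at_right x) Q"
    "\<And>x. 0 \<le> P x - Q x"
    "\<And>x y. 0 \<le> x \<Longrightarrow> x \<le> y \<Longrightarrow> y \<le> T \<Longrightarrow> ((\<lambda>t. P t - Q t) has_integral (\<nu> T 0 y - \<nu> T 0 x)) {x..y}"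
    "((\<lambda>t. P t - Q t) \<longlongrightarrow> l) (at_left T)"
    "total_variation {0<..<T} (\<lambda>t. P t - Q t) \<le> ereal (P 0 - Q 0 + l)"
    by (rule S.ex_cadlag_density) (rule that)
  have r: "((\<lambda>t. P t - Q t) \<longlongrightarrow> P x - Q x) (at_right x)" for x
    using PQ(3,4)[of x] by (intro tendsto_diff) (simp_all add: continuous_within)
  show ?thesis
  proof (rule that[of "\<lambda>t. P t - Q t"])
    show "(\<lambda>t. P t - Q t) \<in> borel_measurable borel"
      using PQ(1,2) by (intro borel_measurable_diff borel_measurable_mono)
    show "((\<lambda>t. P t - Q t) has_integral \<nu> T x y) {x..y}" if "0 \<le> x" "x \<le> y" "y \<le> T" for x y
      using PQ(6)[OF that] \<nu>_diff[OF that] by simp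
    show "cadlag_interior T (\<lambda>t. P t - Q t)"
      unfolding cadlag_interior_def
    proof (intro ballI conjI)
      show "continuous (at_right t) (\<lambda>t. P t - Q t)" for t using PQ(3,4) by (intro continuous_diff)
      fix t obtain a b where "(P \<longlongrightarrow> a) (at_left t)" "(Q \<longlongrightarrow> b) (at_left t)"
        using mono_left_limit[OF PQ(1)] mono_left_limit[OF PQ(2)] by blast
      then show "\<exists>l. ((\<lambda>t. P t - Q t) \<longlongrightarrow> l) (at_left t)" by (intro exI[of _ "a - b"] tendsto_diff)
    qed
    show "variation_property T (\<lambda>t. P t - Q t)"
      unfolding variation_property_def
    proof
      show "total_variation {0<..<T} (\<lambda>t. P t - Q t) < \<infinity>"
        using PQ(8) by (rule le_less_trans) simp
      show "\<exists>f0 fT. ((\<lambda>t. P t - Q t) \<longlongrightarrow> f0) (at_right 0) \<and> ((\<lambda>t. P t - Q t) \<longlongrightarrow> fT) (at_left T) \<and>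
        total_variation {0<..<T} (\<lambda>t. P t - Q t) \<le> ereal (f0 + fT)"
        using r[of 0] PQ(7,8) by blast
    qed
  qed (fact PQ r)+
qed

lemma sup_location_eq_loc: "sup_location X T = loc 0 T"
  by (rule ext) (simp add: sup_location_eq_wloc loc_def)

text \<open>Masses of intervals suffice, because the law cut down to \<open>(0, T)\<close> and the
  measure with density f there have the same distribution function.\<close>

lemma interior_density_\<nu>:
  assumes T: "0 < T" and f [measurable]: "f \<in> borel_measurable borel" and nonneg: "\<And>x. 0 \<le> f x"
    and int: "\<And>x y. 0 \<le> x \<Longrightarrow> x \<le> y \<Longrightarrow> y \<le> T \<Longrightarrow> (f has_integral \<nu> T x y) {x..y}"
  shows "interior_density M X T f"
proof (rule interior_densityI[where g = f])
  have [measurable]: "loc 0 T \<in> borel_measurable M" using T by simp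
  show "sup_location X T \<in> borel_measurable M" by (simp add: sup_location_eq_loc)
  define m1 where "m1 = density (distr M borel (loc 0 T)) (indicator {0<..<T})"
  define m2 where "m2 = density lborel (\<lambda>t. ennreal (f t) * indicator {0<..<T} t)"
  have e1: "emeasure m1 B = emeasure M {\<omega>\<in>space M. loc 0 T \<omega> \<in> B \<inter> {0<..<T}}" if [measurable]: "B \<in> sets borel" for B
  proof -
    have "emeasure m1 B = (\<integral>\<^sup>+x. indicator {0<..<T} x * indicator B x \<partial>distr M borel (loc 0 T))"
      unfolding m1_def by (rule emeasure_density) simp_all
    also have "\<dots> = (\<integral>\<^sup>+x. indicator (B \<inter> {0<..<T}) x \<partial>distr M borel (loc 0 T))"
      by (rule nn_integral_cong) (auto simp: indicator_def)
    also have "\<dots> = emeasure (distr M borel (loc 0 T)) (B \<inter> {0<..<T})"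
      by (rule nn_integral_indicator) simp
    also have "\<dots> = emeasure M {\<omega>\<in>space M. loc 0 T \<omega> \<in> B \<inter> {0<..<T}}"
      by (subst emeasure_distr) (auto intro!: arg_cong[where f = "emeasure M"])
    finally show ?thesis .
  qed
  have e2: "emeasure m2 B = (\<integral>\<^sup>+t. ennreal (f t) * indicator (B \<inter> {0<..<T}) t \<partial>lborel)" if [measurable]: "B \<in> sets borel" for B
    unfolding m2_def by (subst emeasure_density) (auto intro!: nn_integral_cong simp: indicator_def)
  have e2c: "emeasure m2 {..y} = ennreal (\<nu> T 0 y)" if "0 \<le> y" "y \<le> T" for y
  proof -
    have ae: "AE t in lborel. t \<noteq> 0 \<and> t \<noteq> T" using AE_lborel_singleton[of 0] AE_lborel_singleton[of T] by eventually_elim simp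
    have "(\<integral>\<^sup>+t. ennreal (f t) * indicator ({..y} \<inter> {0<..<T}) t \<partial>lborel) = (\<integral>\<^sup>+t. ennreal (f t) * indicator {0..y} t \<partial>lborel)"
      by (rule nn_integral_cong_AE, rule eventually_mono[OF ae]) (use that in \<open>auto simp: indicator_def\<close>)
    also have "\<dots> = ennreal (\<nu> T 0 y)"
      by (rule nn_integral_has_integral_lebesgue') (use nonneg int that in auto)
    finally show ?thesis by (simp add: e2)
  qed
  have e1c: "emeasure m1 {..y} = ennreal (\<nu> T 0 y)" if y: "0 \<le> y" "y \<le> T" for y
  proof -
    have "prob {\<omega>\<in>space M. loc 0 T \<omega> \<in> {..y} \<inter> {0<..<T}} = \<nu> T 0 y"
    proof (cases "0 < y \<and> y < T")
      case True
      then have "AE \<omega> in M. loc 0 T \<omega> \<noteq> y" by (intro AE_loc_neq) auto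
      then show ?thesis unfolding \<nu>_def
        using True by (intro finite_measure_eq_AE) (auto elim!: eventually_mono)
    next
      case False
      then have "{..y} \<inter> {0<..<T} = {0<..<y}" using y by auto
      then show ?thesis by (simp add: \<nu>_def)
    qed
    then show ?thesis by (simp add: e1 emeasure_eq_measure)
  qed
  have low: "emeasure m1 {..y} = 0" "emeasure m2 {..y} = 0" if "y < 0" for y
  proof -
    have "{..y} \<inter> {0<..<T} = {}" using that by auto
    then show "emeasure m1 {..y} = 0" "emeasure m2 {..y} = 0" by (simp_all add: e1 e2)
  qed
  have high: "emeasure m1 {..y} = emeasure m1 {..T}" "emeasure m2 {..y} = emeasure m2 {..T}" if "T < y" for y
  proof -
    have "{..y} \<inter> {0<..<T} = {..T} \<inter> {0<..<T}" using that by auto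
    then show "emeasure m1 {..y} = emeasure m1 {..T}" "emeasure m2 {..y} = emeasure m2 {..T}" by (simp_all add: e1 e2)
  qed
  have eq: "emeasure m1 {..y} = emeasure m2 {..y}" for y
  proof -
    consider "y < 0" | "0 \<le> y" "y \<le> T" | "T < y" by linarith
    then show ?thesis
      by cases (use low e1c e2c high T in auto)
  qed
  have full: "emeasure m1 UNIV = emeasure m1 {..T}" "emeasure m2 UNIV = emeasure m2 {..T}"
  proof -
    have "UNIV \<inter> {0<..<T} = {..T} \<inter> {0<..<T}" by auto
    then show "emeasure m1 UNIV = emeasure m1 {..T}" "emeasure m2 UNIV = emeasure m2 {..T}" using e1[of UNIV] e1[of "{..T}"] e2[of UNIV] e2[of "{..T}"] by simp_all
  qed
  have sp: "space m1 = UNIV" "space m2 = UNIV" "sets m1 = sets borel" "sets m2 = sets borel" by (simp_all add: m1_def m2_def)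
  have "finite_measure m1" "finite_measure m2"
    by (rule finite_measureI, simp add: sp full e1c e2c T less_imp_le)+
  then have "m1 = m2"
    by (intro cdf_unique') (auto simp: finite_borel_measure_def finite_borel_measure_axioms_def sp cdf_def measure_def eq fun_eq_iff)
  then show "emeasure M {\<omega>\<in>space M. sup_location X T \<omega> \<in> B} = (\<integral>\<^sup>+t. ennreal (f t) * indicator B t \<partial>lborel)"
    if "B \<in> sets borel" "B \<subseteq> {0<..<T}" for B
    using e1[OF that(1)] e2[OF that(1)] Int_absorb2[OF that(2)] by (simp add: sup_location_eq_loc)
qed (use f in simp_all)

text \<open>Since f is recovered at every point, relations between masses pass to the chosen
  right-continuous version everywhere and not just almost everywhere.\<close>

lemma density_quotient:
  assumes x: "0 \<le> x" "x < T" and f: "(f \<longlongrightarrow> f x) (at_right x)"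
    and int: "\<And>x y. 0 \<le> x \<Longrightarrow> x \<le> y \<Longrightarrow> y \<le> T \<Longrightarrow> (f has_integral \<nu> T x y) {x..y}"
  shows "((\<lambda>h. \<nu> T x (x + h) / h) \<longlongrightarrow> f x) (at_right 0)"
proof -
  have zero: "\<nu> T x x = 0"
  proof -
    have "{\<omega> \<in> space M. loc 0 T \<omega> \<in> {x<..<x}} = {}" by auto
    then show ?thesis by (simp only: \<nu>_def measure_empty)
  qed
  have "((\<lambda>h. (\<nu> T x (x + h) - \<nu> T x x) / h) \<longlongrightarrow> f x) (at_right 0)"
    by (rule quotient_at_right[OF x(2) _ f]) (use int x zero in auto)
  then show ?thesis by (simp add: zero)
qed

section \<open>Interior mass one forces the uniform density\<close>

lemma AE_no_tie:
  assumes T: "0 < T" and U: "assumption_U M X T"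
  shows "AE \<omega> in M. \<not> has_tie r (r + T) (path \<omega>)"
proof -
  have m: "Measurable.pred path_space (\<lambda>x. \<not> has_tie 0 T x)"
    by (rule pred_intros_logic) (rule pred_has_tie, use T in simp)
  have "{\<omega>\<in>space M. has_tie 0 T (path \<omega>)} \<in> null_sets M"
    using U by (simp add: assumption_U_def has_tie_def wsup_def)
  then have "AE \<omega> in M. \<not> has_tie 0 T (path \<omega>)"
    by (rule AE_I') auto
  from AE_path_shift[OF m this, of r]
  have "AE \<omega> in M. \<not> has_tie 0 T (\<lambda>t. X (t + r) \<omega>)" .
  then show ?thesis
    by eventually_elim (simp add: has_tie_shift[of 0 T "path _" r] add.commute)
qed

text \<open>With interior mass 1, almost every path has a unique interior maximiser in each of
  countably many windows. Then \<open>argmax_shift_iff\<close> compares the windows at 0 and h path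
  by path, and stationarity moves the second one back to 0.\<close>

lemma \<nu>_translation:
  assumes U: "assumption_U M X T" and full: "\<nu> T 0 T = 1"
    and h: "0 < h" "h < a" "a < b" "b < T"
  shows "\<nu> T a b = \<nu> T (a - h) (b - h)"
proof -
  have T: "0 < T" "0 \<le> T" using h by auto
  \<comment> \<open>Rationals and their translates by h: countable, dense, containing 0 and h, and
    mapped into itself when r is replaced by h - r.\<close>
  define D where "D = \<rat> \<union> (\<lambda>q. q + h) ` \<rat>"
  have D: "countable D" "0 \<in> D" "h \<in> D" unfolding D_def using countable_rat by (auto intro!: image_eqI[of h _ 0])
  have Ddense: "\<exists>r\<in>D. u < r \<and> r < v" if "u < v" for u v
    using Rats_dense_in_real[OF that] unfolding D_def by blast
  have Drefl: "h - r \<in> D" if "r \<in> D" for r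
  proof -
    consider "r \<in> \<rat>" | q where "q \<in> \<rat>" "r = q + h" using \<open>r \<in> D\<close> unfolding D_def by blast
    then show ?thesis
    proof cases
      case 1
      then have "h - r = - r + h" "- r \<in> \<rat>" by auto
      then show ?thesis unfolding D_def by blast
    next
      case 2
      then have "h - r = - q" "- q \<in> \<rat>" by auto
      then show ?thesis unfolding D_def by simp
    qed
  qed
  have [measurable]: "loc r (r + T) \<in> borel_measurable M" for r using T by simp
  have [measurable]: "loc 0 T \<in> borel_measurable M" using T by simp
  have 1: "AE \<omega> in M. \<forall>r\<in>D. \<not> has_tie r (r + T) (path \<omega>)"
    using D(1) AE_no_tie[OF T(1) U] by (subst AE_ball_countable) auto
  have 2: "AE \<omega> in M. \<forall>r\<in>D. loc r (r + T) \<omega> \<in> {r<..<r + T}"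
  proof -
    have "AE \<omega> in M. loc r (r + T) \<omega> \<in> {r<..<r + T}" for r
    proof -
      have "prob {\<omega>\<in>space M. loc r (r + T) \<omega> \<in> {r<..<r + T}} = 1"
        using prob_loc_window[OF T(2), of r 0 T] full by simp
      then show ?thesis by (subst (asm) prob_Collect_eq_1) auto
    qed
    then show ?thesis using D(1) by (subst AE_ball_countable) auto
  qed
  have "AE \<omega> in M. loc 0 T \<omega> \<in> {a<..b} \<longleftrightarrow> loc h (h + T) \<omega> \<in> {a<..b}"
    using 1 2 AE_finite_local_max AE_space
  proof eventually_elim
    case (elim \<omega>)
    show ?case
      unfolding loc_def
    proof (rule argmax_shift_iff[where D = D])
      show "continuous_on UNIV (path \<omega>)" using elim by (intro cont)
      show "s = t" if "r \<in> D" "s \<in> {r..r+T}" "t \<in> {r..r+T}" "path \<omega> s = wsup r (r+T) (path \<omega>)" "path \<omega> t = wsup r (r+T) (path \<omega>)" for r s t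
        using elim(1) that unfolding has_tie_def by blast
      show "wloc r (r + T) (path \<omega>) \<in> {r<..<r + T}" if "r \<in> D" for r
        using elim(2) that unfolding loc_def by blast
      show "finite {t \<in> {c<..<d}. local_max_at (path \<omega>) t}" for c d using elim(3) by blast
    qed (use h D Ddense Drefl in auto)
  qed
  moreover have "AE \<omega> in M. loc 0 T \<omega> \<noteq> b" "AE \<omega> in M. loc h (h + T) \<omega> \<noteq> b"
    using h by (auto intro!: AE_loc_neq)
  ultimately have "AE \<omega> in M. (loc 0 T \<omega> \<in> {a<..<b}) = (loc h (h + T) \<omega> \<in> {a<..<b})"
    by eventually_elim auto
  then have "prob {\<omega>\<in>space M. loc 0 T \<omega> \<in> {a<..<b}} = prob {\<omega>\<in>space M. loc h (h + T) \<omega> \<in> {a<..<b}}"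
    by (intro finite_measure_eq_AE) auto
  then show ?thesis
    using prob_loc_window[OF T(2), of h "a - h" "b - h"] by (simp add: \<nu>_def)
qed

text \<open>Translation invariance of short intervals makes the right derivatives of the mass equal
  at all interior points; the total mass 1 fixes the constant.\<close>

lemma density_uniform:
  assumes U: "assumption_U M X T" and full: "\<nu> T 0 T = 1" and T: "0 < T"
    and f: "\<And>x. (f \<longlongrightarrow> f x) (at_right x)"
    and int: "\<And>x y. 0 \<le> x \<Longrightarrow> x \<le> y \<Longrightarrow> y \<le> T \<Longrightarrow> (f has_integral \<nu> T x y) {x..y}"
    and x: "x \<in> {0<..<T}"
  shows "f x = 1 / T"
proof -
  have less: "f x = f y" if xy: "0 < x" "x < y" "y < T" for x y
  proof -
    have "\<forall>\<^sub>F h in at_right 0. \<nu> T y (y + h) / h = \<nu> T x (x + h) / h"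
      unfolding eventually_at_right_field
    proof (rule exI[of _ "T - y"], intro conjI allI impI)
      fix h assume "0 < h" "h < T - y"
      then have "\<nu> T y (y + h) = \<nu> T (y - (y - x)) (y + h - (y - x))"
        using xy by (intro \<nu>_translation[OF U full]) auto
      then show "\<nu> T y (y + h) / h = \<nu> T x (x + h) / h" by (simp add: add.commute)
    qed (use xy in simp)
    moreover have "((\<lambda>h. \<nu> T y (y + h) / h) \<longlongrightarrow> f y) (at_right 0)"
      by (rule density_quotient[OF _ _ f int]) (use xy in auto)
    ultimately have l1: "((\<lambda>h. \<nu> T x (x + h) / h) \<longlongrightarrow> f y) (at_right 0)"
      by (rule Lim_transform_eventually[rotated])
    have l2: "((\<lambda>h. \<nu> T x (x + h) / h) \<longlongrightarrow> f x) (at_right 0)"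
      by (rule density_quotient[OF _ _ f int]) (use xy in auto)
    show ?thesis by (rule tendsto_unique[OF trivial_limit_at_right_real l2 l1])
  qed
  have const: "f y = f x" if "y \<in> {0<..<T}" for y
    using less[of x y] less[of y x] x that by (cases x y rule: linorder_cases) auto
  have "(f has_integral 1) {0<..<T}" using int[of 0 T] T full by (simp add: has_integral_Icc_iff_Ioo)
  then have "((\<lambda>_. f x) has_integral 1) {0<..<T}"
    by (rule has_integral_eq[rotated]) (rule const)
  moreover have "((\<lambda>_. f x) has_integral (T - 0) * f x) {0<..<T}"
    using has_integral_const_real[of "f x" 0 T] T by (simp add: has_integral_Icc_iff_Ioo)
  ultimately have "1 = (T - 0) * f x" by (rule has_integral_unique)
  then show ?thesis using T by (simp add: field_simps)
qed

end

section \<open>A density with infimum zero forces interior mass one\<close>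

text \<open>The number of occurrences among the first n events has expectation n * p but never
  exceeds 1. It is applied to the crossing of a level at successive blocks.\<close>

lemma (in prob_space) prob_AE_disjoint_eq_0:
  assumes A [measurable]: "\<And>n::nat. A n \<in> events" and p: "\<And>n. prob (A n) = p"
    and disj: "\<And>m n. m < n \<Longrightarrow> AE \<omega> in M. \<not> (\<omega> \<in> A m \<and> \<omega> \<in> A n)"
  shows "p = 0"
proof -
  have "AE \<omega> in M. \<forall>m n. m < n \<longrightarrow> \<not> (\<omega> \<in> A m \<and> \<omega> \<in> A n)"
    unfolding AE_all_countable using disj by (auto intro: AE_I2)
  then have le: "AE \<omega> in M. (\<Sum>i<n. indicator (A i) \<omega> :: real) \<le> 1" for n :: nat
  proof eventually_elim
    case (elim \<omega>)
    have "(\<Sum>i<n. indicator (A i) \<omega> :: real) = real (card {i. i < n \<and> \<omega> \<in> A i})"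
    proof -
      have "(\<Sum>i<n. indicator (A i) \<omega> :: real) = (\<Sum>i<n. if \<omega> \<in> A i then 1 else 0)"
        by (rule sum.cong) (auto simp: indicator_def)
      also have "\<dots> = real (card {i. i < n \<and> \<omega> \<in> A i})"
        by (simp add: sum.If_cases Int_def lessThan_def)
      finally show ?thesis .
    qed
    moreover have "card {i. i < n \<and> \<omega> \<in> A i} \<le> 1"
    proof -
      have "i = j" if "i \<in> {i. i < n \<and> \<omega> \<in> A i}" "j \<in> {i. i < n \<and> \<omega> \<in> A i}" for i j
        using elim that by (metis (mono_tags) linorder_neqE_nat mem_Collect_eq)
      then show ?thesis by (subst card_le_Suc0_iff_eq[folded One_nat_def]) auto
    qed
    ultimately show ?case by simp
  qed
  have ii: "integrable M (indicator (A i) :: _ \<Rightarrow> real)" for i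
    by (intro integrable_real_indicator A) (simp add: less_top[symmetric])
  have "real n * p \<le> 1" for n :: nat
  proof -
    have "real n * p = (\<Sum>i<n. prob (A i))" by (simp add: p)
    also have "\<dots> = (\<integral>\<omega>. (\<Sum>i<n. indicator (A i) \<omega>) \<partial>M)"
      by (subst Bochner_Integration.integral_sum) (simp_all add: ii)
    also have "\<dots> \<le> (\<integral>\<omega>. 1 \<partial>M)"
    proof (rule integral_mono_AE)
      show "integrable M (\<lambda>\<omega>. \<Sum>i<n. indicator (A i) \<omega> :: real)"
        by (intro Bochner_Integration.integrable_sum ii)
    qed (use le in simp_all)
    also have "\<dots> = 1" by (simp add: prob_space)
    finally show ?thesis .
  qed
  moreover have "0 \<le> p" using p[of 0] by (metis measure_nonneg)
  ultimately show ?thesis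
    using reals_Archimedean3[of p] by (metis linorder_not_le order_less_le)
qed

context stationary_L
begin

lemma density_antimono:
  assumes T: "0 < T" "T \<le> T'" and t: "t \<in> {0<..<T}" "t \<le> x" "x \<le> t + (T' - T)"
    and f: "(f \<longlongrightarrow> f t) (at_right t)" "\<And>x y. 0 \<le> x \<Longrightarrow> x \<le> y \<Longrightarrow> y \<le> T \<Longrightarrow> (f has_integral \<nu> T x y) {x..y}"
    and g: "(g \<longlongrightarrow> g x) (at_right x)" "\<And>x y. 0 \<le> x \<Longrightarrow> x \<le> y \<Longrightarrow> y \<le> T' \<Longrightarrow> (g has_integral \<nu> T' x y) {x..y}"
  shows "g x \<le> f t"
proof (rule tendsto_le[OF trivial_limit_at_right_real])
  show "((\<lambda>h. \<nu> T t (t + h) / h) \<longlongrightarrow> f t) (at_right 0)"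
    by (rule density_quotient[OF _ _ f]) (use t in auto)
  show "((\<lambda>h. \<nu> T' x (x + h) / h) \<longlongrightarrow> g x) (at_right 0)"
    by (rule density_quotient[OF _ _ g]) (use t in auto)
  show "\<forall>\<^sub>F h in at_right 0. \<nu> T' x (x + h) / h \<le> \<nu> T t (t + h) / h"
    unfolding eventually_at_right_field
  proof (rule exI[of _ "T - t"], intro conjI allI impI)
    fix h assume h: "0 < h" "h < T - t"
    then have "\<nu> T' x (x + h) \<le> \<nu> T t (t + h)"
      using T t by (intro \<nu>_antimono) auto
    then show "\<nu> T' x (x + h) / h \<le> \<nu> T t (t + h) / h" using h by (simp add: divide_right_mono)
  qed (use t in auto)
qed

text \<open>A point x of the middle part takes any prescribed relative position t in a suitable
  window of length T inside \<open>[0, T']\<close>. So the long-window density at x is at most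
  \<open>f t\<close> for every t, hence 0.\<close>

lemma \<nu>_middle_eq_0:
  assumes T: "0 < T" "2 * T \<le> T'"
    and f: "\<And>x. (f \<longlongrightarrow> f x) (at_right x)" "\<And>x y. 0 \<le> x \<Longrightarrow> x \<le> y \<Longrightarrow> y \<le> T \<Longrightarrow> (f has_integral \<nu> T x y) {x..y}"
    and small: "\<And>e. e > 0 \<Longrightarrow> \<exists>t\<in>{0<..<T}. f t < e"
  shows "\<nu> T' T (T' - T) = 0"
proof -
  have T': "0 < T'" using T by simp
  obtain g where g: "\<And>x. 0 \<le> g x" "\<And>x. (g \<longlongrightarrow> g x) (at_right x)"
    "\<And>x y. 0 \<le> x \<Longrightarrow> x \<le> y \<Longrightarrow> y \<le> T' \<Longrightarrow> (g has_integral \<nu> T' x y) {x..y}"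
    by (rule ex_density[OF T']) (rule that)
  have g0: "g x = 0" if x: "x \<in> {T<..<T' - T}" for x
  proof (rule antisym[OF field_le_epsilon g(1)])
    fix e :: real assume "e > 0"
    then obtain t where t: "t \<in> {0<..<T}" "f t < e" using small by blast
    have "g x \<le> f t"
      by (rule density_antimono[OF T(1) _ t(1) _ _ f(1) f(2) g(2) g(3)]) (use x t T in auto)
    then show "g x \<le> 0 + e" using t by simp
  qed
  have "(g has_integral \<nu> T' T (T' - T)) {T<..<T' - T}"
    using g(3)[of T "T' - T"] T by (simp add: has_integral_Icc_iff_Ioo)
  moreover have "(g has_integral 0) {T<..<T' - T}"
    by (rule has_integral_is_0) (rule g0)
  ultimately show ?thesis by (rule has_integral_unique)
qed

text \<open>Blocks have length 3 * T: even a single block is long enough for \<open>mid\<close>. The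
  maximum over blocks i to k lies within T of an end, hence in block i or in block k, and this is
  quasi-convexity of the block maxima.\<close>

lemma blocks_full_mass:
  assumes T: "0 < T" and mid: "\<And>T'. 2 * T \<le> T' \<Longrightarrow> \<nu> T' T (T' - T) = 0"
  shows "\<nu> T 0 T = 1"
proof -
  define S where "S = 3 * T"
  have S: "0 < S" "T < S" using T by (auto simp: S_def)
  define W where "W k \<omega> = wsup (real k * S) (real (Suc k) * S) (path \<omega>)" for k \<omega>
  have kS: "real k * S \<le> real (Suc k) * S" for k using S by (intro mult_right_mono) auto
  have [measurable]: "W k \<in> borel_measurable M" for k
    using measurable_compose[OF measurable_path measurable_wsup] by (simp add: W_def[abs_def])
  have ijS: "real i * S \<le> real j * S" if "i \<le> j" for i j using S that by (intro mult_right_mono) auto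
  have nomid: "AE \<omega> in M. loc (real i * S) (real (Suc k) * S) \<omega> \<notin> {real i * S + T<..<real (Suc k) * S - T}" if "i \<le> k" for i k
  proof -
    define T' where "T' = real (Suc k) * S - real i * S"
    have "real (Suc i) * S \<le> real (Suc k) * S" using that by (intro ijS) simp
    then have "S \<le> T'" by (simp add: T'_def algebra_simps)
    then have T': "2 * T \<le> T'" "0 \<le> T'" using T by (simp_all add: S_def)
    have [measurable]: "loc (real i * S) (real i * S + T') \<in> borel_measurable M" using T' by simp
    have "prob {\<omega>\<in>space M. loc (real i * S) (real i * S + T') \<omega> \<in> {real i * S + T<..<real i * S + (T' - T)}} = 0"
      using prob_loc_window[OF T'(2), of "real i * S" T "T' - T"] mid[OF T'(1)] by simp
    then have "AE \<omega> in M. \<omega> \<notin> {\<omega>\<in>space M. loc (real i * S) (real i * S + T') \<omega> \<in> {real i * S + T<..<real i * S + (T' - T)}}"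
      by (subst (asm) prob_eq_0) auto
    then show ?thesis using AE_space by eventually_elim (auto simp: T'_def)
  qed
  have quasi: "AE \<omega> in M. \<forall>i j k. i < j \<longrightarrow> j < k \<longrightarrow> W j \<omega> \<le> max (W i \<omega>) (W k \<omega>)"
    unfolding AE_all_countable
  proof (intro allI)
    fix i j k :: nat
    show "AE \<omega> in M. i < j \<longrightarrow> j < k \<longrightarrow> W j \<omega> \<le> max (W i \<omega>) (W k \<omega>)"
    proof (cases "i < j \<and> j < k")
      case ijk: True
      then have "i \<le> k" by simp
      show ?thesis using nomid[OF \<open>i \<le> k\<close>] AE_space
      proof eventually_elim
        case (elim \<omega>)
        have c: "continuous_on UNIV (path \<omega>)" using elim cont by blast
        let ?a = "real i * S" and ?b = "real (Suc k) * S"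
        have o: "?a \<le> real (Suc i) * S" "real (Suc i) * S \<le> real j * S" "real j * S \<le> real (Suc j) * S"
          "real (Suc j) * S \<le> real k * S" "real k * S \<le> ?b"
          using ijk by (auto intro!: ijS simp del: of_nat_Suc)
        have ab: "?a \<le> ?b" using o by linarith
        define L where "L = loc ?a ?b \<omega>"
        have Lin: "?a \<le> L" "L \<le> ?b" using loc_in[OF ab] elim by (auto simp: L_def)
        have Wj: "W j \<omega> \<le> path \<omega> L"
        proof -
          have "W j \<omega> = path \<omega> (wloc (real j * S) (real (Suc j) * S) (path \<omega>))"
            unfolding W_def by (rule wloc_sup[OF c o(3), symmetric])
          also have "\<dots> \<le> path \<omega> L"
            unfolding L_def loc_def using wloc_in[OF c o(3)] o by (intro wloc_max[OF c ab]) auto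
          finally show ?thesis .
        qed
        have "L \<le> ?a + T \<or> ?b - T \<le> L" using elim by (auto simp: L_def)
        then show ?case
        proof
          assume "L \<le> ?a + T"
          then have "L \<in> {?a..real (Suc i) * S}" using Lin S by (auto simp: algebra_simps)
          then have "path \<omega> L \<le> W i \<omega>" unfolding W_def by (rule wsup_ge[OF c])
          then show ?thesis using Wj by auto
        next
          assume "?b - T \<le> L"
          then have "L \<in> {real k * S..?b}" using Lin S by (auto simp: algebra_simps)
          then have "path \<omega> L \<le> W k \<omega>" unfolding W_def by (rule wsup_ge[OF c])
          then show ?thesis using Wj by auto
        qed
      qed
    qed auto
  qed
  have wshift: "W k \<omega> = wsup 0 S (\<lambda>t. X (t + real k * S) \<omega>)" for k \<omega>
    using wsup_shift[of 0 S "path \<omega>" "real k * S"] by (simp add: W_def algebra_simps)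
  have wshift2: "W (Suc k) \<omega> = wsup S (2 * S) (\<lambda>t. X (t + real k * S) \<omega>)" for k \<omega>
    using wsup_shift[of S "2 * S" "path \<omega>" "real k * S"] by (simp add: W_def algebra_simps)
  have up0: "prob {\<omega>\<in>space M. W n \<omega> \<le> c \<and> c < W (Suc n) \<omega>} = 0" for c n
  proof -
    define A where "A n = {\<omega>\<in>space M. W n \<omega> \<le> c \<and> c < W (Suc n) \<omega>}" for n
    have m: "Measurable.pred path_space (\<lambda>x. wsup 0 S x \<le> c \<and> c < wsup S (2 * S) x)"
      using measurable_wsup by (intro pred_intros_logic borel_measurable_pred_less borel_measurable_const) (auto simp: pred_def)
    have "prob (A n) = prob {\<omega>\<in>space M. wsup 0 S (path \<omega>) \<le> c \<and> c < wsup S (2 * S) (path \<omega>)}" for n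
      using prob_path_shift[OF m, of "real n * S"] unfolding A_def wshift2 wshift[of n] by simp
    \<comment> \<open>A second upward crossing at n would put block k + 1 above c, strictly between
      blocks k and n which are both at most c.\<close>
    moreover have "AE \<omega> in M. \<not> (\<omega> \<in> A k \<and> \<omega> \<in> A n)" if "k < n" for k n
      using quasi
    proof eventually_elim
      case (elim \<omega>)
      show ?case
      proof
        assume "\<omega> \<in> A k \<and> \<omega> \<in> A n"
        then have *: "W k \<omega> \<le> c" "c < W (Suc k) \<omega>" "W n \<omega> \<le> c" by (auto simp: A_def)
        then have "Suc k < n" using that by (metis Suc_lessI not_le)
        then have "W (Suc k) \<omega> \<le> max (W k \<omega>) (W n \<omega>)" using elim by blast
        then show False using * by auto
      qed
    qed
    moreover have "A n \<in> events" for n unfolding A_def by measurable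
    ultimately have "prob {\<omega>\<in>space M. wsup 0 S (path \<omega>) \<le> c \<and> c < wsup S (2 * S) (path \<omega>)} = 0"
      using prob_AE_disjoint_eq_0[of A] by blast
    then show ?thesis
      using \<open>prob (A n) = prob {\<omega>\<in>space M. wsup 0 S (path \<omega>) \<le> c \<and> c < wsup S (2 * S) (path \<omega>)}\<close> by (simp add: A_def)
  qed
  have down0: "prob {\<omega>\<in>space M. c < W n \<omega> \<and> W (Suc n) \<omega> \<le> c} = 0" for c n
  proof -
    define A where "A n = {\<omega>\<in>space M. c < W n \<omega> \<and> W (Suc n) \<omega> \<le> c}" for n
    have m: "Measurable.pred path_space (\<lambda>x. c < wsup 0 S x \<and> wsup S (2 * S) x \<le> c)"
      using measurable_wsup by (intro pred_intros_logic borel_measurable_pred_less borel_measurable_const) (auto simp: pred_def)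
    have pA: "prob (A n) = prob {\<omega>\<in>space M. c < wsup 0 S (path \<omega>) \<and> wsup S (2 * S) (path \<omega>) \<le> c}" for n
      using prob_path_shift[OF m, of "real n * S"] unfolding A_def wshift2 wshift[of n] by simp
    have "AE \<omega> in M. \<not> (\<omega> \<in> A k \<and> \<omega> \<in> A n)" if "k < n" for k n
      using quasi
    proof eventually_elim
      case (elim \<omega>)
      show ?case
      proof
        assume "\<omega> \<in> A k \<and> \<omega> \<in> A n"
        then have *: "W (Suc k) \<omega> \<le> c" "c < W n \<omega>" "W (Suc n) \<omega> \<le> c" by (auto simp: A_def)
        then have "Suc k < n" using that by (metis Suc_lessI not_le)
        then have "W n \<omega> \<le> max (W (Suc k) \<omega>) (W (Suc n) \<omega>)" using elim by blast
        then show False using * by auto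
      qed
    qed
    moreover have "A n \<in> events" for n unfolding A_def by measurable
    ultimately have "prob {\<omega>\<in>space M. c < wsup 0 S (path \<omega>) \<and> wsup S (2 * S) (path \<omega>) \<le> c} = 0"
      using prob_AE_disjoint_eq_0[of A] pA by blast
    then show ?thesis using pA[of n] by (simp add: A_def)
  qed
  have "AE \<omega> in M. \<forall>n. \<forall>c\<in>\<rat>. \<not> (W n \<omega> \<le> c \<and> c < W (Suc n) \<omega>) \<and> \<not> (c < W n \<omega> \<and> W (Suc n) \<omega> \<le> c)"
    unfolding AE_all_countable
  proof
    fix n
    have "AE \<omega> in M. \<not> (W n \<omega> \<le> c \<and> c < W (Suc n) \<omega>) \<and> \<not> (c < W n \<omega> \<and> W (Suc n) \<omega> \<le> c)" for c
    proof -
      have "AE \<omega> in M. \<omega> \<notin> {\<omega>\<in>space M. W n \<omega> \<le> c \<and> c < W (Suc n) \<omega>}"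
        using up0[of n c] by (subst (asm) prob_eq_0) auto
      moreover have "AE \<omega> in M. \<omega> \<notin> {\<omega>\<in>space M. c < W n \<omega> \<and> W (Suc n) \<omega> \<le> c}"
        using down0[of c n] by (subst (asm) prob_eq_0) auto
      ultimately show ?thesis using AE_space by eventually_elim blast
    qed
    then show "AE \<omega> in M. \<forall>c\<in>\<rat>. \<not> (W n \<omega> \<le> c \<and> c < W (Suc n) \<omega>) \<and> \<not> (c < W n \<omega> \<and> W (Suc n) \<omega> \<le> c)"
      by (subst AE_ball_countable[OF countable_rat]) blast
  qed
  then have eqW: "AE \<omega> in M. \<forall>n. W n \<omega> = W (Suc n) \<omega>"
  proof eventually_elim
    case (elim \<omega>)
    show ?case
    proof
      fix n
      show "W n \<omega> = W (Suc n) \<omega>"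
      proof (rule linorder_cases)
        assume "W n \<omega> < W (Suc n) \<omega>"
        then obtain c where "c \<in> \<rat>" "W n \<omega> < c" "c < W (Suc n) \<omega>" using Rats_dense_in_real by blast
        then show ?thesis using elim less_imp_le by blast
      next
        assume "W (Suc n) \<omega> < W n \<omega>"
        then obtain c where "c \<in> \<rat>" "W (Suc n) \<omega> < c" "c < W n \<omega>" using Rats_dense_in_real by blast
        then show ?thesis using elim less_imp_le by blast
      qed
    qed
  qed
  have nomid13: "AE \<omega> in M. loc S (4 * S) \<omega> \<notin> {S + T<..<4 * S - T}"
    using nomid[of 1 3] by simp
  have "AE \<omega> in M. loc S (S + T) \<omega> \<in> {S<..<S + T}"
    using eqW nomid13 AE_not_local_max[of S] AE_not_local_max[of "S + T"] AE_space
  proof eventually_elim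
    case (elim \<omega>)
    have c: "continuous_on UNIV (path \<omega>)" using elim cont by blast
    have W: "W 0 \<omega> = wsup 0 S (path \<omega>)" "W 1 \<omega> = wsup S (2 * S) (path \<omega>)" "W 2 \<omega> = wsup (2 * S) (3 * S) (path \<omega>)" "W 3 \<omega> = wsup (3 * S) (4 * S) (path \<omega>)"
      by (simp_all add: W_def algebra_simps)
    have "W 0 \<omega> = W (Suc 0) \<omega>" "W (Suc 0) \<omega> = W (Suc (Suc 0)) \<omega>" "W (Suc (Suc 0)) \<omega> = W (Suc (Suc (Suc 0))) \<omega>" using elim(1) by blast+
    then have Weq: "W 0 \<omega> = W 1 \<omega>" "W 2 \<omega> = W 1 \<omega>" "W 3 \<omega> = W 1 \<omega>" by (simp_all add: numeral_2_eq_2 numeral_3_eq_3)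
    have bound: "path \<omega> s \<le> W 1 \<omega>" if "s \<in> {0..4 * S}" for s
    proof -
      consider "s \<in> {0..S}" | "s \<in> {S..2 * S}" | "s \<in> {2 * S..3 * S}" | "s \<in> {3 * S..4 * S}" using \<open>s \<in> {0..4 * S}\<close> by fastforce
      then show ?thesis
        by cases (use wsup_ge[OF c] Weq W in fastforce)+
    qed
    \<comment> \<open>With equal block maxima the leftmost maximiser over blocks 1 to 3 falls into
      block 1, and as it avoids the middle it is within T of S. Equality with block 0 makes it a
      local maximum even if it were S itself, so almost surely it is neither S nor S + T.\<close>
    define L where "L = loc S (4 * S) \<omega>"
    define L1 where "L1 = wloc S (2 * S) (path \<omega>)"
    have S4: "S \<le> 4 * S" "S \<le> 2 * S" using S by auto
    have L1: "L1 \<in> {S..2 * S}" "path \<omega> L1 = W 1 \<omega>" unfolding L1_def W using wloc_in[OF c S4(2)] wloc_sup[OF c S4(2)] by auto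
    have Lle: "L \<le> 2 * S"
    proof (rule ccontr)
      assume "\<not> L \<le> 2 * S"
      then have "path \<omega> L1 < path \<omega> L"
        unfolding L_def loc_def using L1 by (intro wloc_left[OF c S4(1)]) auto
      moreover have "path \<omega> L \<le> W 1 \<omega>" using loc_in[OF S4(1), of \<omega>] elim S by (intro bound) (auto simp: L_def)
      ultimately show False using L1 by simp
    qed
    have Lin: "S \<le> L" using loc_in(1)[OF S4(1)] elim by (simp add: L_def)
    have LT: "L \<le> S + T" using elim(2) Lle S by (auto simp: L_def S_def)
    have PL: "path \<omega> L = W 1 \<omega>"
    proof (rule antisym)
      show "path \<omega> L \<le> W 1 \<omega>" using Lin Lle S by (intro bound) auto
      show "W 1 \<omega> \<le> path \<omega> L"
        unfolding L1(2)[symmetric] L_def loc_def using L1 S by (intro wloc_max[OF c S4(1)]) auto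
    qed
    have "local_max_at (path \<omega>) L"
      by (rule local_max_atI[of 0 _ "3 * S"]) (use Lin Lle S PL bound in auto)
    then have "L \<noteq> S" "L \<noteq> S + T" using elim by auto
    moreover have "loc S (S + T) \<omega> = L"
      unfolding L_def using elim Lin LT S by (intro loc_subinterval) (auto simp: L_def)
    ultimately show ?case using Lin LT by auto
  qed
  then have "prob {\<omega>\<in>space M. loc S (S + T) \<omega> \<in> {S + 0<..<S + T}} = 1"
    using T by (subst prob_Collect_eq_1) auto
  then show ?thesis using prob_loc_window[of T S 0 T] T by simp
qed

theorem density_properties:
  assumes T: "0 < T" and U: "assumption_U M X T"
  shows "absolutely_continuous (restrict_space lborel {0<..<T}) (restrict_space (sup_location_law M X T) {0<..<T}) \<and>
    (\<exists>f. (\<forall>t\<in>{0<..<T}. 0 \<le> f t) \<and> cadlag_interior T f \<and> interior_density M X T f \<and>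
       variation_property T f \<and> (INF t\<in>{0<..<T}. f t) > 0 \<and>
       ((\<forall>t\<in>{0<..<T}. f t = 1 / T) \<or> (LBINT t:{0<..<T}. f t) < 1))"
proof -
  obtain f where f: "f \<in> borel_measurable borel" "\<And>x. 0 \<le> f x" "\<And>x. (f \<longlongrightarrow> f x) (at_right x)"
    "\<And>x y. 0 \<le> x \<Longrightarrow> x \<le> y \<Longrightarrow> y \<le> T \<Longrightarrow> (f has_integral \<nu> T x y) {x..y}"
    "cadlag_interior T f" "variation_property T f"
    by (rule ex_density[OF T]) (rule that)
  have dens: "interior_density M X T f"
    by (rule interior_density_\<nu>[OF T f(1) f(2) f(4)])
  have ne: "{0<..<T} \<noteq> {}" using T by simp
  have bdd: "bdd_below (f ` {0<..<T})" using f(2) by (intro bdd_belowI2)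
  have int: "(LBINT t:{0<..<T}. f t) = \<nu> T 0 T"
  proof -
    have "(\<integral>\<^sup>+x. ennreal (f x) * indicator {0<..<T} x \<partial>lborel) = ennreal (\<nu> T 0 T)"
      by (rule nn_integral_has_integral_lebesgue') (use f(2) f(4)[of 0 T] T in \<open>auto simp: has_integral_Icc_iff_Ioo[symmetric]\<close>)
    then have "(\<integral>\<^sup>+x. ennreal (indicator {0<..<T} x * f x) \<partial>lborel) = ennreal (\<nu> T 0 T)"
      by (simp add: mult.commute ennreal_mult f(2) ennreal_indicator)
    then show ?thesis
      unfolding set_lebesgue_integral_def real_scaleR_def using f(1,2) \<nu>_nonneg
      by (subst integral_eq_nn_integral) auto
  qed
  have unif: "\<forall>t\<in>{0<..<T}. f t = 1 / T" if "\<nu> T 0 T = 1"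
    using density_uniform[OF U that T f(3) f(4)] by blast
  have alt: "(\<forall>t\<in>{0<..<T}. f t = 1 / T) \<or> (LBINT t:{0<..<T}. f t) < 1"
    using unif int \<nu>_le_1[of T 0 T] by linarith
  have pos: "(INF t\<in>{0<..<T}. f t) > 0"
  proof (rule ccontr)
    assume n: "\<not> (INF t\<in>{0<..<T}. f t) > 0"
    have small: "\<exists>t\<in>{0<..<T}. f t < e" if "e > 0" for e
    proof -
      have "(INF t\<in>{0<..<T}. f t) < e" using n that by linarith
      then show ?thesis by (simp add: cINF_less_iff[OF ne bdd])
    qed
    have "\<nu> T 0 T = 1"
      by (rule blocks_full_mass[OF T]) (rule \<nu>_middle_eq_0[OF T _ f(3) f(4) small])
    then have "\<forall>t\<in>{0<..<T}. f t = 1 / T" by (rule unif)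
    then show False using small[of "1 / T"] T by auto
  qed
  have "absolutely_continuous (restrict_space lborel {0<..<T}) (restrict_space (sup_location_law M X T) {0<..<T})"
    using dens f(1) unfolding interior_density_def
    by (auto intro!: absolutely_continuousI_density measurable_restrict_space1)
  then show ?thesis using f(2,5,6) dens pos alt by blast
qed

end

section \<open>Periodic envelopes of tents\<close>

lemma int_strict_mono_step:
  fixes f :: "int \<Rightarrow> real"
  assumes step: "\<And>i. f i < f (i + 1)" and "i < j"
  shows "f i < f j"
proof -
  have "f i < f (i + 1 + int k)" for k
  proof (induction k)
    case 0 then show ?case using step by simp
  next
    case (Suc k)
    then show ?case using step[of "i + 1 + int k"] by (simp add: algebra_simps)
  qed
  from this[of "nat (j - i - 1)"] show ?thesis using \<open>i < j\<close> by simp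
qed

definition envelope :: "(int \<Rightarrow> real) \<Rightarrow> (int \<Rightarrow> real) \<Rightarrow> real \<Rightarrow> real" where
  "envelope p h x = (SUP i. h i - \<bar>x - p i\<bar>)"

text \<open>
  Peak \<open>i\<close> is the maximum over \<open>[u, u + T]\<close> exactly when \<open>a i < p i - u < b i\<close>, up to ties:
  \<open>right_ge\<close> and \<open>right_eq\<close> say that the nearest higher tent on the right reaches the
  height of peak \<open>i\<close> at distance \<open>T - a i\<close> (at least \<open>T\<close> if \<open>a i = 0\<close>); \<open>left_ge\<close> and
  \<open>left_eq\<close> do the same on the left with distance \<open>b i\<close>.
\<close>

locale tents =
  fixes p h :: "int \<Rightarrow> real" and n :: int and L T :: real and a b :: "int \<Rightarrow> real"
  assumes n: "0 < n" and L: "0 < L" and T: "0 < T"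
    and period: "p (i + n) = p i + L" "h (i + n) = h i" "a (i + n) = a i" "b (i + n) = b i"
    and gap: "\<bar>h (i + 1) - h i\<bar> < p (i + 1) - p i"
    and right_ge: "i < k \<Longrightarrow> h i < h k \<Longrightarrow> T - a i \<le> (p k - h k) - (p i - h i)"
    and right_eq: "a i \<noteq> 0 \<Longrightarrow> \<exists>k>i. h i < h k \<and> (p k - h k) - (p i - h i) = T - a i"
    and left_ge: "k < i \<Longrightarrow> h i < h k \<Longrightarrow> b i \<le> (p i + h i) - (p k + h k)"
    and left_eq: "b i \<noteq> T \<Longrightarrow> \<exists>k<i. h i < h k \<and> (p i + h i) - (p k + h k) = b i"
    and equal: "i < k \<Longrightarrow> h k = h i \<Longrightarrow> (\<And>l. i < l \<Longrightarrow> l < k \<Longrightarrow> h l \<le> h i) \<Longrightarrow> T \<le> p k - p i"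
begin

text \<open>The feet of tent i: it rises along x - \<open>A i\<close> and falls along
  \<open>C i\<close> - x. The condition \<open>gap\<close> says that both feet increase with i, so
  no tent hides under a neighbour.\<close>

definition A :: "int \<Rightarrow> real" where "A i = p i - h i"
definition C :: "int \<Rightarrow> real" where "C i = p i + h i"
abbreviation g :: "real \<Rightarrow> real" where "g \<equiv> envelope p h"

lemma A_less: "i < j \<Longrightarrow> A i < A j"
proof (rule int_strict_mono_step[of A])
  show "A k < A (k + 1)" for k using gap[of k] unfolding A_def abs_less_iff by linarith
qed

lemma C_less: "i < j \<Longrightarrow> C i < C j"
proof (rule int_strict_mono_step[of C])
  show "C k < C (k + 1)" for k using gap[of k] unfolding C_def abs_less_iff by linarith
qed

lemma p_less: "i < j \<Longrightarrow> p i < p j"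
  using A_less[of i j] C_less[of i j] by (simp add: A_def C_def)

lemma p_less_iff: "p i < p j \<longleftrightarrow> i < j"
  using p_less[of i j] p_less[of j i] by (cases i j rule: linorder_cases) auto

lemma period_nat: "p (i + int k * n) = p i + real k * L" "h (i + int k * n) = h i"
  "a (i + int k * n) = a i" "b (i + int k * n) = b i"
proof (induction k)
  case (Suc k)
  have e: "i + int (Suc k) * n = (i + int k * n) + n" by (simp add: algebra_simps)
  { case 1 then show ?case unfolding e period using Suc by (simp add: algebra_simps) }
  { case 2 then show ?case unfolding e period using Suc by simp }
  { case 3 then show ?case unfolding e period using Suc by simp }
  { case 4 then show ?case unfolding e period using Suc by simp }
qed simp_all

lemma period_int: "p (i + k * n) = p i + of_int k * L" "h (i + k * n) = h i"
  "a (i + k * n) = a i" "b (i + k * n) = b i"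
proof -
  have "p (i + k * n) = p i + of_int k * L \<and> h (i + k * n) = h i \<and> a (i + k * n) = a i \<and> b (i + k * n) = b i"
  proof (cases "0 \<le> k")
    case True
    then show ?thesis using period_nat[of i "nat k"] by simp
  next
    case False
    then have "k = - int (nat (- k))" by simp
    then obtain m where m: "k = - int m" by blast
    have "i + k * n + int m * n = i" by (simp add: m algebra_simps)
    then show ?thesis using period_nat[of "i + k * n" m] by (simp add: m)
  qed
  then show "p (i + k * n) = p i + of_int k * L" "h (i + k * n) = h i" "a (i + k * n) = a i" "b (i + k * n) = b i"
    by auto
qed

lemma bdd_h: "\<exists>B. \<forall>i. h i \<le> B"
proof -
  have "h i \<le> Max (h ` {0..<n})" for i
  proof -
    have "h i = h (i mod n)" using period_int(2)[of "i mod n" "i div n"] by (simp add: add.commute)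
    then show ?thesis using n by (intro Max_ge) (auto intro!: image_eqI[of _ _ "i mod n"])
  qed
  then show ?thesis by blast
qed

lemma bdd_tents: "bdd_above (range (\<lambda>i. h i - \<bar>x - p i\<bar>))"
proof -
  obtain B where "\<forall>i. h i \<le> B" using bdd_h by blast
  then have B: "h i \<le> B" for i by blast
  have "h i - \<bar>x - p i\<bar> \<le> B" for i using B[of i] abs_ge_zero[of "x - p i"] by linarith
  then show ?thesis by (intro bdd_aboveI2)
qed

lemma g_ge: "h i - \<bar>x - p i\<bar> \<le> g x"
  unfolding envelope_def by (rule cSUP_upper[OF _ bdd_tents]) simp

lemma g_leI: "(\<And>i. h i - \<bar>x - p i\<bar> \<le> c) \<Longrightarrow> g x \<le> c"
  unfolding envelope_def by (rule cSUP_least) auto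

lemma ex_cell: "\<exists>i. p i \<le> x \<and> x < p (i + 1)"
proof -
  obtain k :: int where k: "of_int k \<le> (x - p 0) / L" "(x - p 0) / L < of_int k + 1"
    using floor_exists[of "(x - p 0) / L"] by auto
  have 1: "p (k * n) \<le> x" using period_int(1)[of 0 k] k(1) L by (simp add: le_divide_eq)
  have 2: "x < p (k * n + n)"
    using period_int(1)[of 0 k] period(1)[of "k * n"] k(2) L by (simp add: divide_less_eq algebra_simps)
  define m where "m = (LEAST m::nat. x < p (k * n + int m))"
  have "x < p (k * n + int (nat n))" using 2 n by simp
  then have m: "x < p (k * n + int m)" and least: "\<And>m'. m' < m \<Longrightarrow> \<not> x < p (k * n + int m')"
    unfolding m_def using LeastI[of "\<lambda>m. x < p (k * n + int m)"] not_less_Least by blast+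
  have "m \<noteq> 0" using m 1 by (cases m) auto
  then have "p (k * n + int (m - 1)) \<le> x" using least[of "m - 1"] by simp
  then show ?thesis using m \<open>m \<noteq> 0\<close> by (intro exI[of _ "k * n + int (m - 1)"]) (simp add: of_nat_diff)
qed

text \<open>The falling lines of tents to the left are ordered by their right feet, the rising lines
  of tents to the right by their left feet; so the two neighbours decide.\<close>

lemma g_cell:
  assumes "p i \<le> x" "x \<le> p (i + 1)"
  shows "g x = max (C i - x) (x - A (i + 1))"
proof (rule antisym)
  show "g x \<le> max (C i - x) (x - A (i + 1))"
  proof (rule g_leI)
    fix k
    show "h k - \<bar>x - p k\<bar> \<le> max (C i - x) (x - A (i + 1))"
    proof (cases "k \<le> i")
      case True
      then have "C k \<le> C i" using C_less[of k i] by (cases "k = i") auto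
      moreover have "h k - \<bar>x - p k\<bar> \<le> C k - x" by (simp add: C_def)
      ultimately show ?thesis by linarith
    next
      case False
      then have "A (i + 1) \<le> A k" using A_less[of "i + 1" k] by (cases "k = i + 1") auto
      moreover have "h k - \<bar>x - p k\<bar> \<le> x - A k" by (simp add: A_def)
      ultimately show ?thesis by linarith
    qed
  qed
  show "max (C i - x) (x - A (i + 1)) \<le> g x"
    using g_ge[of i x] g_ge[of "i + 1" x] assms by (simp add: A_def C_def)
qed

lemma g_attained: "\<exists>k. g x = h k - \<bar>x - p k\<bar>"
proof -
  obtain i where i: "p i \<le> x" "x < p (i + 1)" using ex_cell by blast
  have "g x = C i - x \<or> g x = x - A (i + 1)" using g_cell[of i x] i by linarith
  then show ?thesis
  proof
    assume "g x = C i - x" then show ?thesis using i by (intro exI[of _ i]) (simp add: C_def)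
  next
    assume "g x = x - A (i + 1)" then show ?thesis using i by (intro exI[of _ "i + 1"]) (simp add: A_def)
  qed
qed

lemma g_le_tent:
  assumes "p i - (C i - C (i - 1)) \<le> x" "x \<le> p i + (A (i + 1) - A i)"
  shows "g x \<le> h i"
proof (rule g_leI)
  fix k
  consider "k < i" | "k = i" | "i < k" by linarith
  then show "h k - \<bar>x - p k\<bar> \<le> h i"
  proof cases
    case 1
    then have "C k \<le> C (i - 1)" using C_less[of k "i - 1"] by (cases "k = i - 1") auto
    moreover have "h k - \<bar>x - p k\<bar> \<le> C k - x" by (simp add: C_def)
    moreover have "C i = p i + h i" by (simp add: C_def)
    ultimately show ?thesis using assms(1) by linarith
  next
    case 3
    then have "A (i + 1) \<le> A k" using A_less[of "i + 1" k] by (cases "k = i + 1") auto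
    moreover have "h k - \<bar>x - p k\<bar> \<le> x - A k" by (simp add: A_def)
    moreover have "A i = p i - h i" by (simp add: A_def)
    ultimately show ?thesis using assms(2) by linarith
  qed simp
qed

lemma g_peak: "g (p i) = h i"
  using g_le_tent[of i "p i"] C_less[of "i - 1" i] A_less[of i "i + 1"] g_ge[of i "p i"] by simp

lemma g_lipschitz: "g x \<le> g y + \<bar>x - y\<bar>"
proof (rule g_leI)
  fix i show "h i - \<bar>x - p i\<bar> \<le> g y + \<bar>x - y\<bar>" using g_ge[of i y] by linarith
qed

lemma continuous_g: "continuous_on UNIV g"
proof -
  have "dist (g x) (g y) \<le> 1 * dist x y" for x y
    using g_lipschitz[of x y] g_lipschitz[of y x] abs_minus_commute[of x y] unfolding dist_real_def mult_1 by (intro abs_leI) simp_all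
  then have "1-lipschitz_on UNIV g" by (intro lipschitz_onI) auto
  then show ?thesis by (rule lipschitz_on_continuous_on)
qed

lemma g_period: "g (x + of_int k * L) = g x"
proof -
  have le: "g (x + of_int k * L) \<le> g x" for x k
  proof (rule g_leI)
    fix i
    have "p i = p (i - k * n) + of_int k * L" "h i = h (i - k * n)"
      using period_int[of "i - k * n" k] by simp_all
    then show "h i - \<bar>x + of_int k * L - p i\<bar> \<le> g x" using g_ge[of "i - k * n" x] by simp
  qed
  show ?thesis using le[of x k] le[of "x + of_int k * L" "- k"] by simp
qed

lemma slope_left:
  assumes "g x = h k - \<bar>x - p k\<bar>" "p k < x" "y < x" "p k \<le> y"
  shows "g x < g y"
  using g_ge[of k y] assms by simp

lemma slope_right:
  assumes "g x = h k - \<bar>x - p k\<bar>" "x < p k" "x < y" "y \<le> p k"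
  shows "g x < g y"
  using g_ge[of k y] assms by simp

lemma local_max_peak: "local_max_at g (p i)"
proof (rule local_max_atI)
  show "p i - (C i - C (i - 1)) < p i" "p i < p i + (A (i + 1) - A i)"
    using C_less[of "i - 1" i] A_less[of i "i + 1"] by simp_all
  show "g s \<le> g (p i)" if "s \<in> {p i - (C i - C (i - 1))..p i + (A (i + 1) - A i)}" for s
    using g_le_tent[of i s] that by (simp add: g_peak)
qed

text \<open>Away from the peaks the envelope at x is attained by a tent with its peak elsewhere, and
  moving towards that peak raises the envelope.\<close>

lemma local_max_iff: "local_max_at g x \<longleftrightarrow> x \<in> range p"
proof
  assume "local_max_at g x"
  then obtain e where e: "e > 0" "\<And>s. s \<in> {x-e..x+e} \<Longrightarrow> g s \<le> g x"
    by (rule local_max_at_interval) (rule that)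
  obtain k where k: "g x = h k - \<bar>x - p k\<bar>" using g_attained by blast
  show "x \<in> range p"
  proof (rule ccontr)
    assume "x \<notin> range p"
    then consider "p k < x" | "x < p k" by (metis linorder_cases rangeI)
    then show False
    proof cases
      case 1
      then have "g x < g (max (p k) (x - e))" using e(1) by (intro slope_left[OF k]) auto
      then show False using e(2)[of "max (p k) (x - e)"] 1 e(1) by auto
    next
      case 2
      then have "g x < g (min (p k) (x + e))" using e(1) by (intro slope_right[OF k]) auto
      then show False using e(2)[of "min (p k) (x + e)"] 2 e(1) by auto
    qed
  qed
qed (use local_max_peak in blast)

section \<open>Which peak is the maximum over a window\<close>

text \<open>Window positions u at which something happens exactly at an edge: a peak sits at u or at
  u + T; a tent has the height of some peak at u + T or at u; or a falling line at u and a rising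
  line at u + T give the same value. They are countably many, so a uniform phase avoids
  them.\<close>

definition exceptional :: "real set" where
  "exceptional = range p \<union> range (\<lambda>i. p i - T) \<union> (\<Union>i. range (\<lambda>k. A k + h i - T)) \<union>
     (\<Union>i. range (\<lambda>k. C k - h i)) \<union> (\<Union>i. range (\<lambda>k. (C k + A i - T) / 2))"

lemma countable_exceptional: "countable exceptional"
  unfolding exceptional_def by (intro countable_Un countable_UN) auto

text \<open>Only higher peaks can spoil peak i. Inside the window a rising line is largest at the
  right edge and a falling line at the left edge, so comparing with \<open>h i\<close> at the edges
  is enough.\<close>

definition visible :: "int \<Rightarrow> real \<Rightarrow> bool" where
  "visible i u \<longleftrightarrow> u < p i \<and> p i < u + T \<and> (\<forall>k>i. h i < h k \<longrightarrow> u + T < A k + h i) \<and> (\<forall>k<i. h i < h k \<longrightarrow> C k - h i < u)"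

lemma visible_iff:
  assumes "u < p i" "p i < u + T"
  shows "visible i u \<longleftrightarrow> a i < p i - u \<and> p i - u < b i"
proof
  assume v: "visible i u"
  have "a i < p i - u"
  proof (cases "a i = 0")
    case False
    then obtain k where k: "k > i" "h i < h k" "(p k - h k) - (p i - h i) = T - a i" using right_eq by blast
    then have "u + T < A k + h i" using v by (auto simp: visible_def)
    then show ?thesis using k by (simp add: A_def)
  qed (use assms in simp)
  moreover have "p i - u < b i"
  proof (cases "b i = T")
    case False
    then obtain k where k: "k < i" "h i < h k" "(p i + h i) - (p k + h k) = b i" using left_eq by blast
    then have "C k - h i < u" using v by (auto simp: visible_def)
    then show ?thesis using k by (simp add: C_def)
  qed (use assms in simp)
  ultimately show "a i < p i - u \<and> p i - u < b i" by simp
next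
  assume ab: "a i < p i - u \<and> p i - u < b i"
  show "visible i u"
    unfolding visible_def
  proof (intro conjI allI impI)
    fix k assume "k > i" "h i < h k"
    then show "u + T < A k + h i" using right_ge[of i k] ab by (simp add: A_def)
  next
    fix k assume "k < i" "h i < h k"
    then show "C k - h i < u" using left_ge[of k i] ab by (simp add: C_def)
  qed (use assms in auto)
qed

text \<open>Higher tents are excluded by visibility. A tent of at most the same height could only
  tie, at its own peak and with equal height; no higher peak lies in between, so
  \<open>equal\<close> puts the two peaks at distance at least T, although \<open>p i\<close> lies
  strictly inside the window.\<close>

lemma visible_unique_max:
  assumes v: "visible i u" and x: "x \<in> {u..u+T}" "x \<noteq> p i"
  shows "g x < h i"
proof -
  obtain k where k: "g x = h k - \<bar>x - p k\<bar>" using g_attained by blast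
  show ?thesis
  proof (cases "h i < h k")
    case True
    then consider "k > i" | "k < i" by (cases k i rule: linorder_cases) auto
    then show ?thesis
    proof cases
      case 1
      then have "u + T < A k + h i" using v True by (auto simp: visible_def)
      moreover have "h k - \<bar>x - p k\<bar> \<le> h k + (x - p k)" by simp
      ultimately show ?thesis using k x by (simp add: A_def)
    next
      case 2
      then have "C k - h i < u" using v True by (auto simp: visible_def)
      moreover have "h k - \<bar>x - p k\<bar> \<le> h k - (x - p k)" by simp
      ultimately show ?thesis using k x by (simp add: C_def)
    qed
  next
    case False
    show ?thesis
    proof (rule ccontr)
      assume "\<not> g x < h i"
      then have xk: "x = p k" "h k = h i" using k False by auto
      then have ki: "k \<noteq> i" using x by auto
      have between: "h l \<le> h i" if l: "min i k < l" "l < max i k" for l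
      proof (rule ccontr)
        assume hl: "\<not> h l \<le> h i"
        have "p (min i k) < p l" "p l < p (max i k)" using l by (auto simp: p_less_iff)
        then have pl: "u < p l" "p l < u + T" using v x xk by (auto simp: visible_def min_def max_def split: if_splits)
        show False
        proof (cases "l > i")
          case True
          then have "u + T < A l + h i" using v hl by (auto simp: visible_def)
          then show False using pl hl by (simp add: A_def)
        next
          case False
          then have "l < i" using hl by (cases "l = i") auto
          then have "C l - h i < u" using v hl by (auto simp: visible_def)
          then show False using pl hl by (simp add: C_def)
        qed
      qed
      have "T \<le> p (max i k) - p (min i k)"
      proof (rule equal)
        show "min i k < max i k" using ki by auto
        show "h (max i k) = h (min i k)" using xk by (auto simp: max_def min_def)
        show "h l \<le> h (min i k)" if "min i k < l" "l < max i k" for l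
          using between[OF that] xk by (auto simp: min_def)
      qed
      then show False using v x xk ki by (auto simp: visible_def min_def max_def split: if_splits)
    qed
  qed
qed

lemma visible_wloc:
  assumes "visible i u"
  shows "wloc u (u + T) g = p i"
proof (rule wloc_eqI)
  show "p i \<in> {u..u+T}" using assms by (auto simp: visible_def)
  show "g s \<le> g (p i)" if "s \<in> {u..u+T}" for s
    using visible_unique_max[OF assms that] by (cases "s = p i") (auto simp: g_peak)
  show "g s < g (p i)" if "s \<in> {u..<p i}" for s
    using visible_unique_max[OF assms, of s] that assms by (auto simp: g_peak visible_def)
qed

text \<open>A higher peak in the window would beat z, so it lies outside and its tent is at most
  \<open>g z\<close> at the near edge. The choice of u excludes equality there, which gives the
  strict inequalities of \<open>visible\<close>.\<close>

lemma max_visible: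
  assumes u: "u \<notin> exceptional" and z: "u < z" "z < u + T" and m: "\<And>x. x \<in> {u..u+T} \<Longrightarrow> g x \<le> g z"
  shows "\<exists>i. z = p i \<and> visible i u"
proof -
  have "local_max_at g z" by (rule local_max_atI[of u _ "u + T"]) (fact z m)+
  then obtain i where i: "z = p i" using local_max_iff by auto
  have "visible i u"
    unfolding visible_def
  proof (intro conjI allI impI)
    show "u < p i" "p i < u + T" using z i by auto
    fix k
    { assume k: "k > i" "h i < h k"
      have "p i < p k" using k p_less by simp
      moreover have "p k \<notin> {u..u+T}" using m[of "p k"] k i by (auto simp: g_peak)
      ultimately have "u + T < p k" using z i by auto
      then have "u + T - A k \<le> h i" using g_ge[of k "u + T"] m[of "u + T"] T i by (simp add: g_peak A_def)
      moreover have "u \<noteq> A k + h i - T" using u unfolding exceptional_def by blast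
      ultimately show "u + T < A k + h i" by simp }
    { assume k: "k < i" "h i < h k"
      have "p k < p i" using k p_less by simp
      moreover have "p k \<notin> {u..u+T}" using m[of "p k"] k i by (auto simp: g_peak)
      ultimately have "p k < u" using z i by auto
      then have "C k - u \<le> h i" using g_ge[of k u] m[of u] T i by (simp add: g_peak C_def)
      moreover have "u \<noteq> C k - h i" using u unfolding exceptional_def by blast
      ultimately show "C k - h i < u" by simp }
  qed
  then show ?thesis using i by blast
qed

text \<open>An interior maximiser is visible and hence unique. There remains a tie between the two
  edges: then the envelope falls at u and rises at u + T, and equality of the two values makes u one
  of the excluded midpoints.\<close>

lemma not_tie:
  assumes u: "u \<notin> exceptional"
  shows "\<not> has_tie u (u + T) g"
proof
  assume "has_tie u (u + T) g"
  then obtain s t where st: "s \<in> {u..u+T}" "t \<in> {u..u+T}" "s < t" "g s = wsup u (u+T) g" "g t = wsup u (u+T) g"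
    unfolding has_tie_def by (metis linorder_neqE_linordered_idom)
  have ms: "g x \<le> g s" "g x \<le> g t" if "x \<in> {u..u+T}" for x
    using wsup_ge[OF continuous_g that] st by auto
  have "\<not> (u < z \<and> z < u + T)" if z: "z = s \<or> z = t" for z
  proof
    assume zi: "u < z \<and> z < u + T"
    have zm: "g x \<le> g z" if "x \<in> {u..u+T}" for x using ms[OF that] z by auto
    have "\<exists>i. z = p i \<and> visible i u"
    proof (rule max_visible[OF u])
      show "u < z" "z < u + T" using zi by auto
      show "g x \<le> g z" if "x \<in> {u..u+T}" for x by (rule zm[OF that])
    qed
    then obtain i where i: "z = p i" "visible i u" by blast
    define y where "y = (if z = s then t else s)"
    have y: "y \<in> {u..u+T}" "y \<noteq> p i" "g y = g z" using z st i by (auto simp: y_def)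
    then show False using visible_unique_max[OF i(2) y(1,2)] i(1) by (simp add: g_peak)
  qed
  then have "\<not> (u < s \<and> s < u + T)" "\<not> (u < t \<and> t < u + T)" by blast+
  then have e: "s = u" "t = u + T" using st by auto
  obtain k where k: "g u = h k - \<bar>u - p k\<bar>" using g_attained by blast
  obtain l where l: "g (u + T) = h l - \<bar>u + T - p l\<bar>" using g_attained by blast
  have "u \<noteq> p k" "u \<noteq> p l - T" using u unfolding exceptional_def by blast+
  then have "p k \<noteq> u" "p l - T \<noteq> u" by auto
  have "p k < u"
  proof (rule ccontr)
    assume "\<not> p k < u"
    then have "u < p k" using \<open>p k \<noteq> u\<close> by simp
    then have "g u < g (min (p k) (u + T))" using T by (intro slope_right[OF k]) auto
    moreover have "min (p k) (u + T) \<in> {u..u+T}" using \<open>u < p k\<close> T by auto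
    ultimately show False using ms(1)[of "min (p k) (u + T)"] e by simp
  qed
  moreover have "u + T < p l"
  proof (rule ccontr)
    assume "\<not> u + T < p l"
    then have "p l < u + T" using \<open>p l - T \<noteq> u\<close> by simp
    then have "g (u + T) < g (max (p l) u)" using T by (intro slope_left[OF l]) auto
    moreover have "max (p l) u \<in> {u..u+T}" using \<open>p l < u + T\<close> T by auto
    ultimately show False using ms(2)[of "max (p l) u"] e by simp
  qed
  moreover have "g u = g (u + T)" using st e by simp
  ultimately have "u = (C k + A l - T) / 2" using k l by (simp add: C_def A_def)
  then have "u \<in> range (\<lambda>k. (C k + A l - T) / 2)" by (rule range_eqI)
  then have "u \<in> (\<Union>i. range (\<lambda>k. (C k + A i - T) / 2))" by (rule UN_I[OF UNIV_I])
  then show False using u unfolding exceptional_def by blast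
qed

lemma wloc_interior_iff:
  assumes u: "u \<notin> exceptional" and B: "B \<subseteq> {0<..<T}"
  shows "wloc u (u + T) g - u \<in> B \<longleftrightarrow> (\<exists>i. p i - u \<in> B \<inter> {a i<..<b i})"
proof
  have uT: "u \<le> u + T" using T by simp
  assume w: "wloc u (u + T) g - u \<in> B"
  then have z: "u < wloc u (u + T) g" "wloc u (u + T) g < u + T" using B by auto
  have "\<exists>i. wloc u (u + T) g = p i \<and> visible i u"
  proof (rule max_visible[OF u z])
    show "g x \<le> g (wloc u (u + T) g)" if "x \<in> {u..u+T}" for x by (rule wloc_max[OF continuous_g uT that])
  qed
  then obtain i where i: "wloc u (u + T) g = p i" "visible i u" by blast
  then show "\<exists>i. p i - u \<in> B \<inter> {a i<..<b i}" using visible_iff[of u i] z w by auto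
next
  assume "\<exists>i. p i - u \<in> B \<inter> {a i<..<b i}"
  then obtain i where i: "p i - u \<in> B" "a i < p i - u" "p i - u < b i" by auto
  then have "u < p i" "p i < u + T" using B by auto
  then have "visible i u" using visible_iff i by blast
  then show "wloc u (u + T) g - u \<in> B" using visible_wloc i by simp
qed

lemma visible_inj:
  assumes B: "B \<subseteq> {0<..<T}" "p i - u \<in> B \<inter> {a i<..<b i}" "p j - u \<in> B \<inter> {a j<..<b j}"
  shows "i = j"
proof -
  have "u < p i" "p i < u + T" "u < p j" "p j < u + T" using B by auto
  then have "visible i u" "visible j u" using visible_iff B by auto
  then have "p i = p j" using visible_wloc by metis
  then show ?thesis using p_less_iff by (metis linorder_less_linear order_less_irrefl)
qed

end

section \<open>Averages over a period\<close>

text \<open>Unfolding: the translates of one period tile the line.\<close>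

lemma nn_integral_periodize:
  fixes \<phi> :: "real \<Rightarrow> ennreal"
  assumes L: "0 < L" and [measurable]: "\<phi> \<in> borel_measurable borel"
  shows "(\<integral>\<^sup>+u. (\<integral>\<^sup>+k. \<phi> (c + of_int k * L + u) \<partial>count_space UNIV) * indicator {0..<L} u \<partial>lborel) = (\<integral>\<^sup>+x. \<phi> x \<partial>lborel)"
proof -
  interpret C: sigma_finite_measure "count_space (UNIV :: int set)"
    by (rule sigma_finite_measure_count_space)
  interpret P: pair_sigma_finite lborel "count_space (UNIV :: int set)" ..
  define t where "t k = c + of_int k * L" for k :: int
  have m1: "(\<lambda>(u, k). \<phi> (t k + u) * indicator {0..<L} u) \<in> borel_measurable (lborel \<Otimes>\<^sub>M count_space (UNIV :: int set))"
  proof -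
    have "(\<lambda>z. (\<lambda>k z. \<phi> (t k + fst z) * indicator {0..<L} (fst z)) (snd z) z) \<in> borel_measurable (lborel \<Otimes>\<^sub>M count_space (UNIV :: int set))"
      by (rule measurable_compose_countable'[where I = UNIV]) measurable
    then show ?thesis by (simp add: case_prod_beta)
  qed
  have m2: "(\<lambda>(x, k). \<phi> x * indicator {t k..<t k + L} x) \<in> borel_measurable (lborel \<Otimes>\<^sub>M count_space (UNIV :: int set))"
  proof -
    have "(\<lambda>z. (\<lambda>k z. \<phi> (fst z) * indicator {t k..<t k + L} (fst z)) (snd z) z) \<in> borel_measurable (lborel \<Otimes>\<^sub>M count_space (UNIV :: int set))"
      by (rule measurable_compose_countable'[where I = UNIV]) measurable
    then show ?thesis by (simp add: case_prod_beta)
  qed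
  have "(\<integral>\<^sup>+u. (\<integral>\<^sup>+k. \<phi> (c + of_int k * L + u) \<partial>count_space UNIV) * indicator {0..<L} u \<partial>lborel)
      = (\<integral>\<^sup>+u. (\<integral>\<^sup>+k. \<phi> (t k + u) * indicator {0..<L} u \<partial>count_space UNIV) \<partial>lborel)"
    by (simp add: t_def nn_integral_multc)
  also have "\<dots> = (\<integral>\<^sup>+k. (\<integral>\<^sup>+u. \<phi> (t k + u) * indicator {0..<L} u \<partial>lborel) \<partial>count_space UNIV)"
    using P.Fubini[OF m1] by simp
  also have "\<dots> = (\<integral>\<^sup>+k. (\<integral>\<^sup>+x. \<phi> x * indicator {t k..<t k + L} x \<partial>lborel) \<partial>count_space UNIV)"
  proof (rule nn_integral_cong)
    fix k
    have "(\<integral>\<^sup>+x. \<phi> x * indicator {t k..<t k + L} x \<partial>lborel) = (\<integral>\<^sup>+u. \<phi> (t k + 1 * u) * indicator {t k..<t k + L} (t k + 1 * u) \<partial>lborel)"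
      using nn_integral_real_affine[of "\<lambda>x. \<phi> x * indicator {t k..<t k + L} x" 1 "t k"] by simp
    also have "\<dots> = (\<integral>\<^sup>+u. \<phi> (t k + u) * indicator {0..<L} u \<partial>lborel)"
      by (rule nn_integral_cong) (simp add: indicator_def)
    finally show "(\<integral>\<^sup>+u. \<phi> (t k + u) * indicator {0..<L} u \<partial>lborel) = (\<integral>\<^sup>+x. \<phi> x * indicator {t k..<t k + L} x \<partial>lborel)" by simp
  qed
  also have "\<dots> = (\<integral>\<^sup>+x. (\<integral>\<^sup>+k. \<phi> x * indicator {t k..<t k + L} x \<partial>count_space UNIV) \<partial>lborel)"
    using P.Fubini[OF m2] by simp
  also have "\<dots> = (\<integral>\<^sup>+x. \<phi> x \<partial>lborel)"
  proof (rule nn_integral_cong)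
    fix x
    have "x \<in> {t k..<t k + L} \<longleftrightarrow> k = \<lfloor>(x - c) / L\<rfloor>" for k
    proof -
      have "x \<in> {t k..<t k + L} \<longleftrightarrow> of_int k \<le> (x - c) / L \<and> (x - c) / L < of_int k + 1"
        using L by (auto simp: t_def le_divide_eq divide_less_eq algebra_simps)
      then show ?thesis by linarith
    qed
    then have "(\<integral>\<^sup>+k. \<phi> x * indicator {t k..<t k + L} x \<partial>count_space UNIV) = (\<integral>\<^sup>+k. \<phi> x * indicator {\<lfloor>(x - c) / L\<rfloor>} k \<partial>count_space UNIV)"
      by (intro nn_integral_cong) (simp add: indicator_def)
    also have "\<dots> = \<phi> x * (\<integral>\<^sup>+k. indicator {\<lfloor>(x - c) / L\<rfloor>} k \<partial>count_space UNIV)"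
      by (rule nn_integral_cmult) simp
    also have "\<dots> = \<phi> x"
      by (subst nn_integral_indicator) simp_all
    finally show "(\<integral>\<^sup>+k. \<phi> x * indicator {t k..<t k + L} x \<partial>count_space UNIV) = \<phi> x" .
  qed
  finally show ?thesis .
qed

text \<open>Unfolding is applied to F times the indicator of a period: for each u exactly one
  translate of s + u lies in \<open>[0, L)\<close>, and F does not notice the translation.\<close>

lemma nn_integral_shift_period:
  fixes F :: "real \<Rightarrow> ennreal"
  assumes L: "0 < L" and [measurable]: "F \<in> borel_measurable borel" and per: "\<And>x k. F (x + of_int k * L) = F x"
  shows "(\<integral>\<^sup>+u. F (s + u) * indicator {0..<L} u \<partial>lborel) = (\<integral>\<^sup>+u. F u * indicator {0..<L} u \<partial>lborel)"
proof -
  have "(\<integral>\<^sup>+k. F (s + of_int k * L + u) * indicator {0..<L} (s + of_int k * L + u) \<partial>count_space UNIV) = F (s + u)" for u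
  proof -
    have "(s + of_int k * L + u) \<in> {0..<L} \<longleftrightarrow> k = - \<lfloor>(s + u) / L\<rfloor>" for k
    proof -
      have "(s + of_int k * L + u) \<in> {0..<L} \<longleftrightarrow> - of_int k \<le> (s + u) / L \<and> (s + u) / L < - of_int k + 1"
        unfolding pos_le_divide_eq[OF L] pos_divide_less_eq[OF L] by (auto simp: algebra_simps)
      then show ?thesis by linarith
    qed
    then have "(\<integral>\<^sup>+k. F (s + of_int k * L + u) * indicator {0..<L} (s + of_int k * L + u) \<partial>count_space UNIV)
      = (\<integral>\<^sup>+k. F (s + u) * indicator {- \<lfloor>(s + u) / L\<rfloor>} k \<partial>count_space UNIV)"
      using per[of "s + u"] by (intro nn_integral_cong) (simp add: indicator_def ac_simps)
    also have "\<dots> = F (s + u) * (\<integral>\<^sup>+k. indicator {- \<lfloor>(s + u) / L\<rfloor>} k \<partial>count_space UNIV)"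
      by (rule nn_integral_cmult) simp
    also have "\<dots> = F (s + u)"
      by (subst nn_integral_indicator) simp_all
    finally show ?thesis .
  qed
  then show ?thesis
    using nn_integral_periodize[OF L, of "\<lambda>x. F x * indicator {0..<L} x" s] by simp
qed

context tents
begin

text \<open>By \<open>uniq\<close> the indicator of existence is a sum over all peaks. Peaks with
  the same index modulo n are translates by multiples of L, so the period unfolds to the line and
  yields the measure of \<open>S j\<close>, after a reflection because u enters with a minus
  sign.\<close>

lemma nn_integral_ex_peak:
  assumes S [measurable]: "\<And>i. S i \<in> sets borel" and per: "\<And>i k. S (i + k * n) = S i"
    and uniq: "\<And>i j u. p i - u \<in> S i \<Longrightarrow> p j - u \<in> S j \<Longrightarrow> i = j"
  shows "(\<integral>\<^sup>+u. indicator {u. \<exists>i. p i - u \<in> S i} u * indicator {0..<L} u \<partial>lborel) = (\<Sum>j\<in>{0..<n}. emeasure lborel (S j))"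
proof -
  have ind: "indicator {u. \<exists>i. p i - u \<in> S i} u = (\<Sum>j\<in>{0..<n}. \<integral>\<^sup>+k. indicator (S j) (- (- p j + of_int k * L + u)) \<partial>count_space UNIV)" for u :: real
  proof -
    have pk: "- (- p j + of_int k * L + u) = p (j + (- k) * n) - u" for j k
      using period_int(1)[of j "- k"] by simp
    have "(\<Sum>j\<in>{0..<n}. \<integral>\<^sup>+k. indicator (S j) (- (- p j + of_int k * L + u)) \<partial>count_space UNIV)
       = (\<Sum>j\<in>{0..<n}. emeasure (count_space UNIV) {k. p (j + (- k) * n) - u \<in> S (j + (- k) * n)})"
    proof (rule sum.cong[OF refl])
      fix j
      have "(\<integral>\<^sup>+k. indicator (S j) (- (- p j + of_int k * L + u)) \<partial>count_space UNIV) = (\<integral>\<^sup>+k. indicator {k. p (j + (- k) * n) - u \<in> S (j + (- k) * n)} k \<partial>count_space UNIV)"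
        unfolding pk per by (rule nn_integral_cong) (simp add: indicator_def)
      then show "(\<integral>\<^sup>+k. indicator (S j) (- (- p j + of_int k * L + u)) \<partial>count_space UNIV) = emeasure (count_space UNIV) {k. p (j + (- k) * n) - u \<in> S (j + (- k) * n)}"
        by (simp del: emeasure_count_space)
    qed
    also have "\<dots> = indicator {u. \<exists>i. p i - u \<in> S i} u"
    proof (cases "\<exists>i. p i - u \<in> S i")
      case False
      then show ?thesis by simp
    next
      case True
      then obtain i where i: "p i - u \<in> S i" by blast
      have "{k. p (j + (- k) * n) - u \<in> S (j + (- k) * n)} = (if j = i mod n then {- (i div n)} else {})" if "j \<in> {0..<n}" for j
      proof -
        have "p (j + (- k) * n) - u \<in> S (j + (- k) * n) \<longleftrightarrow> j + (- k) * n = i" for k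
          using uniq[OF i, of "j + (- k) * n"] i by metis
        moreover have "j + (- k) * n = i \<longleftrightarrow> j = i mod n \<and> k = - (i div n)" for k
        proof
          assume e: "j + (- k) * n = i"
          have "(j + (- k) * n) mod n = j" using that by (subst mod_mult_self1) simp
          moreover have "(j + (- k) * n) div n = - k" using that n by (subst div_mult_self1) simp_all
          ultimately have "i mod n = j" "i div n = - k" unfolding e by blast+
          then show "j = i mod n \<and> k = - (i div n)" by simp
        next
          assume "j = i mod n \<and> k = - (i div n)"
          then show "j + (- k) * n = i" by simp
        qed
        ultimately show ?thesis by auto
      qed
      then have "(\<Sum>j\<in>{0..<n}. emeasure (count_space UNIV) {k. p (j + (- k) * n) - u \<in> S (j + (- k) * n)}) = (\<Sum>j\<in>{0..<n}. if j = i mod n then 1 else 0 :: ennreal)"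
        by (intro sum.cong) auto
      also have "\<dots> = 1" using n by simp
      finally show ?thesis using True by simp
    qed
    finally show ?thesis by simp
  qed
  have m [measurable]: "(\<lambda>u. \<integral>\<^sup>+k. indicator (S j) (- (- p j + of_int k * L + u)) \<partial>count_space UNIV) \<in> borel_measurable lborel" for j
  proof -
    have "(\<lambda>z. (\<lambda>k z. indicator (S j) (- (- p j + of_int k * L + fst z)) :: ennreal) (snd z) z) \<in> borel_measurable (lborel \<Otimes>\<^sub>M count_space (UNIV :: int set))"
      by (rule measurable_compose_countable'[where I = UNIV]) measurable
    then have *: "(\<lambda>(u, k). indicator (S j) (- (- p j + of_int k * L + u)) :: ennreal) \<in> borel_measurable (lborel \<Otimes>\<^sub>M count_space (UNIV :: int set))"
      by (simp add: case_prod_beta)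
    interpret C: sigma_finite_measure "count_space (UNIV :: int set)"
      by (rule sigma_finite_measure_count_space)
    show ?thesis using C.borel_measurable_nn_integral_fst[OF *] by simp
  qed
  have "(\<integral>\<^sup>+u. indicator {u. \<exists>i. p i - u \<in> S i} u * indicator {0..<L} u \<partial>lborel)
    = (\<Sum>j\<in>{0..<n}. \<integral>\<^sup>+u. (\<integral>\<^sup>+k. indicator (S j) (- (- p j + of_int k * L + u)) \<partial>count_space UNIV) * indicator {0..<L} u \<partial>lborel)"
    unfolding ind sum_distrib_right by (rule nn_integral_sum) measurable
  also have "\<dots> = (\<Sum>j\<in>{0..<n}. \<integral>\<^sup>+x. indicator (S j) (- x) \<partial>lborel)"
    by (intro sum.cong refl nn_integral_periodize[OF L, where \<phi> = "\<lambda>x. indicator (S _) (- x)"]) measurable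
  also have "\<dots> = (\<Sum>j\<in>{0..<n}. emeasure lborel (S j))"
  proof (rule sum.cong[OF refl])
    fix j
    have "(\<integral>\<^sup>+x. indicator (S j) x \<partial>lborel) = (\<integral>\<^sup>+x. indicator (S j) (- x) \<partial>lborel)"
      using nn_integral_real_affine[of "indicator (S j)" "-1" 0] by simp
    then show "(\<integral>\<^sup>+x. indicator (S j) (- x) \<partial>lborel) = emeasure lborel (S j)" by simp
  qed
  finally show ?thesis .
qed

lemma nn_integral_wloc:
  assumes [measurable]: "B \<in> sets borel" and B: "B \<subseteq> {0<..<T}"
  shows "(\<integral>\<^sup>+u. indicator {u. wloc u (u + T) g - u \<in> B} u * indicator {0..<L} u \<partial>lborel) = (\<Sum>j\<in>{0..<n}. emeasure lborel (B \<inter> {a j<..<b j}))"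
proof -
  have ae: "AE u in lborel. u \<notin> exceptional"
    using countable_imp_null_set_lborel[OF countable_exceptional] by (rule AE_not_in)
  have "(\<integral>\<^sup>+u. indicator {u. wloc u (u + T) g - u \<in> B} u * indicator {0..<L} u \<partial>lborel)
      = (\<integral>\<^sup>+u. indicator {u. \<exists>i. p i - u \<in> B \<inter> {a i<..<b i}} u * indicator {0..<L} u \<partial>lborel)"
    by (rule nn_integral_cong_AE, rule eventually_mono[OF ae]) (simp add: indicator_def wloc_interior_iff[OF _ B])
  also have "\<dots> = (\<Sum>j\<in>{0..<n}. emeasure lborel (B \<inter> {a j<..<b j}))"
  proof (rule nn_integral_ex_peak)
    show "i = j" if "p i - u \<in> B \<inter> {a i<..<b i}" "p j - u \<in> B \<inter> {a j<..<b j}" for i j u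
      by (rule visible_inj[OF B that])
  qed (simp_all add: period_int)
  finally show ?thesis .
qed

text \<open>An open window no longer than the smallest gap contains at most one peak, so each of the
  n peaks in a period contributes exactly e.\<close>

lemma nn_integral_local_max:
  assumes e: "0 < e" and sep: "\<And>i. e \<le> p (i + 1) - p i"
  shows "(\<integral>\<^sup>+u. indicator {u. has_local_max u (u + e) g} u * indicator {0..<L} u \<partial>lborel) = ennreal (of_int n * e)"
proof -
  have hl: "has_local_max u (u + e) g \<longleftrightarrow> (\<exists>i. p i - u \<in> {0<..<e})" for u
  proof -
    have "has_local_max u (u + e) g \<longleftrightarrow> (\<exists>i. p i \<in> {u<..<u + e})"
      unfolding has_local_max_def local_max_iff by blast
    moreover have "p i \<in> {u<..<u + e} \<longleftrightarrow> p i - u \<in> {0<..<e}" for i by auto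
    ultimately show ?thesis by simp
  qed
  have far: "e \<le> p j - p i" if "i < j" for i j
  proof -
    have "p (i + 1) \<le> p j" using that p_less[of "i + 1" j] by (cases "j = i + 1") auto
    then show ?thesis using sep[of i] by linarith
  qed
  have "(\<integral>\<^sup>+u. indicator {u. \<exists>i. p i - u \<in> {0<..<e}} u * indicator {0..<L} u \<partial>lborel) = (\<Sum>j\<in>{0..<n}. emeasure lborel {0<..<e})"
  proof (rule nn_integral_ex_peak)
    show "i = j" if "p i - u \<in> {0<..<e}" "p j - u \<in> {0<..<e}" for i j u
      using far[of i j] far[of j i] that by (cases i j rule: linorder_cases) auto
  qed simp_all
  also have "\<dots> = of_nat (nat n) * ennreal e" using e by simp
  also have "\<dots> = ennreal (of_int n * e)"
    using n e by (simp add: ennreal_of_nat_eq_real_of_nat ennreal_mult[symmetric])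
  finally show ?thesis by (simp add: hl)
qed

end

section \<open>Random tent envelopes\<close>

text \<open>The construction lives on pairs of reals, while the theorem asks for a measure on
  functions; a measure-preserving map carries everything over.\<close>

lemma stationary_process_transfer:
  assumes \<psi> [measurable]: "\<psi> \<in> measurable M N" and dist: "distr M N \<psi> = N" and M: "prob_space M"
    and sc: "sample_continuous_process N Y" and st: "stationary_process N Y"
    and U: "assumption_U N Y T" and L: "assumption_L N Y" and d: "interior_density N Y T f" and T: "0 \<le> T"
  shows "sample_continuous_process M (\<lambda>t \<omega>. Y t (\<psi> \<omega>)) \<and> stationary_process M (\<lambda>t \<omega>. Y t (\<psi> \<omega>)) \<and>
    assumption_U M (\<lambda>t \<omega>. Y t (\<psi> \<omega>)) T \<and> assumption_L M (\<lambda>t \<omega>. Y t (\<psi> \<omega>)) \<and> interior_density M (\<lambda>t \<omega>. Y t (\<psi> \<omega>)) T f"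
proof -
  have Y [measurable]: "Y t \<in> borel_measurable N" for t using sc by (simp add: sample_continuous_process_def)
  interpret S: stationary_cont N Y
    using sc st by (auto simp: stationary_cont_def stationary_cont_axioms_def sample_continuous_process_def)
  have sp: "\<psi> \<omega> \<in> space N" if "\<omega> \<in> space M" for \<omega> using measurable_space[OF \<psi> that] .
  have "sample_continuous_process M (\<lambda>t \<omega>. Y t (\<psi> \<omega>))"
    unfolding sample_continuous_process_def using M S.cont sp by (auto intro: measurable_compose[OF \<psi>])
  moreover have "stationary_process M (\<lambda>t \<omega>. Y t (\<psi> \<omega>))"
    unfolding stationary_process_def
  proof (intro allI impI)
    fix I :: "real set" and h :: real assume "finite I"
    have m: "(\<lambda>\<omega>. \<lambda>t\<in>I. Y (t + h) \<omega>) \<in> measurable N (Pi\<^sub>M I (\<lambda>_. borel))" for h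
      by (rule measurable_restrict) measurable
    have "distr M (Pi\<^sub>M I (\<lambda>_. borel)) (\<lambda>\<omega>. \<lambda>t\<in>I. Y (t + h) (\<psi> \<omega>)) = distr N (Pi\<^sub>M I (\<lambda>_. borel)) (\<lambda>\<omega>. \<lambda>t\<in>I. Y (t + h) \<omega>)" for h
      using distr_distr[OF m \<psi>, of h] dist by (simp add: o_def)
    from this[of h] this[of 0] show "distr M (Pi\<^sub>M I (\<lambda>_. borel)) (\<lambda>\<omega>. \<lambda>t\<in>I. Y (t + h) (\<psi> \<omega>)) = distr M (Pi\<^sub>M I (\<lambda>_. borel)) (\<lambda>\<omega>. \<lambda>t\<in>I. Y t (\<psi> \<omega>))"
      using st \<open>finite I\<close> unfolding stationary_process_def by simp
  qed
  moreover have "assumption_U M (\<lambda>t \<omega>. Y t (\<psi> \<omega>)) T"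
  proof -
    define A where "A = {\<omega>\<in>space N. has_tie 0 T (\<lambda>t. Y t \<omega>)}"
    have A: "A \<in> null_sets N" using U by (simp add: A_def assumption_U_def has_tie_def wsup_def)
    then have "emeasure M (\<psi> -` A \<inter> space M) = emeasure N A"
      by (subst dist[symmetric]) (simp add: emeasure_distr null_setsD2)
    then have "\<psi> -` A \<inter> space M \<in> null_sets M"
      using A by (auto intro!: null_setsI measurable_sets[OF \<psi>])
    moreover have "\<psi> -` A \<inter> space M = {\<omega>\<in>space M. has_tie 0 T (\<lambda>t. Y t (\<psi> \<omega>))}" using sp by (auto simp: A_def)
    ultimately show ?thesis by (simp add: assumption_U_def has_tie_def wsup_def)
  qed
  moreover have "assumption_L M (\<lambda>t \<omega>. Y t (\<psi> \<omega>))"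
  proof -
    have "measure M {\<omega> \<in> space M. has_local_max 0 e (\<lambda>t. Y t (\<psi> \<omega>))} = measure N {\<omega> \<in> space N. has_local_max 0 e (\<lambda>t. Y t \<omega>)}" for e
    proof -
      have A: "{\<omega> \<in> space N. has_local_max 0 e (\<lambda>t. Y t \<omega>)} \<in> sets N"
        using measurable_compose[OF S.measurable_path pred_has_local_max] by (simp add: pred_def)
      have "measure N {\<omega> \<in> space N. has_local_max 0 e (\<lambda>t. Y t \<omega>)} = measure M (\<psi> -` {\<omega> \<in> space N. has_local_max 0 e (\<lambda>t. Y t \<omega>)} \<inter> space M)"
        by (subst dist[symmetric]) (simp add: measure_distr A)
      also have "\<psi> -` {\<omega> \<in> space N. has_local_max 0 e (\<lambda>t. Y t \<omega>)} \<inter> space M = {\<omega> \<in> space M. has_local_max 0 e (\<lambda>t. Y t (\<psi> \<omega>))}"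
        using sp by auto
      finally show ?thesis by simp
    qed
    then show ?thesis using L by (simp add: assumption_L_def has_local_max_def)
  qed
  moreover have "interior_density M (\<lambda>t \<omega>. Y t (\<psi> \<omega>)) T f"
  proof -
    have m: "sup_location Y T \<in> borel_measurable N"
      using measurable_compose[OF S.measurable_path measurable_wloc[OF T]] by (simp add: sup_location_eq_wloc[abs_def])
    have e: "sup_location (\<lambda>t \<omega>. Y t (\<psi> \<omega>)) T = sup_location Y T \<circ> \<psi>"
      by (rule ext) (simp add: sup_location_eq_wloc)
    have "sup_location_law M (\<lambda>t \<omega>. Y t (\<psi> \<omega>)) T = sup_location_law N Y T"
      unfolding sup_location_law_def e using distr_distr[OF m \<psi>] dist by simp
    then show ?thesis using d by (simp add: interior_density_def)
  qed
  ultimately show ?thesis by blast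
qed

text \<open>Fubini in level and place: instead of measuring the intervals at a fixed level, count
  for a fixed s the levels whose intervals contain s.\<close>

lemma nn_integral_sum_intervals:
  fixes a b :: "real \<Rightarrow> int \<Rightarrow> real"
  assumes [measurable]: "\<And>j. (\<lambda>\<theta>. a \<theta> j) \<in> borel_measurable borel" "\<And>j. (\<lambda>\<theta>. b \<theta> j) \<in> borel_measurable borel" "B \<in> sets borel"
  shows "(\<integral>\<^sup>+\<theta>. (\<Sum>j\<in>{0..<n}. emeasure lborel (B \<inter> {a \<theta> j<..<b \<theta> j})) * indicator {0<..<m} \<theta> \<partial>lborel) =
    (\<integral>\<^sup>+s. indicator B s * (\<Sum>j\<in>{0..<n}. \<integral>\<^sup>+\<theta>. indicator {\<theta>. a \<theta> j < s \<and> s < b \<theta> j} \<theta> * indicator {0<..<m} \<theta> \<partial>lborel) \<partial>lborel)"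
proof -
  have "(\<integral>\<^sup>+\<theta>. (\<Sum>j\<in>{0..<n}. emeasure lborel (B \<inter> {a \<theta> j<..<b \<theta> j})) * indicator {0<..<m} \<theta> \<partial>lborel) = (\<integral>\<^sup>+\<theta>. (\<Sum>j\<in>{0..<n}. \<integral>\<^sup>+s. indicator B s * (indicator {\<theta>. a \<theta> j < s \<and> s < b \<theta> j} \<theta> * indicator {0<..<m} \<theta>) \<partial>lborel) \<partial>lborel)"
  proof (rule nn_integral_cong)
    fix \<theta>
    have "emeasure lborel (B \<inter> {a \<theta> j<..<b \<theta> j}) * indicator {0<..<m} \<theta> = (\<integral>\<^sup>+s. indicator B s * (indicator {\<theta>. a \<theta> j < s \<and> s < b \<theta> j} \<theta> * indicator {0<..<m} \<theta>) \<partial>lborel)" for j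
    proof -
      have "emeasure lborel (B \<inter> {a \<theta> j<..<b \<theta> j}) * indicator {0<..<m} \<theta> = (\<integral>\<^sup>+s. indicator (B \<inter> {a \<theta> j<..<b \<theta> j}) s * indicator {0<..<m} \<theta> \<partial>lborel)"
        by (subst nn_integral_multc) auto
      also have "\<dots> = (\<integral>\<^sup>+s. indicator B s * (indicator {\<theta>. a \<theta> j < s \<and> s < b \<theta> j} \<theta> * indicator {0<..<m} \<theta>) \<partial>lborel)"
        by (rule nn_integral_cong) (auto simp: indicator_def)
      finally show ?thesis .
    qed
    then show "(\<Sum>j\<in>{0..<n}. emeasure lborel (B \<inter> {a \<theta> j<..<b \<theta> j})) * indicator {0<..<m} \<theta> = (\<Sum>j\<in>{0..<n}. \<integral>\<^sup>+s. indicator B s * (indicator {\<theta>. a \<theta> j < s \<and> s < b \<theta> j} \<theta> * indicator {0<..<m} \<theta>) \<partial>lborel)"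
      by (simp add: sum_distrib_right)
  qed
  also have "\<dots> = (\<Sum>j\<in>{0..<n}. \<integral>\<^sup>+\<theta>. \<integral>\<^sup>+s. indicator B s * (indicator {\<theta>. a \<theta> j < s \<and> s < b \<theta> j} \<theta> * indicator {0<..<m} \<theta>) \<partial>lborel \<partial>lborel)"
    by (rule nn_integral_sum) measurable
  also have "\<dots> = (\<Sum>j\<in>{0..<n}. \<integral>\<^sup>+s. \<integral>\<^sup>+\<theta>. indicator B s * (indicator {\<theta>. a \<theta> j < s \<and> s < b \<theta> j} \<theta> * indicator {0<..<m} \<theta>) \<partial>lborel \<partial>lborel)"
    by (intro sum.cong refl lborel_pair.Fubini') measurable
  also have "\<dots> = (\<integral>\<^sup>+s. (\<Sum>j\<in>{0..<n}. \<integral>\<^sup>+\<theta>. indicator B s * (indicator {\<theta>. a \<theta> j < s \<and> s < b \<theta> j} \<theta> * indicator {0<..<m} \<theta>) \<partial>lborel) \<partial>lborel)"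
    by (rule nn_integral_sum[symmetric]) measurable
  also have "\<dots> = (\<integral>\<^sup>+s. indicator B s * (\<Sum>j\<in>{0..<n}. \<integral>\<^sup>+\<theta>. indicator {\<theta>. a \<theta> j < s \<and> s < b \<theta> j} \<theta> * indicator {0<..<m} \<theta> \<partial>lborel) \<partial>lborel)"
    unfolding sum_distrib_left by (intro nn_integral_cong sum.cong refl nn_integral_cmult) measurable
  finally show ?thesis .
qed

text \<open>\<open>F\<close> is a measurable representative of the target density and
  \<open>total\<close> makes the area under L equal to 1. The bound \<eta> is uniform in \<theta>
  because Assumption L asks for a limit of a probability averaged over all levels.\<close>

locale tent_family =
  fixes n :: int and m T \<eta> :: real and L F :: "real \<Rightarrow> real" and p h a b :: "real \<Rightarrow> int \<Rightarrow> real"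
  assumes m: "0 < m" and \<eta>: "0 < \<eta>" and T: "0 < T"
    and tents: "\<theta> \<in> {0<..<m} \<Longrightarrow> tents (p \<theta>) (h \<theta>) n (L \<theta>) T (a \<theta>) (b \<theta>)"
    and sep: "\<theta> \<in> {0<..<m} \<Longrightarrow> \<eta> \<le> p \<theta> (i + 1) - p \<theta> i"
    and meas_p [measurable]: "(\<lambda>\<theta>. p \<theta> i) \<in> borel_measurable borel"
    and meas_h [measurable]: "(\<lambda>\<theta>. h \<theta> i) \<in> borel_measurable borel"
    and meas_a [measurable]: "(\<lambda>\<theta>. a \<theta> i) \<in> borel_measurable borel"
    and meas_b [measurable]: "(\<lambda>\<theta>. b \<theta> i) \<in> borel_measurable borel"
    and meas_L [measurable]: "L \<in> borel_measurable borel"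
    and meas_F [measurable]: "F \<in> borel_measurable borel"
    and total: "(\<integral>\<^sup>+\<theta>. ennreal (L \<theta>) * indicator {0<..<m} \<theta> \<partial>lborel) = 1"
    and dens: "AE s in lborel. s \<in> {0<..<T} \<longrightarrow>
      (\<Sum>j\<in>{0..<n}. \<integral>\<^sup>+\<theta>. indicator {\<theta>. a \<theta> j < s \<and> s < b \<theta> j} \<theta> * indicator {0<..<m} \<theta> \<partial>lborel) = ennreal (F s)"
begin

definition \<Omega> :: "(real \<times> real) set" where
  "\<Omega> = {\<omega>. fst \<omega> \<in> {0<..<m} \<and> 0 \<le> snd \<omega> \<and> snd \<omega> < L (fst \<omega>)}"

text \<open>
  A uniform point under the graph of the period \<open>L\<close> is a level \<open>\<theta>\<close> together with a phase. This
  size-biases the level by its period, so that expected numbers of peaks per unit of time become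
  plain integrals over \<open>\<theta>\<close>, as in the assumption \<open>dens\<close>.
\<close>

definition M0 :: "(real \<times> real) measure" where
  "M0 = restrict_space (lborel \<Otimes>\<^sub>M lborel) \<Omega>"

definition Y :: "real \<Rightarrow> real \<times> real \<Rightarrow> real" where
  "Y t \<omega> = envelope (p (fst \<omega>)) (h (fst \<omega>)) (t + snd \<omega>)"

lemma sets_\<Omega> [measurable]: "\<Omega> \<in> sets (lborel \<Otimes>\<^sub>M lborel)"
proof -
  have "{\<omega> \<in> space (lborel \<Otimes>\<^sub>M lborel). fst \<omega> \<in> {0<..<m} \<and> 0 \<le> snd \<omega> \<and> snd \<omega> < L (fst \<omega>)} \<in> sets (lborel \<Otimes>\<^sub>M lborel)"
    by measurable
  then show ?thesis by (simp add: \<Omega>_def space_pair_measure)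
qed

lemma space_M0: "space M0 = \<Omega>"
  by (simp add: M0_def space_restrict_space space_pair_measure)

lemma emeasure_M0:
  assumes Q: "{\<omega>\<in>space M0. Q \<omega>} \<in> sets M0"
  shows "emeasure M0 {\<omega>\<in>space M0. Q \<omega>} =
    (\<integral>\<^sup>+\<theta>. (\<integral>\<^sup>+u. indicator {u. Q (\<theta>, u)} u * indicator {0..<L \<theta>} u \<partial>lborel) * indicator {0<..<m} \<theta> \<partial>lborel)"
proof -
  have Q': "{\<omega>\<in>space M0. Q \<omega>} \<in> sets (lborel \<Otimes>\<^sub>M lborel)"
    using Q sets_\<Omega> unfolding M0_def by (subst (asm) sets_restrict_space_iff) auto
  have "emeasure M0 {\<omega>\<in>space M0. Q \<omega>} = emeasure (lborel \<Otimes>\<^sub>M lborel) {\<omega>\<in>space M0. Q \<omega>}"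
    unfolding M0_def by (rule emeasure_restrict_space) (use sets_\<Omega> in \<open>auto simp: space_restrict_space\<close>)
  also have "\<dots> = (\<integral>\<^sup>+\<theta>. \<integral>\<^sup>+u. indicator {\<omega>\<in>space M0. Q \<omega>} (\<theta>, u) \<partial>lborel \<partial>lborel)"
    by (rule lborel.emeasure_pair_measure[OF Q'])
  also have "\<dots> = (\<integral>\<^sup>+\<theta>. (\<integral>\<^sup>+u. indicator {u. Q (\<theta>, u)} u * indicator {0..<L \<theta>} u \<partial>lborel) * indicator {0<..<m} \<theta> \<partial>lborel)"
  proof (rule nn_integral_cong)
    fix \<theta>
    show "(\<integral>\<^sup>+u. indicator {\<omega>\<in>space M0. Q \<omega>} (\<theta>, u) \<partial>lborel) = (\<integral>\<^sup>+u. indicator {u. Q (\<theta>, u)} u * indicator {0..<L \<theta>} u \<partial>lborel) * indicator {0<..<m} \<theta>"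
    proof (cases "\<theta> \<in> {0<..<m}")
      case True
      then have "(\<integral>\<^sup>+u. indicator {\<omega>\<in>space M0. Q \<omega>} (\<theta>, u) \<partial>lborel) = (\<integral>\<^sup>+u. indicator {u. Q (\<theta>, u)} u * indicator {0..<L \<theta>} u \<partial>lborel)"
        by (intro nn_integral_cong) (auto simp: space_M0 \<Omega>_def indicator_def)
      then show ?thesis using True by simp
    next
      case False
      then have "indicator {\<omega>\<in>space M0. Q \<omega>} (\<theta>, u) = (0 :: ennreal)" for u by (auto simp: space_M0 \<Omega>_def)
      then show ?thesis using False by simp
    qed
  qed
  finally show ?thesis .
qed

lemma prob_space_M0: "prob_space M0"
proof
  have "emeasure M0 (space M0) = emeasure M0 {\<omega>\<in>space M0. True}" by simp
  also have "\<dots> = (\<integral>\<^sup>+\<theta>. (\<integral>\<^sup>+u. indicator {u. True} u * indicator {0..<L \<theta>} u \<partial>lborel) * indicator {0<..<m} \<theta> \<partial>lborel)"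
    by (rule emeasure_M0) simp
  also have "\<dots> = (\<integral>\<^sup>+\<theta>. ennreal (L \<theta>) * indicator {0<..<m} \<theta> \<partial>lborel)"
  proof (rule nn_integral_cong)
    fix \<theta>
    show "(\<integral>\<^sup>+u. indicator {u. True} u * indicator {0..<L \<theta>} u \<partial>lborel) * indicator {0<..<m} \<theta> = ennreal (L \<theta>) * indicator {0<..<m} \<theta>"
    proof (cases "\<theta> \<in> {0<..<m}")
      case True
      then have "0 < L \<theta>" using tents[OF True] by (simp add: tents_def)
      then show ?thesis by simp
    qed simp
  qed
  finally show "emeasure M0 (space M0) = 1" using total by simp
qed

lemma measurable_Y [measurable]: "Y t \<in> borel_measurable M0"
  unfolding Y_def envelope_def
proof (rule borel_measurable_cSUP)
  show "(\<lambda>\<omega>. h (fst \<omega>) i - \<bar>t + snd \<omega> - p (fst \<omega>) i\<bar>) \<in> borel_measurable M0" for i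
    unfolding M0_def by (rule measurable_restrict_space1) measurable
  show "bdd_above ((\<lambda>i. h (fst \<omega>) i - \<bar>t + snd \<omega> - p (fst \<omega>) i\<bar>) ` UNIV)" if "\<omega> \<in> space M0" for \<omega>
    using that tents.bdd_tents[OF tents] by (simp add: space_M0 \<Omega>_def)
qed simp

lemma continuous_Y: "\<omega> \<in> space M0 \<Longrightarrow> continuous_on UNIV (\<lambda>t. Y t \<omega>)"
  unfolding Y_def using continuous_shift[OF tents.continuous_g[OF tents]] by (simp add: space_M0 \<Omega>_def)

lemma nn_integral_cong_\<theta>:
  assumes "\<And>\<theta>. \<theta> \<in> {0<..<m} \<Longrightarrow> G \<theta> = (H \<theta> :: ennreal)"
  shows "(\<integral>\<^sup>+\<theta>. G \<theta> * indicator {0<..<m} \<theta> \<partial>lborel) = (\<integral>\<^sup>+\<theta>. H \<theta> * indicator {0<..<m} \<theta> \<partial>lborel)"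
  by (rule nn_integral_cong) (use assms in \<open>auto simp: indicator_def\<close>)

text \<open>At a fixed level a shift of time is a shift of the phase, and the path depends
  periodically on the phase with period \<open>L \<theta>\<close>.\<close>

lemma stationary_Y: "stationary_process M0 Y"
  unfolding stationary_process_def
proof (intro allI impI)
  fix I :: "real set" and s :: real
  have mY: "(\<lambda>\<omega>. \<lambda>t\<in>I. Y (t + s) \<omega>) \<in> measurable M0 (Pi\<^sub>M I (\<lambda>_. borel))" for s
    by (rule measurable_restrict) measurable
  have mY0: "(\<lambda>\<omega>. \<lambda>t\<in>I. Y t \<omega>) \<in> measurable M0 (Pi\<^sub>M I (\<lambda>_. borel))" using mY[of 0] by simp
  show "distr M0 (Pi\<^sub>M I (\<lambda>_. borel)) (\<lambda>\<omega>. \<lambda>t\<in>I. Y (t + s) \<omega>) = distr M0 (Pi\<^sub>M I (\<lambda>_. borel)) (\<lambda>\<omega>. \<lambda>t\<in>I. Y t \<omega>)"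
  proof (rule measure_eqI)
    fix A assume "A \<in> sets (distr M0 (Pi\<^sub>M I (\<lambda>_. borel)) (\<lambda>\<omega>. \<lambda>t\<in>I. Y (t + s) \<omega>))"
    then have A: "A \<in> sets (Pi\<^sub>M I (\<lambda>_. borel))" by simp
    have e: "emeasure (distr M0 (Pi\<^sub>M I (\<lambda>_. borel)) (\<lambda>\<omega>. \<lambda>t\<in>I. Y (t + s) \<omega>)) A =
      (\<integral>\<^sup>+\<theta>. (\<integral>\<^sup>+u. indicator {u. (\<lambda>t\<in>I. Y (t + s) (\<theta>, u)) \<in> A} u * indicator {0..<L \<theta>} u \<partial>lborel) * indicator {0<..<m} \<theta> \<partial>lborel)" for s
    proof -
      have s1: "(\<lambda>\<omega>. \<lambda>t\<in>I. Y (t + s) \<omega>) -` A \<inter> space M0 = {\<omega>\<in>space M0. (\<lambda>t\<in>I. Y (t + s) \<omega>) \<in> A}" by auto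
      have s2: "{\<omega>\<in>space M0. (\<lambda>t\<in>I. Y (t + s) \<omega>) \<in> A} \<in> sets M0"
        unfolding s1[symmetric] by (rule measurable_sets[OF mY A])
      show ?thesis unfolding emeasure_distr[OF mY A] s1 by (rule emeasure_M0[OF s2])
    qed
    have "(\<integral>\<^sup>+\<theta>. (\<integral>\<^sup>+u. indicator {u. (\<lambda>t\<in>I. Y (t + s) (\<theta>, u)) \<in> A} u * indicator {0..<L \<theta>} u \<partial>lborel) * indicator {0<..<m} \<theta> \<partial>lborel)
      = (\<integral>\<^sup>+\<theta>. (\<integral>\<^sup>+u. indicator {u. (\<lambda>t\<in>I. Y (t + 0) (\<theta>, u)) \<in> A} u * indicator {0..<L \<theta>} u \<partial>lborel) * indicator {0<..<m} \<theta> \<partial>lborel)"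
    proof (rule nn_integral_cong_\<theta>)
      fix \<theta> assume \<theta>: "\<theta> \<in> {0<..<m}"
      interpret tents "p \<theta>" "h \<theta>" n "L \<theta>" T "a \<theta>" "b \<theta>" by (rule tents[OF \<theta>])
      have [measurable]: "envelope (p \<theta>) (h \<theta>) \<in> borel_measurable borel"
        using continuous_g by (rule borel_measurable_continuous_onI)
      define G where "G u = (\<lambda>t\<in>I. envelope (p \<theta>) (h \<theta>) (t + u))" for u
      have mG: "G \<in> measurable borel (Pi\<^sub>M I (\<lambda>_. borel))"
        unfolding G_def by (rule measurable_restrict) measurable
      have F: "(\<lambda>u. indicator A (G u) :: ennreal) \<in> borel_measurable borel"
        by (rule measurable_compose[OF mG]) (use A in measurable)
      have per: "indicator A (G (u + of_int k * L \<theta>)) = (indicator A (G u) :: ennreal)" for u k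
      proof -
        have "G (u + of_int k * L \<theta>) = G u"
          unfolding G_def using g_period[of "_ + u" k] by (simp add: add.assoc)
        then show ?thesis by simp
      qed
      have ind: "indicator {u. (\<lambda>t\<in>I. Y (t + s) (\<theta>, u)) \<in> A} u = (indicator A (G (s + u)) :: ennreal)" for u s
        by (simp add: indicator_def G_def Y_def add.assoc)
      show "(\<integral>\<^sup>+u. indicator {u. (\<lambda>t\<in>I. Y (t + s) (\<theta>, u)) \<in> A} u * indicator {0..<L \<theta>} u \<partial>lborel)
        = (\<integral>\<^sup>+u. indicator {u. (\<lambda>t\<in>I. Y (t + 0) (\<theta>, u)) \<in> A} u * indicator {0..<L \<theta>} u \<partial>lborel)"
        unfolding ind using nn_integral_shift_period[OF L F per, of s] by simp
    qed
    then show "emeasure (distr M0 (Pi\<^sub>M I (\<lambda>_. borel)) (\<lambda>\<omega>. \<lambda>t\<in>I. Y (t + s) \<omega>)) A = emeasure (distr M0 (Pi\<^sub>M I (\<lambda>_. borel)) (\<lambda>\<omega>. \<lambda>t\<in>I. Y t \<omega>)) A"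
      using e[of s] e[of 0] by simp
  qed simp
qed

sublocale S: stationary_cont M0 Y
  using prob_space_M0 by (auto simp: stationary_cont_def stationary_cont_axioms_def stationary_Y continuous_Y)

lemma Y_pair: "(\<lambda>t. Y t (\<theta>, u)) = (\<lambda>t. envelope (p \<theta>) (h \<theta>) (t + u))"
  by (simp add: Y_def)

lemma assumption_U_Y: "assumption_U M0 Y T"
proof -
  have A: "{\<omega>\<in>space M0. has_tie 0 T (\<lambda>t. Y t \<omega>)} \<in> sets M0"
    using measurable_compose[OF S.measurable_path pred_has_tie[of 0 T]] T by (simp add: pred_def)
  have "emeasure M0 {\<omega>\<in>space M0. has_tie 0 T (\<lambda>t. Y t \<omega>)} =
    (\<integral>\<^sup>+\<theta>. (\<integral>\<^sup>+u. indicator {u. has_tie 0 T (\<lambda>t. Y t (\<theta>, u))} u * indicator {0..<L \<theta>} u \<partial>lborel) * indicator {0<..<m} \<theta> \<partial>lborel)"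
    by (rule emeasure_M0[OF A])
  also have "\<dots> = (\<integral>\<^sup>+\<theta>. 0 * indicator {0<..<m} \<theta> \<partial>lborel)"
  proof (rule nn_integral_cong_\<theta>)
    fix \<theta> assume \<theta>: "\<theta> \<in> {0<..<m}"
    interpret tents "p \<theta>" "h \<theta>" n "L \<theta>" T "a \<theta>" "b \<theta>" by (rule tents[OF \<theta>])
    have ae: "AE u in lborel. u \<notin> exceptional"
      using countable_imp_null_set_lborel[OF countable_exceptional] by (rule AE_not_in)
    have "(\<integral>\<^sup>+u. indicator {u. has_tie 0 T (\<lambda>t. Y t (\<theta>, u))} u * indicator {0..<L \<theta>} u \<partial>lborel) = (\<integral>\<^sup>+u. 0 \<partial>(lborel :: real measure))"
    proof (rule nn_integral_cong_AE, rule eventually_mono[OF ae])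
      fix u assume "u \<notin> exceptional"
      then have "\<not> has_tie 0 T (\<lambda>t. Y t (\<theta>, u))"
        using not_tie[of u] has_tie_shift[of 0 T "envelope (p \<theta>) (h \<theta>)" u] by (simp add: Y_pair add.commute)
      then show "indicator {u. has_tie 0 T (\<lambda>t. Y t (\<theta>, u))} u * indicator {0..<L \<theta>} u = (0 :: ennreal)" by simp
    qed
    then show "(\<integral>\<^sup>+u. indicator {u. has_tie 0 T (\<lambda>t. Y t (\<theta>, u))} u * indicator {0..<L \<theta>} u \<partial>lborel) = 0" by simp
  qed
  also have "\<dots> = 0" by simp
  finally show ?thesis
    using A by (auto simp: assumption_U_def has_tie_def[abs_def] wsup_def[abs_def] null_sets_def)
qed

text \<open>For e < \<eta> a window of length e meets at most one peak, so the quotient is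
  constantly n * m.\<close>

lemma assumption_L_Y: "assumption_L M0 Y"
proof -
  have val: "measure M0 {\<omega>\<in>space M0. has_local_max 0 e (\<lambda>t. Y t \<omega>)} / e = of_int n * m" if e: "0 < e" "e < \<eta>" for e
  proof -
    have n: "0 < n" using tents[of "m / 2"] m by (simp add: tents_def)
    have A: "{\<omega>\<in>space M0. has_local_max 0 e (\<lambda>t. Y t \<omega>)} \<in> sets M0"
      using measurable_compose[OF S.measurable_path pred_has_local_max] by (simp add: pred_def)
    have "emeasure M0 {\<omega>\<in>space M0. has_local_max 0 e (\<lambda>t. Y t \<omega>)} =
      (\<integral>\<^sup>+\<theta>. (\<integral>\<^sup>+u. indicator {u. has_local_max 0 e (\<lambda>t. Y t (\<theta>, u))} u * indicator {0..<L \<theta>} u \<partial>lborel) * indicator {0<..<m} \<theta> \<partial>lborel)"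
      by (rule emeasure_M0[OF A])
    also have "\<dots> = (\<integral>\<^sup>+\<theta>. ennreal (of_int n * e) * indicator {0<..<m} \<theta> \<partial>lborel)"
    proof (rule nn_integral_cong_\<theta>)
      fix \<theta> assume \<theta>: "\<theta> \<in> {0<..<m}"
      interpret tents "p \<theta>" "h \<theta>" n "L \<theta>" T "a \<theta>" "b \<theta>" by (rule tents[OF \<theta>])
      have "has_local_max 0 e (\<lambda>t. Y t (\<theta>, u)) \<longleftrightarrow> has_local_max u (u + e) (envelope (p \<theta>) (h \<theta>))" for u
        using has_local_max_shift[of 0 e "envelope (p \<theta>) (h \<theta>)" u] by (simp add: Y_pair add.commute)
      moreover have "e \<le> p \<theta> (i + 1) - p \<theta> i" for i using sep[OF \<theta>, of i] e by simp
      ultimately show "(\<integral>\<^sup>+u. indicator {u. has_local_max 0 e (\<lambda>t. Y t (\<theta>, u))} u * indicator {0..<L \<theta>} u \<partial>lborel) = ennreal (of_int n * e)"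
        using nn_integral_local_max[OF e(1)] by simp
    qed
    also have "\<dots> = ennreal (of_int n * e) * ennreal m"
      using m by (subst nn_integral_cmult_indicator) auto
    also have "\<dots> = ennreal (of_int n * e * m)" using n e m by (simp add: ennreal_mult[symmetric])
    finally have "measure M0 {\<omega>\<in>space M0. has_local_max 0 e (\<lambda>t. Y t \<omega>)} = of_int n * e * m"
      using n e m by (simp add: measure_def)
    then show ?thesis using e by simp
  qed
  have "((\<lambda>e. measure M0 {\<omega>\<in>space M0. has_local_max 0 e (\<lambda>t. Y t \<omega>)} / e) \<longlongrightarrow> of_int n * m) (at_right 0)"
    by (rule tendsto_eventually) (unfold eventually_at_right_field, rule exI[of _ \<eta>], use val \<eta> in blast)
  then show ?thesis unfolding assumption_L_def has_local_max_def by blast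
qed

lemma interior_density_Y:
  assumes f: "\<And>t. t \<in> {0<..<T} \<Longrightarrow> F t = f t"
  shows "interior_density M0 Y T f"
proof (rule interior_densityI[OF _ meas_F f])
  have wm: "(\<lambda>\<omega>. wloc 0 T (\<lambda>t. Y t \<omega>)) \<in> borel_measurable M0"
    using measurable_compose[OF S.measurable_path measurable_wloc[of 0 T]] T by simp
  then show "sup_location Y T \<in> borel_measurable M0"
    by (simp add: sup_location_eq_wloc[abs_def])
  fix B assume B [measurable]: "B \<in> sets borel" and BT: "B \<subseteq> {0<..<T}"
  have A: "{\<omega>\<in>space M0. wloc 0 T (\<lambda>t. Y t \<omega>) \<in> B} \<in> sets M0"
    using measurable_sets[OF wm B] by (simp add: vimage_def Int_def conj_commute)
  have "emeasure M0 {\<omega>\<in>space M0. sup_location Y T \<omega> \<in> B} = emeasure M0 {\<omega>\<in>space M0. wloc 0 T (\<lambda>t. Y t \<omega>) \<in> B}"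
    by (simp add: sup_location_eq_wloc)
  also have "\<dots> = (\<integral>\<^sup>+\<theta>. (\<integral>\<^sup>+u. indicator {u. wloc 0 T (\<lambda>t. Y t (\<theta>, u)) \<in> B} u * indicator {0..<L \<theta>} u \<partial>lborel) * indicator {0<..<m} \<theta> \<partial>lborel)"
    by (rule emeasure_M0[OF A])
  also have "\<dots> = (\<integral>\<^sup>+\<theta>. (\<Sum>j\<in>{0..<n}. emeasure lborel (B \<inter> {a \<theta> j<..<b \<theta> j})) * indicator {0<..<m} \<theta> \<partial>lborel)"
  proof (rule nn_integral_cong_\<theta>)
    fix \<theta> assume \<theta>: "\<theta> \<in> {0<..<m}"
    interpret tents "p \<theta>" "h \<theta>" n "L \<theta>" T "a \<theta>" "b \<theta>" by (rule tents[OF \<theta>])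
    have "wloc 0 T (\<lambda>t. Y t (\<theta>, u)) = wloc u (u + T) (envelope (p \<theta>) (h \<theta>)) - u" for u
      using wloc_shift[OF continuous_g, of 0 T u] T by (simp add: Y_pair add.commute)
    then show "(\<integral>\<^sup>+u. indicator {u. wloc 0 T (\<lambda>t. Y t (\<theta>, u)) \<in> B} u * indicator {0..<L \<theta>} u \<partial>lborel) = (\<Sum>j\<in>{0..<n}. emeasure lborel (B \<inter> {a \<theta> j<..<b \<theta> j}))"
      using nn_integral_wloc[OF B BT] by simp
  qed
  also have "\<dots> = (\<integral>\<^sup>+s. indicator B s * (\<Sum>j\<in>{0..<n}. \<integral>\<^sup>+\<theta>. indicator {\<theta>. a \<theta> j < s \<and> s < b \<theta> j} \<theta> * indicator {0<..<m} \<theta> \<partial>lborel) \<partial>lborel)"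
    by (rule nn_integral_sum_intervals) measurable
  also have "\<dots> = (\<integral>\<^sup>+s. ennreal (F s) * indicator B s \<partial>lborel)"
  proof (rule nn_integral_cong_AE, rule eventually_mono[OF dens])
    fix s assume s: "s \<in> {0<..<T} \<longrightarrow> (\<Sum>j\<in>{0..<n}. \<integral>\<^sup>+\<theta>. indicator {\<theta>. a \<theta> j < s \<and> s < b \<theta> j} \<theta> * indicator {0<..<m} \<theta> \<partial>lborel) = ennreal (F s)"
    show "indicator B s * (\<Sum>j\<in>{0..<n}. \<integral>\<^sup>+\<theta>. indicator {\<theta>. a \<theta> j < s \<and> s < b \<theta> j} \<theta> * indicator {0<..<m} \<theta> \<partial>lborel) = ennreal (F s) * indicator B s"
      using s BT by (cases "s \<in> B") auto
  qed
  finally show "emeasure M0 {\<omega>\<in>space M0. sup_location Y T \<omega> \<in> B} = (\<integral>\<^sup>+s. ennreal (F s) * indicator B s \<partial>lborel)" .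
qed

theorem ex_process:
  assumes f: "\<And>t. t \<in> {0<..<T} \<Longrightarrow> F t = f t"
  shows "\<exists>(M :: (real \<Rightarrow> real) measure) X. sample_continuous_process M X \<and> stationary_process M X \<and>
    assumption_U M X T \<and> assumption_L M X \<and> interior_density M X T f"
proof -
  \<comment> \<open>A pair is stored in the values of a function at 0 and 1. The map \<phi> is a
    section of \<psi>, so \<psi> recovers the law on pairs from its image on functions.\<close>
  define \<psi> :: "(real \<Rightarrow> real) \<Rightarrow> real \<times> real" where "\<psi> x = (x 0, x 1)" for x
  define \<phi> :: "real \<times> real \<Rightarrow> real \<Rightarrow> real" where "\<phi> \<omega> = (\<lambda>t. if t = 0 then fst \<omega> else snd \<omega>)" for \<omega>
  define N where "N = restrict_space PiR (\<psi> -` \<Omega>)"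
  have mM0: "measurable N' M0 = measurable N' (restrict_space (borel \<Otimes>\<^sub>M borel) \<Omega>)" for N' :: "'z measure"
    unfolding M0_def by (rule measurable_cong_sets) (auto simp: sets_restrict_space cong: sets_pair_measure_cong)
  have m\<psi>: "\<psi> \<in> measurable N M0"
    unfolding mM0
  proof (rule measurable_restrict_space2)
    show "\<psi> \<in> space N \<rightarrow> \<Omega>" by (auto simp: N_def space_restrict_space)
    show "\<psi> \<in> measurable N (borel \<Otimes>\<^sub>M borel)"
      unfolding N_def \<psi>_def by (rule measurable_restrict_space1) measurable
  qed
  have m\<phi>: "\<phi> \<in> measurable M0 N"
    unfolding N_def
  proof (rule measurable_restrict_space2)
    show "\<phi> \<in> space M0 \<rightarrow> \<psi> -` \<Omega>" by (auto simp: space_M0 \<phi>_def \<psi>_def)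
    have "(\<lambda>\<omega>. if t = 0 then fst \<omega> else snd \<omega>) \<in> borel_measurable M0" for t :: real
      unfolding M0_def by (rule measurable_restrict_space1) measurable
    then show "\<phi> \<in> measurable M0 PiR"
      unfolding \<phi>_def by (intro measurable_abs_UNIV)
  qed
  define M where "M = distr M0 N \<phi>"
  have m\<psi>M: "\<psi> \<in> measurable M M0" using m\<psi> by (simp add: M_def)
  have "distr M M0 \<psi> = distr M0 M0 (\<psi> \<circ> \<phi>)"
    unfolding M_def by (rule distr_distr[OF m\<psi> m\<phi>])
  also have "\<psi> \<circ> \<phi> = (\<lambda>x. x)" by (auto simp: \<psi>_def \<phi>_def)
  also have "distr M0 M0 (\<lambda>x. x) = M0" by simp
  finally have d: "distr M M0 \<psi> = M0" .
  have pM: "prob_space M" unfolding M_def by (rule prob_space.prob_space_distr[OF prob_space_M0 m\<phi>])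
  have sc: "sample_continuous_process M0 Y"
    using prob_space_M0 continuous_Y by (simp add: sample_continuous_process_def)
  show ?thesis
    using stationary_process_transfer[OF m\<psi>M d pM sc stationary_Y assumption_U_Y assumption_L_Y interior_density_Y[OF f]] T
    by (intro exI[of _ M] exI[of _ "\<lambda>t \<omega>. Y t (\<psi> \<omega>)"]) simp
qed

end

section \<open>Cycles of peaks\<close>

text \<open>
  Heights fall along the first \<open>J\<close> steps of a cycle and rise along the others. The total variation
  \<open>c\<close> of the heights over a cycle lengthens the period without affecting any of the intervals
  \<open>(\<alpha> j, \<beta> j)\<close>; it carries the mass missing from the interior.
\<close>

definition cyc_h :: "nat \<Rightarrow> nat \<Rightarrow> real \<Rightarrow> nat \<Rightarrow> real" where
  "cyc_h N J c j = (if j \<le> J then - (c / 2) * (real j / real J)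
     else - (c / 2) * ((real (Suc N) - real j) / (real (Suc N) - real J)))"

text \<open>On a falling step \<alpha> k = 0, and neighbouring right feet are \<beta> (k + 1) apart;
  on a rising step \<beta> (k + 1) = T, and neighbouring left feet are T - \<alpha> k apart. One
  formula serves both because the height difference cancels in the relevant foot.\<close>

definition cyc_gap :: "nat \<Rightarrow> nat \<Rightarrow> real \<Rightarrow> (nat \<Rightarrow> real) \<Rightarrow> (nat \<Rightarrow> real) \<Rightarrow> nat \<Rightarrow> real" where
  "cyc_gap N J c \<alpha> \<beta> k = \<beta> (Suc k) - \<alpha> k + \<bar>cyc_h N J c (Suc k) - cyc_h N J c k\<bar>"

definition cyc_p :: "nat \<Rightarrow> nat \<Rightarrow> real \<Rightarrow> (nat \<Rightarrow> real) \<Rightarrow> (nat \<Rightarrow> real) \<Rightarrow> nat \<Rightarrow> real" where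
  "cyc_p N J c \<alpha> \<beta> j = (\<Sum>k<j. cyc_gap N J c \<alpha> \<beta> k)"

definition unroll :: "nat \<Rightarrow> (nat \<Rightarrow> 'b) \<Rightarrow> int \<Rightarrow> 'b" where
  "unroll N x i = x (nat (i mod int (Suc N)))"

definition peak_pos :: "nat \<Rightarrow> nat \<Rightarrow> real \<Rightarrow> (nat \<Rightarrow> real) \<Rightarrow> (nat \<Rightarrow> real) \<Rightarrow> int \<Rightarrow> real" where
  "peak_pos N J c \<alpha> \<beta> i = unroll N (cyc_p N J c \<alpha> \<beta>) i + of_int (i div int (Suc N)) * cyc_p N J c \<alpha> \<beta> (Suc N)"

lemma unroll_at: "j \<le> N \<Longrightarrow> unroll N x (q * int (Suc N) + int j) = x j"
  unfolding unroll_def by (subst mod_mult_self3) simp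

lemma int_cycle_cases:
  obtains q j where "(i :: int) = q * int (Suc N) + int j" "j \<le> N"
proof (rule that[of "i div int (Suc N)" "nat (i mod int (Suc N))"])
  have "0 \<le> i mod int (Suc N)" "i mod int (Suc N) < int (Suc N)" by simp_all
  then show "nat (i mod int (Suc N)) \<le> N" by linarith
  show "i = i div int (Suc N) * int (Suc N) + int (nat (i mod int (Suc N)))"
    using div_mult_mod_eq[of i "int (Suc N)"] \<open>0 \<le> i mod int (Suc N)\<close> by (simp del: of_nat_Suc)
qed

text \<open>Peak 0 carries \<open>(0, T)\<close>, the peaks strictly between 0 and J carry
  \<open>(0, \<beta> j)\<close>, those after J carry \<open>(\<alpha> j, T)\<close>. Only the lowest
  peak J may have both ends inside. Index N + 1 is peak 0 of the next cycle, hence its value T for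
  \<beta>.\<close>

locale cycle =
  fixes N J :: nat and c T :: real and \<alpha> \<beta> :: "nat \<Rightarrow> real"
  assumes J: "1 \<le> J" "J \<le> N" and c: "0 < c" and T: "0 < T"
    and \<alpha>_0: "j < J \<Longrightarrow> \<alpha> j = 0" and \<beta>_0: "\<beta> 0 = T" and \<beta>_T: "J < j \<Longrightarrow> j \<le> Suc N \<Longrightarrow> \<beta> j = T"
    and \<alpha>_less: "j \<le> N \<Longrightarrow> \<alpha> j < T" and \<beta>_pos: "1 \<le> j \<Longrightarrow> j \<le> N \<Longrightarrow> 0 < \<beta> j" and \<alpha>\<beta>: "\<alpha> J \<le> \<beta> J"
begin

abbreviation H :: "nat \<Rightarrow> real" where "H \<equiv> cyc_h N J c"
abbreviation n :: int where "n \<equiv> int (Suc N)"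
abbreviation L :: real where "L \<equiv> cyc_p N J c \<alpha> \<beta> (Suc N)"
abbreviation h :: "int \<Rightarrow> real" where "h \<equiv> unroll N H"
abbreviation a :: "int \<Rightarrow> real" where "a \<equiv> unroll N \<alpha>"
abbreviation b :: "int \<Rightarrow> real" where "b \<equiv> unroll N \<beta>"
abbreviation p :: "int \<Rightarrow> real" where "p \<equiv> peak_pos N J c \<alpha> \<beta>"
definition A :: "int \<Rightarrow> real" where "A i = p i - h i"
definition C :: "int \<Rightarrow> real" where "C i = p i + h i"

lemma H_desc_step: "Suc k \<le> J \<Longrightarrow> H k - H (Suc k) = c / (2 * real J)"
  using J c by (simp add: cyc_h_def field_simps)

lemma H_top: "H 0 = 0" "H (Suc N) = 0"
  using J by (simp_all add: cyc_h_def)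

lemma H_at_J: "H J = - (c / 2) * ((real (Suc N) - real J) / (real (Suc N) - real J))"
  using J by (simp add: cyc_h_def)

lemma H_asc: "J \<le> k \<Longrightarrow> H k = - (c / 2) * ((real (Suc N) - real k) / (real (Suc N) - real J))"
  using H_at_J by (cases "k = J") (auto simp: cyc_h_def)

lemma H_asc_step: "J \<le> k \<Longrightarrow> H (Suc k) - H k = c / (2 * (real (Suc N) - real J))"
proof -
  assume k: "J \<le> k"
  define D where "D = real (Suc N) - real J"
  define x where "x = (real (Suc N) - real k) / D"
  define y where "y = 1 / D"
  have "(real (Suc N) - real (Suc k)) / D = x - y"
    unfolding x_def y_def diff_divide_distrib[symmetric] by simp
  then have "H (Suc k) = - (c / 2) * (x - y)" "H k = - (c / 2) * x"
    using k H_asc[of k] H_asc[of "Suc k"] unfolding x_def D_def by simp_all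
  then have "H (Suc k) - H k = (c / 2) * y" by (simp add: field_simps)
  then have "H (Suc k) - H k = (c / 2) * (1 / D)" by (simp only: y_def)
  then show ?thesis by (simp add: D_def)
qed

lemma H_less_desc: "j < j' \<Longrightarrow> j' \<le> J \<Longrightarrow> H j' < H j"
  using J c by (simp add: cyc_h_def divide_strict_right_mono)

lemma H_less_asc: "J \<le> j \<Longrightarrow> j < j' \<Longrightarrow> H j < H j'"
  using J c by (simp add: H_asc divide_strict_right_mono)

lemma abs_H_step:
  assumes "k \<le> N" shows "c / (2 * real N) \<le> \<bar>H (Suc k) - H k\<bar>"
proof (cases "Suc k \<le> J")
  case True
  have "c / (2 * real N) \<le> c / (2 * real J)" using J c by (intro divide_left_mono) auto
  then show ?thesis using H_desc_step[OF True] by linarith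
next
  case False
  then have "J \<le> k" by simp
  have "c / (2 * real N) \<le> c / (2 * (real (Suc N) - real J))" using J c by (intro divide_left_mono) auto
  then show ?thesis using H_asc_step[OF \<open>J \<le> k\<close>] by linarith
qed

lemma sum_abs_H: "(\<Sum>k<Suc N. \<bar>H (Suc k) - H k\<bar>) = c"
proof -
  have J': "J \<le> Suc N" using J by simp
  have "(\<Sum>k<Suc N. \<bar>H (Suc k) - H k\<bar>) = (\<Sum>k=0..<J. \<bar>H (Suc k) - H k\<bar>) + (\<Sum>k=J..<Suc N. \<bar>H (Suc k) - H k\<bar>)"
    unfolding atLeast0LessThan[symmetric] by (rule sum.atLeastLessThan_concat[symmetric]) (use J' in auto)
  also have "(\<Sum>k=0..<J. \<bar>H (Suc k) - H k\<bar>) = (\<Sum>k=0..<J. c / (2 * real J))"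
  proof (rule sum.cong[OF refl])
    fix k assume "k \<in> {0..<J}"
    then have "Suc k \<le> J" by simp
    moreover have "0 < c / (2 * real J)" using c J by simp
    ultimately show "\<bar>H (Suc k) - H k\<bar> = c / (2 * real J)" using H_desc_step[of k] by linarith
  qed
  also have "\<dots> = c / 2" using J by simp
  also have "(\<Sum>k=J..<Suc N. \<bar>H (Suc k) - H k\<bar>) = (\<Sum>k=J..<Suc N. c / (2 * (real (Suc N) - real J)))"
  proof (rule sum.cong[OF refl])
    fix k assume "k \<in> {J..<Suc N}"
    then have "J \<le> k" by simp
    moreover have "0 < c / (2 * (real (Suc N) - real J))" using c J by simp
    ultimately show "\<bar>H (Suc k) - H k\<bar> = c / (2 * (real (Suc N) - real J))" using H_asc_step[of k] by linarith
  qed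
  also have "\<dots> = c / 2" using J J' by (simp add: of_nat_diff field_simps)
  finally show ?thesis by simp
qed

text \<open>A cyclic shift of the index in \<beta>, allowed by \<beta> (N + 1) = \<beta> 0, turns
  the sum of the gaps into total interval length plus height variation.\<close>

lemma L_eq: "L = (\<Sum>k\<le>N. \<beta> k - \<alpha> k) + c"
proof -
  have "L = (\<Sum>k<Suc N. \<beta> (Suc k)) - (\<Sum>k<Suc N. \<alpha> k) + (\<Sum>k<Suc N. \<bar>H (Suc k) - H k\<bar>)"
    unfolding cyc_p_def cyc_gap_def sum.distrib sum_subtractf by simp
  also have "(\<Sum>k<Suc N. \<beta> (Suc k)) = (\<Sum>k<Suc N. \<beta> k)"
    using sum.lessThan_Suc_shift[of \<beta> "Suc N"] \<beta>_0 \<beta>_T[of "Suc N"] J by simp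
  finally show ?thesis using sum_abs_H by (simp only: sum_subtractf lessThan_Suc_atMost)
qed

lemma h_at: "j \<le> Suc N \<Longrightarrow> h (q * n + int j) = H j"
proof -
  assume "j \<le> Suc N"
  show ?thesis
  proof (cases "j = Suc N")
    case True
    have "h (q * n + int j) = h ((q + 1) * n + int 0)" by (simp add: True algebra_simps)
    then show ?thesis by (simp only: unroll_at[of 0] H_top True)
  qed (use \<open>j \<le> Suc N\<close> unroll_at[of j N H q] in simp)
qed

lemma b_at: "j \<le> Suc N \<Longrightarrow> b (q * n + int j) = \<beta> j"
proof -
  assume "j \<le> Suc N"
  show ?thesis
  proof (cases "j = Suc N")
    case True
    have "b (q * n + int j) = b ((q + 1) * n + int 0)" by (simp add: True algebra_simps)
    then show ?thesis using \<beta>_T[of "Suc N"] J by (simp only: unroll_at[of 0] \<beta>_0 True)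
  qed (use \<open>j \<le> Suc N\<close> unroll_at[of j N \<beta> q] in simp)
qed

lemma p_at: "j \<le> Suc N \<Longrightarrow> p (q * n + int j) = cyc_p N J c \<alpha> \<beta> j + of_int q * L"
proof -
  assume j: "j \<le> Suc N"
  show ?thesis
  proof (cases "j = Suc N")
    case True
    have "p (q * n + int j) = p ((q + 1) * n + int 0)" by (simp add: True algebra_simps)
    also have "\<dots> = cyc_p N J c \<alpha> \<beta> 0 + of_int (q + 1) * L"
      unfolding peak_pos_def by (subst unroll_at) simp_all
    finally show ?thesis by (simp add: True cyc_p_def[of _ _ _ _ _ 0] algebra_simps)
  next
    case False
    then have "(q * n + int j) div n = q" using j by (subst div_mult_self3) auto
    then show ?thesis using False j unfolding peak_pos_def by (subst unroll_at) simp_all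
  qed
qed

lemma gap_eq: "p (i + 1) - p i = b (i + 1) - a i + \<bar>h (i + 1) - h i\<bar>"
proof -
  obtain q j where i: "i = q * n + int j" "j \<le> N" by (rule int_cycle_cases)
  have i1: "i + 1 = q * n + int (Suc j)" using i by simp
  have "p (i + 1) - p i = cyc_gap N J c \<alpha> \<beta> j"
    unfolding i1 unfolding i using p_at[of "Suc j" q] p_at[of j q] i(2) by (simp add: cyc_p_def)
  also have "\<dots> = b (i + 1) - a i + \<bar>h (i + 1) - h i\<bar>"
    unfolding i1 unfolding i using i(2) h_at[of j q] h_at[of "Suc j" q] b_at[of "Suc j" q] unroll_at[of j N \<alpha> q]
    by (simp add: cyc_gap_def)
  finally show ?thesis .
qed

lemma \<alpha>_le_\<beta>:
  assumes that: "k \<le> N" shows "\<alpha> k \<le> \<beta> k"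
proof -
  consider "k = 0" | "0 < k" "k < J" | "k = J" | "J < k" using J by linarith
  then show ?thesis
  proof cases
    case 1 then show ?thesis using \<beta>_0 \<alpha>_0[of 0] J T by simp
  next
    case 2 then show ?thesis using \<alpha>_0[of k] \<beta>_pos[of k] that by simp
  next
    case 3 then show ?thesis using \<alpha>\<beta> by simp
  next
    case 4 then show ?thesis using \<beta>_T[of k] \<alpha>_less[of k] that by simp
  qed
qed

lemma L_pos: "0 < L"
  unfolding L_eq using c \<alpha>_le_\<beta> by (intro add_nonneg_pos sum_nonneg) auto


text \<open>On a step down peak i limits peak i + 1 from the left; on a step up peak i + 1 limits
  peak i from the right. In either case the neighbour realises the equality demanded by
  \<open>tents\<close>.\<close>

lemma step_cases:
  obtains (desc) q j where "i = q * n + int j" "j < J" "h (i + 1) < h i" "a i = 0" "0 < b (i + 1)" "C (i + 1) - C i = b (i + 1)"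
  | (asc) q j where "i = q * n + int j" "J \<le> j" "j \<le> N" "h i < h (i + 1)" "a i < T" "b (i + 1) = T" "A (i + 1) - A i = T - a i"
proof -
  obtain q j where i: "i = q * n + int j" "j \<le> N" by (rule int_cycle_cases)
  have i1: "i + 1 = q * n + int (Suc j)" using i by simp
  have at: "h i = H j" "h (i + 1) = H (Suc j)" "a i = \<alpha> j" "b (i + 1) = \<beta> (Suc j)"
    unfolding i1 unfolding i using i(2) h_at[of j q] h_at[of "Suc j" q] b_at[of "Suc j" q] unroll_at[of j N \<alpha> q] by simp_all
  show ?thesis
  proof (cases "j < J")
    case True
    then have "h (i + 1) < h i" "a i = 0" using H_less_desc[of j "Suc j"] \<alpha>_0 at by auto
    moreover have "0 < b (i + 1)" using \<beta>_pos[of "Suc j"] True J at by simp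
    ultimately show ?thesis using gap_eq[of i] i True by (intro desc[of q j]) (auto simp: C_def)
  next
    case False
    then have "h i < h (i + 1)" "b (i + 1) = T" using H_less_asc[of j "Suc j"] \<beta>_T[of "Suc j"] at i by auto
    moreover have "a i < T" using \<alpha>_less[of j] at i by simp
    ultimately show ?thesis using gap_eq[of i] i False by (intro asc[of q j]) (auto simp: A_def)
  qed
qed

lemma gap_less: "\<bar>h (i + 1) - h i\<bar> < p (i + 1) - p i"
  using gap_eq[of i] by (cases i rule: step_cases) auto

lemma A_less: "i < k \<Longrightarrow> A i < A k"
proof (rule int_strict_mono_step[of A])
  show "A l < A (l + 1)" for l using gap_less[of l] unfolding A_def abs_less_iff by linarith
qed

lemma C_less: "i < k \<Longrightarrow> C i < C k"
proof (rule int_strict_mono_step[of C])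
  show "C l < C (l + 1)" for l using gap_less[of l] unfolding C_def abs_less_iff by linarith
qed

lemma A_le: "i \<le> k \<Longrightarrow> A i \<le> A k" using A_less[of i k] by (cases "i = k") auto
lemma C_le: "i \<le> k \<Longrightarrow> C i \<le> C k" using C_less[of i k] by (cases "i = k") auto

text \<open>The two neighbours of the lowest peak are T - \<alpha> J + \<beta> J apart plus both
  height differences. These differences absorb the heights entering A and C, and \<alpha> J \<le>
  \<beta> J leaves at least T.\<close>

lemma valley: "T \<le> A (q * n + int J + 1) - A (q * n + int J - 1)" "T \<le> C (q * n + int J + 1) - C (q * n + int J - 1)"
proof -
  let ?v = "q * n + int J"
  have d: "?v - 1 = q * n + int (J - 1)" using J by (simp add: of_nat_diff)
  have up: "?v + 1 = q * n + int (Suc J)" by simp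
  have at: "h (?v - 1) = H (J - 1)" "h ?v = H J" "h (?v + 1) = H (Suc J)" "a (?v - 1) = \<alpha> (J - 1)" "a ?v = \<alpha> J" "b ?v = \<beta> J" "b (?v + 1) = \<beta> (Suc J)"
    unfolding d up using J h_at[of "J - 1" q] h_at[of J q] h_at[of "Suc J" q] b_at[of J q] b_at[of "Suc J" q] unroll_at[of J N \<alpha> q] unroll_at[of "J - 1" N \<alpha> q] by simp_all
  have "\<alpha> (J - 1) = 0" "\<beta> (Suc J) = T" using \<alpha>_0[of "J - 1"] \<beta>_T[of "Suc J"] J by auto
  then have g: "p ?v - p (?v - 1) = \<beta> J + \<bar>h ?v - h (?v - 1)\<bar>" "p (?v + 1) - p ?v = T - \<alpha> J + \<bar>h (?v + 1) - h ?v\<bar>"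
    using gap_eq[of "?v - 1"] gap_eq[of ?v] at by simp_all
  show "T \<le> A (?v + 1) - A (?v - 1)" "T \<le> C (?v + 1) - C (?v - 1)"
    using g \<alpha>\<beta> unfolding A_def C_def by linarith+
qed

lemma desc_right:
  assumes i: "i = q * n + int j" "j < J" and k: "i < k" "h i \<le> h k"
  shows "T \<le> A k - A i"
proof -
  have "q * n + int J < k"
  proof (rule ccontr)
    assume "\<not> q * n + int J < k"
    then have kj: "k = q * n + int (nat (k - q * n))" "j < nat (k - q * n)" "nat (k - q * n) \<le> J" using k i by auto
    then have "h k < h i"
      using h_at[of "nat (k - q * n)" q] h_at[of j q] H_less_desc[OF kj(2,3)] i J by auto
    then show False using k by simp
  qed
  then have "A (q * n + int J + 1) \<le> A k" by (intro A_le) simp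
  moreover have "A i \<le> A (q * n + int J - 1)" using i by (intro A_le) simp
  ultimately show ?thesis using valley(1)[of q] by linarith
qed

lemma asc_left:
  assumes i: "i - 1 = q * n + int j" "J \<le> j" "j \<le> N" and k: "k < i" "h i < h k"
  shows "T \<le> C i - C k"
proof -
  have "k < q * n + int J"
  proof (rule ccontr)
    assume "\<not> k < q * n + int J"
    then have kj: "k = q * n + int (nat (k - q * n))" "J \<le> nat (k - q * n)" "nat (k - q * n) < Suc j" using k i by auto
    have ij: "i = q * n + int (Suc j)" using i by simp
    have "h k < h i"
      using h_at[of "nat (k - q * n)" q] h_at[of "Suc j" q] H_less_asc[OF kj(2,3)] kj ij i(3) by auto
    then show False using k by simp
  qed
  then have "C k \<le> C (q * n + int J - 1)" by (intro C_le) simp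
  moreover have "C (q * n + int J + 1) \<le> C i" using i by (intro C_le) simp
  ultimately show ?thesis using valley(2)[of q] by linarith
qed

text \<open>On an uphill side the nearest higher tent is the neighbour, at the foot distance built
  into the gap. On a downhill side every higher tent lies across the valley, at foot distance at
  least T.\<close>

lemma tents_cycle: "tents p h n L T a b"
proof
  show "0 < n" "0 < L" "0 < T" using L_pos T by auto
  show "p (i + n) = p i + L" for i
  proof -
    obtain q j where i: "i = q * n + int j" "j \<le> N" by (rule int_cycle_cases)
    then have "i + n = (q + 1) * n + int j" by (simp add: algebra_simps)
    then show ?thesis using i p_at[of j q] p_at[of j "q + 1"] by (simp only:) (simp add: algebra_simps)
  qed
  show "h (i + n) = h i" "a (i + n) = a i" "b (i + n) = b i" for i by (simp_all add: unroll_def)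
  show "\<bar>h (i + 1) - h i\<bar> < p (i + 1) - p i" for i by (rule gap_less)
  show "T - a i \<le> (p k - h k) - (p i - h i)" if "i < k" "h i < h k" for i k
  proof (cases i rule: step_cases)
    case (desc q j)
    then show ?thesis using desc_right[OF desc(1,2) that(1)] that by (simp add: A_def)
  next
    case (asc q j)
    then show ?thesis using A_le[of "i + 1" k] that by (simp add: A_def)
  qed
  show "\<exists>k>i. h i < h k \<and> (p k - h k) - (p i - h i) = T - a i" if "a i \<noteq> 0" for i
  proof (cases i rule: step_cases)
    case (asc q j)
    then show ?thesis by (intro exI[of _ "i + 1"]) (simp add: A_def)
  qed (use that in simp)
  show "b i \<le> (p i + h i) - (p k + h k)" if "k < i" "h i < h k" for i k
  proof (cases "i - 1" rule: step_cases)
    case (desc q j)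
    show ?thesis using desc(3-) C_le[of k "i - 1"] that by (simp add: C_def)
  next
    case (asc q j)
    show ?thesis using asc(4-) asc_left[OF asc(1,2,3) that] by (simp add: C_def)
  qed
  show "\<exists>k<i. h i < h k \<and> (p i + h i) - (p k + h k) = b i" if "b i \<noteq> T" for i
  proof (cases "i - 1" rule: step_cases)
    case (desc q j)
    show ?thesis using desc(3-) by (intro exI[of _ "i - 1"]) (simp add: C_def)
  next
    case (asc q j)
    show ?thesis using asc(4-) that by simp
  qed
  show "T \<le> p k - p i" if k: "i < k" "h k = h i" and between: "\<And>l. i < l \<Longrightarrow> l < k \<Longrightarrow> h l \<le> h i" for i k
  proof (cases i rule: step_cases)
    case (desc q j)
    then show ?thesis using desc_right[OF desc(1,2) k(1)] k by (simp add: A_def)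
  next
    case (asc q j)
    then have "k \<noteq> i + 1" using k by auto
    then show ?thesis using between[of "i + 1"] k asc by simp
  qed
qed

lemma gap_ge: "c / (2 * real N) \<le> p (i + 1) - p i"
proof -
  obtain q j where i: "i = q * n + int j" "j \<le> N" by (rule int_cycle_cases)
  have i1: "i + 1 = q * n + int (Suc j)" using i by simp
  have "h i = H j" "h (i + 1) = H (Suc j)"
    unfolding i1 unfolding i using i(2) h_at[of j q] h_at[of "Suc j" q] by simp_all
  then show ?thesis using abs_H_step[OF i(2)] gap_less[of i] by simp
qed

end

section \<open>Processes with a prescribed density\<close>

definition path_var :: "(real \<Rightarrow> real) \<Rightarrow> real list \<Rightarrow> real" where
  "path_var f l = (\<Sum>i<length l - 1. \<bar>f (l ! Suc i) - f (l ! i)\<bar>)"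

lemma path_var_snoc:
  assumes "l \<noteq> []" shows "path_var f (l @ [x]) = path_var f l + \<bar>f x - f (last l)\<bar>"
proof -
  obtain k where k: "length l = Suc k" using assms by (cases l) auto
  have "path_var f (l @ [x]) = (\<Sum>i<Suc k. \<bar>f ((l @ [x]) ! Suc i) - f ((l @ [x]) ! i)\<bar>)"
    by (simp add: path_var_def k)
  also have "\<dots> = (\<Sum>i<k. \<bar>f ((l @ [x]) ! Suc i) - f ((l @ [x]) ! i)\<bar>) + \<bar>f ((l @ [x]) ! Suc k) - f ((l @ [x]) ! k)\<bar>"
    by simp
  also have "(\<Sum>i<k. \<bar>f ((l @ [x]) ! Suc i) - f ((l @ [x]) ! i)\<bar>) = path_var f l"
    unfolding path_var_def k by (rule sum.cong) (simp_all add: nth_append k)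
  finally show ?thesis
    using assms by (simp add: nth_append k last_conv_nth)
qed

lemma sum_cycle_nat: "(\<Sum>i\<in>{0..<int (Suc N)}. G (nat (i mod int (Suc N)))) = (\<Sum>j<Suc N. G j :: 'b::comm_monoid_add)"
proof -
  have "{0..<int (Suc N)} = int ` {..<Suc N}"
    by (metis image_int_atLeastLessThan atLeast0LessThan of_nat_0)
  then have "(\<Sum>i\<in>{0..<int (Suc N)}. G (nat (i mod int (Suc N)))) = (\<Sum>j<Suc N. G (nat (int j mod int (Suc N))))"
    by (simp only: sum.reindex[OF inj_on_of_nat] o_def)
  also have "\<dots> = (\<Sum>j<Suc N. G j)"
    by (rule sum.cong) (auto simp del: of_nat_Suc)
  finally show ?thesis .
qed

text \<open>N is so large that N + 1 equal slices of a range of at most f0 + fT are shorter than the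
  lower bound \<mu> of f.\<close>

locale density_data =
  fixes f :: "real \<Rightarrow> real" and T f0 fT \<mu> :: real and N :: nat
  assumes T: "0 < T"
    and lim0: "(f \<longlongrightarrow> f0) (at_right 0)" and limT: "(f \<longlongrightarrow> fT) (at_left T)"
    and var: "\<And>l. sorted_wrt (<) l \<Longrightarrow> set l \<subseteq> {0<..<T} \<Longrightarrow> path_var f l \<le> f0 + fT"
    and \<mu>: "0 < \<mu>" "\<And>t. t \<in> {0<..<T} \<Longrightarrow> \<mu> \<le> f t"
    and N: "1 \<le> N" "(f0 + fT) / real (Suc N) < \<mu>"
    and less_1: "(LBINT t:{0<..<T}. f t) < 1"
begin

section \<open>Variation function and Jordan decomposition\<close>

definition V :: "real \<Rightarrow> real" where
  "V s = (SUP l\<in>{l. sorted_wrt (<) l \<and> set l \<subseteq> {0<..s}}. path_var f l)"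

lemma chain_bdd: "s < T \<Longrightarrow> bdd_above (path_var f ` {l. sorted_wrt (<) l \<and> set l \<subseteq> {0<..s}})"
  by (rule bdd_aboveI2[of _ _ "f0 + fT"]) (auto intro!: var)

lemma V_upper: "s < T \<Longrightarrow> sorted_wrt (<) l \<Longrightarrow> set l \<subseteq> {0<..s} \<Longrightarrow> path_var f l \<le> V s"
  unfolding V_def by (rule cSUP_upper[OF _ chain_bdd]) auto

lemma V_le: "s < T \<Longrightarrow> V s \<le> f0 + fT"
  unfolding V_def by (rule cSUP_least) (auto intro!: var exI[of _ "[]"])

lemma V_nonneg: "s < T \<Longrightarrow> 0 \<le> V s"
  using V_upper[of s "[]"] by (simp add: path_var_def)

text \<open>A chain in \<open>(0, s]\<close> can be made to end in s without decreasing its sum;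
  appending t then adds exactly the last jump.\<close>

lemma V_step:
  assumes st: "0 < s" "s < t" "t < T"
  shows "V s + \<bar>f t - f s\<bar> \<le> V t"
proof -
  have "V s \<le> V t - \<bar>f t - f s\<bar>"
    unfolding V_def[of s]
  proof (rule cSUP_least)
    show "{l. sorted_wrt (<) l \<and> set l \<subseteq> {0<..s}} \<noteq> {}" by (auto intro!: exI[of _ "[]"])
    fix l assume "l \<in> {l. sorted_wrt (<) l \<and> set l \<subseteq> {0<..s}}"
    then have l: "sorted_wrt (<) l" "set l \<subseteq> {0<..s}" by auto
    have "\<exists>l'. sorted_wrt (<) l' \<and> set l' \<subseteq> {0<..s} \<and> l' \<noteq> [] \<and> last l' = s \<and> path_var f l \<le> path_var f l'"
    proof (cases "s \<in> set l")
      case True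
      then have ne: "l \<noteq> []" by auto
      have "last l = s"
      proof (rule ccontr)
        assume ns: "last l \<noteq> s"
        have "l = butlast l @ [last l]" using ne by simp
        then have "sorted_wrt (<) (butlast l @ [last l])" "s \<in> set (butlast l @ [last l])" using l(1) True by simp_all
        then have "s < last l" using ns by (auto simp: sorted_wrt_append)
        moreover have "last l \<le> s" using l(2) ne last_in_set by fastforce
        ultimately show False by simp
      qed
      then show ?thesis using l ne by blast
    next
      case False
      then have "x < s" if "x \<in> set l" for x using l(2) that by (cases "x = s") auto
      then have "sorted_wrt (<) (l @ [s])" "set (l @ [s]) \<subseteq> {0<..s}" using l st by (auto simp: sorted_wrt_append)
      moreover have "path_var f l \<le> path_var f (l @ [s])"
        using path_var_snoc[of l f s] by (cases "l = []") (auto simp: path_var_def)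
      ultimately show ?thesis by (intro exI[of _ "l @ [s]"]) auto
    qed
    then obtain l' where l': "sorted_wrt (<) l'" "set l' \<subseteq> {0<..s}" "l' \<noteq> []" "last l' = s" "path_var f l \<le> path_var f l'" by blast
    have "x < t" if "x \<in> set l'" for x using l'(2) st that by auto
    then have "sorted_wrt (<) (l' @ [t])" using l'(1) by (simp add: sorted_wrt_append)
    moreover have "set (l' @ [t]) \<subseteq> {0<..t}" using l'(2) st by auto
    ultimately have "path_var f (l' @ [t]) \<le> V t" using st by (intro V_upper)
    then show "path_var f l \<le> V t - \<bar>f t - f s\<bar>"
      using path_var_snoc[OF l'(3), of f t] l'(4,5) by simp
  qed
  then show ?thesis by simp
qed

definition D0 :: "real \<Rightarrow> real" where "D0 s = (V s - f s + f0) / 2"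
definition U0 :: "real \<Rightarrow> real" where "U0 s = (V s + f s - f0) / 2"
text \<open>Subtracting the infimum from both parts leaves their difference unchanged and makes
  \<open>D\<close> arbitrarily small near 0, without computing the limit of V there. This smallness
  gives \<open>\<beta>_pos\<close>.\<close>

definition d0 :: real where "d0 = (INF s\<in>{0<..<T}. D0 s)"
definition D :: "real \<Rightarrow> real" where "D s = D0 s - d0"
definition U :: "real \<Rightarrow> real" where "U s = U0 s - d0"

lemma ne: "{0<..<T} \<noteq> {}" using T by simp

lemma f_eq: "f s = f0 + U s - D s"
  by (simp add: D_def U_def D0_def U0_def field_simps)

lemma D0_mono: "0 < s \<Longrightarrow> s \<le> t \<Longrightarrow> t < T \<Longrightarrow> D0 s \<le> D0 t"
  using V_step[of s t] by (cases "s = t") (auto simp: D0_def)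

lemma U0_mono: "0 < s \<Longrightarrow> s \<le> t \<Longrightarrow> t < T \<Longrightarrow> U0 s \<le> U0 t"
  using V_step[of s t] by (cases "s = t") (auto simp: U0_def)

lemma V_ge_f0:
  assumes s: "s \<in> {0<..<T}" shows "\<bar>f s - f0\<bar> \<le> V s"
proof (rule tendsto_upperbound)
  show "((\<lambda>r. \<bar>f s - f r\<bar>) \<longlongrightarrow> \<bar>f s - f0\<bar>) (at_right 0)" by (intro tendsto_intros lim0)
  show "\<forall>\<^sub>F r in at_right 0. \<bar>f s - f r\<bar> \<le> V s"
    unfolding eventually_at_right_field
  proof (rule exI[of _ s], intro conjI allI impI)
    fix r assume "0 < r" "r < s"
    then show "\<bar>f s - f r\<bar> \<le> V s" using V_step[of r s] V_nonneg[of r] s by auto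
  qed (use s in auto)
qed simp

text \<open>Here the variation bound enters, in the form D \<le> f0 and U \<le> fT. As no more is
  taken away than is present at 0, first-in-first-out matching ends only intervals that start at
  0.\<close>

lemma V_le_fT:
  assumes s: "s \<in> {0<..<T}" shows "V s + \<bar>fT - f s\<bar> \<le> f0 + fT"
proof (rule tendsto_upperbound)
  show "((\<lambda>r. V s + \<bar>f r - f s\<bar>) \<longlongrightarrow> V s + \<bar>fT - f s\<bar>) (at_left T)" by (intro tendsto_intros limT)
  show "\<forall>\<^sub>F r in at_left T. V s + \<bar>f r - f s\<bar> \<le> f0 + fT"
    unfolding eventually_at_left_field
  proof (rule exI[of _ s], intro conjI allI impI)
    fix r assume "s < r" "r < T"
    then show "V s + \<bar>f r - f s\<bar> \<le> f0 + fT" using V_step[of s r] V_le[of r] s by auto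
  qed (use s in auto)
qed simp

lemma D0_nonneg: "s \<in> {0<..<T} \<Longrightarrow> 0 \<le> D0 s"
  using V_ge_f0[of s] by (simp add: D0_def abs_le_iff)

lemma D0_bdd: "bdd_below (D0 ` {0<..<T})"
  using D0_nonneg by (intro bdd_belowI2[of _ 0])

lemma d0_le: "s \<in> {0<..<T} \<Longrightarrow> d0 \<le> D0 s"
  unfolding d0_def by (rule cINF_lower[OF D0_bdd])

lemma d0_nonneg: "0 \<le> d0"
  unfolding d0_def using ne D0_nonneg by (intro cINF_greatest)

lemma D_nonneg: "s \<in> {0<..<T} \<Longrightarrow> 0 \<le> D s"
  using d0_le[of s] by (simp add: D_def)

lemma D_le: "s \<in> {0<..<T} \<Longrightarrow> D s \<le> f0"
proof -
  assume s: "s \<in> {0<..<T}"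
  have "D0 s \<le> f0" using V_le_fT[OF s] by (simp add: D0_def abs_le_iff)
  then show ?thesis using d0_nonneg by (simp add: D_def)
qed

lemma D_small: "0 < e \<Longrightarrow> \<exists>s\<in>{0<..<T}. D s < e"
proof -
  assume "0 < e"
  then have "d0 < d0 + e" by simp
  then show ?thesis unfolding d0_def cINF_less_iff[OF ne D0_bdd] D_def d0_def by (auto simp: algebra_simps)
qed

lemma D_mono: "0 < s \<Longrightarrow> s \<le> t \<Longrightarrow> t < T \<Longrightarrow> D s \<le> D t"
  using D0_mono[of s t] by (simp add: D_def)

lemma U_mono: "0 < s \<Longrightarrow> s \<le> t \<Longrightarrow> t < T \<Longrightarrow> U s \<le> U t"
  using U0_mono[of s t] by (simp add: U_def)

text \<open>The constant d0 was chosen for the falling part; it suits the rising part too, since U0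
  - D0 = f - f0 tends to 0 at 0.\<close>

lemma U_nonneg:
  assumes s: "s \<in> {0<..<T}" shows "0 \<le> U s"
proof -
  have "d0 + f0 - f0 \<le> U0 s"
  proof (rule tendsto_upperbound)
    show "((\<lambda>r. d0 + f r - f0) \<longlongrightarrow> d0 + f0 - f0) (at_right 0)" by (intro tendsto_intros lim0)
    show "\<forall>\<^sub>F r in at_right 0. d0 + f r - f0 \<le> U0 s"
      unfolding eventually_at_right_field
    proof (rule exI[of _ s], intro conjI allI impI)
      fix r assume r: "0 < r" "r < s"
      then have "d0 + f r - f0 \<le> U0 r" using d0_le[of r] s by (simp add: D0_def U0_def field_simps)
      also have "\<dots> \<le> U0 s" using r s by (intro U0_mono) auto
      finally show "d0 + f r - f0 \<le> U0 s" .
    qed (use s in auto)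
  qed simp
  then show ?thesis by (simp add: U_def)
qed

lemma U_le: "s \<in> {0<..<T} \<Longrightarrow> U s \<le> fT"
proof -
  assume s: "s \<in> {0<..<T}"
  have "U0 s \<le> fT" using V_le_fT[OF s] by (simp add: U0_def abs_le_iff)
  then show ?thesis using d0_nonneg by (simp add: U_def)
qed

definition u1 :: real where "u1 = (SUP s\<in>{0<..<T}. U s)"
text \<open>The levels of f0 + U range up to f0 + u1 and are cut into N + 1 slices of length m. A
  parameter \<theta> in \<open>(0, m)\<close> selects the level \<theta> + j * m in slice j.\<close>

definition m :: real where "m = (f0 + u1) / real (Suc N)"

lemma U_bdd: "bdd_above (U ` {0<..<T})" using U_le by (intro bdd_aboveI2)
lemma U_le_u1: "s \<in> {0<..<T} \<Longrightarrow> U s \<le> u1" unfolding u1_def by (rule cSUP_upper[OF _ U_bdd])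
lemma u1_le: "u1 \<le> fT" unfolding u1_def using ne U_le by (rule cSUP_least)
lemma u1_nonneg: "0 \<le> u1" using U_le_u1[of "T / 2"] U_nonneg[of "T / 2"] T by simp

lemma f0_ge: "\<mu> \<le> f0"
proof (rule tendsto_lowerbound[OF lim0])
  show "\<forall>\<^sub>F t in at_right 0. \<mu> \<le> f t"
    unfolding eventually_at_right_field using T \<mu>(2) by (intro exI[of _ T]) auto
qed simp

lemma m: "0 < m" "m < \<mu>" "m * real (Suc N) = f0 + u1"
proof -
  show "0 < m" using f0_ge \<mu> u1_nonneg by (simp add: m_def)
  have "m \<le> (f0 + fT) / real (Suc N)" unfolding m_def using u1_le by (intro divide_right_mono) auto
  then show "m < \<mu>" using N by simp
qed (simp add: m_def)

text \<open>
  Generalised inverses of the rising part \<open>f0 + U\<close> and of the falling part \<open>D\<close>, with value \<open>T\<close> at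
  levels that are not attained. Level \<open>y\<close> of the first is matched with level \<open>y - m\<close> of the second.
\<close>

definition \<alpha> :: "real \<Rightarrow> real" where "\<alpha> y = Inf (insert T {s\<in>{0<..<T}. y \<le> f0 + U s})"
definition \<beta> :: "real \<Rightarrow> real" where "\<beta> y = Inf (insert T {s\<in>{0<..<T}. y \<le> D s})"

lemma bdd_sets: "bdd_below (insert T {s\<in>{0<..<T}. P s})"
  by (rule bdd_belowI[of _ 0]) (use T in auto)

lemma \<alpha>_le: "s \<in> {0<..<T} \<Longrightarrow> y \<le> f0 + U s \<Longrightarrow> \<alpha> y \<le> s"
  unfolding \<alpha>_def by (rule cInf_lower[OF _ bdd_sets]) auto

lemma \<beta>_le: "s \<in> {0<..<T} \<Longrightarrow> y \<le> D s \<Longrightarrow> \<beta> y \<le> s"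
  unfolding \<beta>_def by (rule cInf_lower[OF _ bdd_sets]) auto

lemma \<beta>_ge: "z \<le> T \<Longrightarrow> (\<And>s. s \<in> {0<..<T} \<Longrightarrow> y \<le> D s \<Longrightarrow> z \<le> s) \<Longrightarrow> z \<le> \<beta> y"
  unfolding \<beta>_def by (rule cInf_greatest) auto

lemma \<alpha>_nonneg: "0 \<le> \<alpha> y"
  unfolding \<alpha>_def by (rule cInf_greatest) (use T in auto)

lemma \<beta>_le_T: "\<beta> y \<le> T"
  unfolding \<beta>_def by (rule cInf_lower[OF _ bdd_sets]) auto

lemma mono_\<alpha>: "mono \<alpha>"
  unfolding \<alpha>_def by (intro monoI cInf_superset_mono bdd_sets) auto

lemma mono_\<beta>: "mono \<beta>"
  unfolding \<beta>_def by (intro monoI cInf_superset_mono bdd_sets) auto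

lemma meas [measurable]: "\<alpha> \<in> borel_measurable borel" "\<beta> \<in> borel_measurable borel"
  using mono_\<alpha> mono_\<beta> by (auto intro: borel_measurable_mono)

lemma \<alpha>_eq_0: "y \<le> f0 \<Longrightarrow> \<alpha> y = 0"
proof (rule antisym[OF field_le_epsilon \<alpha>_nonneg])
  fix e :: real assume "y \<le> f0" "0 < e"
  have s: "min e (T / 2) \<in> {0<..<T}" using T \<open>0 < e\<close> by auto
  then have "\<alpha> y \<le> min e (T / 2)" using U_nonneg[OF s] \<open>y \<le> f0\<close> by (intro \<alpha>_le) auto
  then show "\<alpha> y \<le> 0 + e" by simp
qed

lemma \<alpha>_less_T: "y < f0 + u1 \<Longrightarrow> \<alpha> y < T"
proof -
  assume "y < f0 + u1"
  then have "y - f0 < u1" by simp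
  then obtain s where "s \<in> {0<..<T}" "y - f0 < U s" unfolding u1_def less_cSUP_iff[OF ne U_bdd] by blast
  then show ?thesis using \<alpha>_le[of s y] by simp
qed

lemma \<beta>_pos: "0 < y \<Longrightarrow> 0 < \<beta> y"
proof -
  assume "0 < y"
  then obtain s where s: "s \<in> {0<..<T}" "D s < y" using D_small by blast
  have "s \<le> \<beta> y"
  proof (rule \<beta>_ge)
    fix t assume t: "t \<in> {0<..<T}" "y \<le> D t"
    show "s \<le> t"
    proof (rule ccontr)
      assume "\<not> s \<le> t"
      then have "D t \<le> D s" using s t by (intro D_mono) auto
      then show False using s t by simp
    qed
  qed (use s in auto)
  then show ?thesis using s by auto
qed

lemma \<beta>_eq_T: "f0 < y \<Longrightarrow> \<beta> y = T"
proof (rule antisym[OF \<beta>_le_T \<beta>_ge])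
  fix s assume "f0 < y" "s \<in> {0<..<T}" "y \<le> D s"
  then show "T \<le> s" using D_le[of s] by simp
qed simp

text \<open>Where D has reached y, the bound f > m gives f0 + U = f + D > y + m, so the start level
  y' has been reached already. This is the purpose of m < inf f.\<close>

lemma \<alpha>_le_\<beta>: "y' \<le> y + m \<Longrightarrow> \<alpha> y' \<le> \<beta> y"
proof (rule \<beta>_ge)
  assume y: "y' \<le> y + m"
  show "\<alpha> y' \<le> T" unfolding \<alpha>_def by (rule cInf_lower[OF _ bdd_sets]) auto
  fix s assume s: "s \<in> {0<..<T}" "y \<le> D s"
  then have "y' \<le> f0 + U s" using y m(2) \<mu>(2)[OF s(1)] f_eq[of s] by simp
  then show "\<alpha> y' \<le> s" using s by (intro \<alpha>_le)
qed

section \<open>Labels of the peaks at a fixed level\<close>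

definition I :: real where "I = (LBINT t:{0<..<T}. f t)"
text \<open>The levels fill an interval of length m, so a height variation c per cycle contributes c
  * m = 1 - I, the mass missing from the interior.\<close>

definition c :: real where "c = (1 - I) / m"
text \<open>Levels up to f0 start at 0. The lowest peak is the first whose level exceeds f0, or the
  last peak if there is none.\<close>

definition J :: "real \<Rightarrow> nat" where "J \<theta> = min N (1 + nat \<lfloor>(f0 - \<theta>) / m\<rfloor>)"
definition \<alpha>s :: "real \<Rightarrow> nat \<Rightarrow> real" where "\<alpha>s \<theta> j = \<alpha> (\<theta> + real j * m)"
text \<open>The index shift pairs the start level \<theta> + j * m with the end level \<theta> + (j
  - 1) * m. Peak 0 has no partner and keeps \<open>(0, T)\<close>; it accounts for a constant share
  m of the density.\<close>

definition \<beta>s :: "real \<Rightarrow> nat \<Rightarrow> real" where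
  "\<beta>s \<theta> j = (if j = 0 \<or> j = Suc N then T else \<beta> (\<theta> + (real j - 1) * m))"

lemma c: "0 < c" using less_1 m by (simp add: c_def I_def)

lemma cycle:
  assumes \<theta>: "\<theta> \<in> {0<..<m}"
  shows "cycle N (J \<theta>) c T (\<alpha>s \<theta>) (\<beta>s \<theta>)"
proof
  have fm: "\<theta> < f0" using \<theta> m f0_ge by simp
  have q: "0 \<le> (f0 - \<theta>) / m" using fm m by simp
  define k where "k = nat \<lfloor>(f0 - \<theta>) / m\<rfloor>"
  have k: "real k \<le> (f0 - \<theta>) / m" "(f0 - \<theta>) / m < real k + 1" using q unfolding k_def by linarith+
  have k': "\<theta> + real k * m \<le> f0" "f0 < \<theta> + (real k + 1) * m"
    using k m by (simp_all add: pos_le_divide_eq pos_divide_less_eq algebra_simps)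
  have J: "J \<theta> = min N (1 + k)" by (simp add: J_def k_def)
  show "1 \<le> J \<theta>" "J \<theta> \<le> N" using N by (auto simp: J)
  show "0 < c" "0 < T" by (fact c T)+
  show "\<alpha>s \<theta> j = 0" if "j < J \<theta>" for j
  proof -
    have "real j * m \<le> real k * m" using that m by (intro mult_right_mono) (auto simp: J)
    then show ?thesis unfolding \<alpha>s_def using k' by (intro \<alpha>_eq_0) linarith
  qed
  show "\<beta>s \<theta> 0 = T" by (simp add: \<beta>s_def)
  show "\<beta>s \<theta> j = T" if "J \<theta> < j" "j \<le> Suc N" for j
  proof (cases "j = Suc N")
    case False
    then have "1 + k < j" using that by (auto simp: J)
    then have "(real k + 1) * m \<le> (real j - 1) * m" using m by (intro mult_right_mono) auto
    then show ?thesis using k' False by (auto simp: \<beta>s_def intro!: \<beta>_eq_T)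
  qed (simp add: \<beta>s_def)
  show "\<alpha>s \<theta> j < T" if "j \<le> N" for j
  proof -
    have 1: "real j * m \<le> real N * m" using that m by (intro mult_right_mono) auto
    have 2: "m * real (Suc N) = m + real N * m" by (simp add: algebra_simps)
    have 3: "\<theta> < m" using \<theta> by simp
    have "\<theta> + real j * m < f0 + u1" unfolding m(3)[symmetric] 2 using 1 3 by linarith
    then show ?thesis unfolding \<alpha>s_def by (rule \<alpha>_less_T)
  qed
  show "0 < \<beta>s \<theta> j" if "1 \<le> j" "j \<le> N" for j
  proof -
    have "0 \<le> (real j - 1) * m" using that m by simp
    then have "0 < \<beta> (\<theta> + (real j - 1) * m)" using \<theta> by (intro \<beta>_pos) auto
    then show ?thesis using T by (simp add: \<beta>s_def)
  qed
  show "\<alpha>s \<theta> (J \<theta>) \<le> \<beta>s \<theta> (J \<theta>)"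
    using N unfolding \<alpha>s_def \<beta>s_def J by (auto intro!: \<alpha>_le_\<beta> simp: algebra_simps)
qed

section \<open>Recovery of the density and normalisation\<close>

definition F :: "real \<Rightarrow> real" where "F t = (if t \<in> {0<..<T} then f t else 0)"

lemma discont: "countable ({s\<in>{0<..<T}. \<not> isCont U s} \<union> {s\<in>{0<..<T}. \<not> isCont D s})"
proof -
  have "mono_on {0<..<T} U" "mono_on {0<..<T} D" by (auto intro!: mono_onI U_mono D_mono)
  then show ?thesis
    using mono_on_ctble_discont_open[of "{0<..<T}" U] mono_on_ctble_discont_open[of "{0<..<T}" D] by (intro countable_Un) simp_all
qed

lemma meas_F [measurable]: "F \<in> borel_measurable borel"
proof -
  have "mono_on {0<..<T} U" "mono_on {0<..<T} D" by (auto intro!: mono_onI U_mono D_mono)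
  then have "U \<in> borel_measurable (restrict_space borel {0<..<T})" "D \<in> borel_measurable (restrict_space borel {0<..<T})"
    by (auto intro: borel_measurable_mono_on_fnc)
  then have r: "(\<lambda>s. f0 + U s - D s) \<in> borel_measurable (restrict_space borel {0<..<T})"
    by (intro borel_measurable_diff borel_measurable_add borel_measurable_const)
  have "(\<lambda>s. if s \<in> {0<..<T} then f0 + U s - D s else 0) \<in> borel_measurable borel"
    by (rule iffD1[OF measurable_restrict_space_iff _]) (rule r | simp)+
  moreover have "F = (\<lambda>s. if s \<in> {0<..<T} then f0 + U s - D s else 0)"
    by (rule ext) (simp only: F_def f_eq[of "_ :: real"])
  ultimately show ?thesis by simp
qed

lemma F_bounds: "0 \<le> F t" "F t \<le> f0 + fT"
proof -
  have "0 \<le> f0 + fT" using var[of "[]"] by (simp add: path_var_def)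
  moreover have "f t \<le> f0 + fT" if "t \<in> {0<..<T}" using f_eq[of t] U_le[OF that] D_nonneg[OF that] by simp
  ultimately show "0 \<le> F t" "F t \<le> f0 + fT" using \<mu> by (auto simp: F_def intro: less_imp_le order_trans)
qed

lemma nn_integral_F: "(\<integral>\<^sup>+t. ennreal (F t) \<partial>lborel) = ennreal I"
proof -
  have Fi: "F t = indicator {0<..<T} t *\<^sub>R F t" for t by (simp add: F_def)
  have "integrable lborel (\<lambda>t. indicator {0<..<T} t *\<^sub>R F t)"
    by (rule integrableI_bounded_set_indicator[where B = "f0 + fT"]) (use F_bounds T in auto)
  then have "integrable lborel F" by (simp only: Fi[symmetric])
  then have "(\<integral>\<^sup>+t. ennreal (F t) \<partial>lborel) = ennreal (\<integral>t. F t \<partial>lborel)"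
    by (rule nn_integral_eq_integral) (simp add: F_bounds)
  also have "(\<integral>t. F t \<partial>lborel) = I"
    unfolding I_def set_lebesgue_integral_def by (rule Bochner_Integration.integral_cong) (auto simp: F_def)
  finally show ?thesis .
qed

text \<open>Continuity of U and D at s makes the one-sided conventions in the inverses immaterial,
  except at the two critical levels. Only countably many s and, for each s, finitely many \<theta>
  are lost.\<close>

lemma label_iff:
  assumes s: "s \<in> {0<..<T}" and cont: "isCont U s" "isCont D s" and y: "y \<noteq> f0 + U s" "y' \<noteq> D s"
  shows "\<alpha> y < s \<longleftrightarrow> y < f0 + U s" "s < \<beta> y' \<longleftrightarrow> D s < y'"
proof -
  show "\<alpha> y < s \<longleftrightarrow> y < f0 + U s"
  proof
    assume "\<alpha> y < s"
    then obtain t where t: "t \<in> insert T {s\<in>{0<..<T}. y \<le> f0 + U s}" "t < s"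
      unfolding \<alpha>_def by (subst (asm) cInf_less_iff[OF _ bdd_sets]) auto
    then have "y \<le> f0 + U t" "t \<in> {0<..<T}" using s by auto
    then have "y \<le> f0 + U s" using U_mono[of t s] t s by auto
    then show "y < f0 + U s" using y by simp
  next
    assume "y < f0 + U s"
    then have "y - f0 < U s" by simp
    moreover have "(U \<longlongrightarrow> U s) (at_left s)" using cont(1) unfolding isCont_def by (rule tendsto_within_subset) simp
    ultimately have "\<forall>\<^sub>F t in at_left s. y - f0 < U t" by (intro order_tendstoD(1))
    then obtain b where b: "b < s" "\<And>t. b < t \<Longrightarrow> t < s \<Longrightarrow> y - f0 < U t" unfolding eventually_at_left_field by blast
    define t where "t = (max b 0 + s) / 2"
    have "b < t" "t < s" "0 < t" "t < T" using b s by (auto simp: t_def max_def)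
    then have "\<alpha> y \<le> t" using b(2)[of t] by (intro \<alpha>_le) auto
    then show "\<alpha> y < s" using \<open>t < s\<close> by simp
  qed
  show "s < \<beta> y' \<longleftrightarrow> D s < y'"
  proof
    assume "s < \<beta> y'"
    then have "\<not> y' \<le> D s" using \<beta>_le[OF s, of y'] by auto
    then show "D s < y'" by simp
  next
    assume "D s < y'"
    moreover have "(D \<longlongrightarrow> D s) (at_right s)" using cont(2) unfolding isCont_def by (rule tendsto_within_subset) simp
    ultimately have "\<forall>\<^sub>F t in at_right s. D t < y'" by (intro order_tendstoD(2))
    then obtain b where b: "b > s" "\<And>t. s < t \<Longrightarrow> t < b \<Longrightarrow> D t < y'" unfolding eventually_at_right_field by blast
    define t where "t = (s + min b T) / 2"
    have t: "s < t" "t < b" "0 < t" "t < T" using b s by (auto simp: t_def min_def)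
    have "t \<le> \<beta> y'"
    proof (rule \<beta>_ge)
      fix r assume r: "r \<in> {0<..<T}" "y' \<le> D r"
      show "t \<le> r"
      proof (rule ccontr)
        assume "\<not> t \<le> r"
        then have "D r \<le> D t" using r t by (intro D_mono) auto
        then show False using r b(2)[of t] t by simp
      qed
    qed (use t in simp)
    then show "s < \<beta> y'" using t by simp
  qed
qed

text \<open>Peak 0 contributes m. Any other peak counts when its level lies between
  \<open>lo\<close> and \<open>hi\<close>; as \<theta> runs through \<open>(0, m)\<close>, the
  levels of peaks 1 to N sweep the range from m to (N + 1) * m, which contains
  \<open>(lo, hi)\<close>. The total is m + hi - lo = f s.\<close>

lemma count_density:
  assumes s: "s \<in> {0<..<T}" and cont: "isCont U s" "isCont D s"
  shows "(\<Sum>j<Suc N. \<integral>\<^sup>+\<theta>. indicator {\<theta>. \<alpha>s \<theta> j < s \<and> s < \<beta>s \<theta> j} \<theta> * indicator {0<..<m} \<theta> \<partial>lborel) = ennreal (f s)"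
proof -
  define lo hi where "lo = D s + m" and "hi = f0 + U s"
  have lh: "m \<le> lo" "lo \<le> hi" "hi \<le> real (Suc N) * m" "f s = hi - lo + m"
    using D_nonneg[OF s] U_le_u1[OF s] m \<mu>(2)[OF s] f_eq[of s] by (auto simp: lo_def hi_def mult.commute)
  \<comment> \<open>Clamping to \<open>[lo, hi]\<close>: the part of a slice lying inside has length
    the difference of K at its ends, and these differences telescope.\<close>
  define K where "K x = min hi (max lo x)" for x
  have Kmono: "K x \<le> K y" if "x \<le> y" for x y using that by (auto simp: K_def)
  have t0: "(\<integral>\<^sup>+\<theta>. indicator {\<theta>. \<alpha>s \<theta> 0 < s \<and> s < \<beta>s \<theta> 0} \<theta> * indicator {0<..<m} \<theta> \<partial>lborel) = ennreal m"
  proof -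
    have "(\<integral>\<^sup>+\<theta>. indicator {\<theta>. \<alpha>s \<theta> 0 < s \<and> s < \<beta>s \<theta> 0} \<theta> * indicator {0<..<m} \<theta> \<partial>lborel) = (\<integral>\<^sup>+\<theta>. indicator {0<..<m} \<theta> \<partial>lborel)"
    proof (rule nn_integral_cong)
      fix \<theta>
      have "\<alpha>s \<theta> 0 = 0" if "\<theta> < m" using that m f0_ge by (auto simp: \<alpha>s_def intro!: \<alpha>_eq_0)
      then show "indicator {\<theta>. \<alpha>s \<theta> 0 < s \<and> s < \<beta>s \<theta> 0} \<theta> * indicator {0<..<m} \<theta> = (indicator {0<..<m} \<theta> :: ennreal)"
        using s by (auto simp: indicator_def \<beta>s_def)
    qed
    then show ?thesis using m by simp
  qed
  have tj: "(\<integral>\<^sup>+\<theta>. indicator {\<theta>. \<alpha>s \<theta> (Suc j) < s \<and> s < \<beta>s \<theta> (Suc j)} \<theta> * indicator {0<..<m} \<theta> \<partial>lborel)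
    = ennreal (K (real (Suc (Suc j)) * m) - K (real (Suc j) * m))" if j: "j < N" for j
  proof -
    let ?c = "real (Suc j) * m"
    have ae: "AE \<theta> in lborel. \<theta> \<noteq> f0 + U s - ?c \<and> \<theta> \<noteq> D s - real j * m"
      using AE_lborel_singleton[of "f0 + U s - ?c"] AE_lborel_singleton[of "D s - real j * m"] by eventually_elim simp
    have "(\<integral>\<^sup>+\<theta>. indicator {\<theta>. \<alpha>s \<theta> (Suc j) < s \<and> s < \<beta>s \<theta> (Suc j)} \<theta> * indicator {0<..<m} \<theta> \<partial>lborel)
      = (\<integral>\<^sup>+\<theta>. indicator {max 0 (lo - ?c)<..<min m (hi - ?c)} \<theta> \<partial>lborel)"
    proof (rule nn_integral_cong_AE, rule eventually_mono[OF ae])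
      fix \<theta> assume \<theta>: "\<theta> \<noteq> f0 + U s - ?c \<and> \<theta> \<noteq> D s - real j * m"
      have "\<alpha>s \<theta> (Suc j) < s \<longleftrightarrow> \<theta> + ?c < f0 + U s"
        unfolding \<alpha>s_def using \<theta> by (intro label_iff(1)[OF s cont, where y' = "D s + 1"]) auto
      moreover have "s < \<beta>s \<theta> (Suc j) \<longleftrightarrow> D s < \<theta> + real j * m"
      proof -
        have "\<beta>s \<theta> (Suc j) = \<beta> (\<theta> + real j * m)" using j by (simp add: \<beta>s_def)
        then show ?thesis using \<theta> by (simp only:) (intro label_iff(2)[OF s cont, where y = "f0 + U s + 1"], auto)
      qed
      moreover have "D s < \<theta> + real j * m \<longleftrightarrow> lo - ?c < \<theta>" by (simp add: lo_def algebra_simps)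
      ultimately have "(\<alpha>s \<theta> (Suc j) < s \<and> s < \<beta>s \<theta> (Suc j)) \<and> \<theta> \<in> {0<..<m} \<longleftrightarrow> \<theta> \<in> {max 0 (lo - ?c)<..<min m (hi - ?c)}"
        by (auto simp: hi_def)
      then show "indicator {\<theta>. \<alpha>s \<theta> (Suc j) < s \<and> s < \<beta>s \<theta> (Suc j)} \<theta> * indicator {0<..<m} \<theta> = (indicator {max 0 (lo - ?c)<..<min m (hi - ?c)} \<theta> :: ennreal)"
        by (auto simp: indicator_def)
    qed
    also have "\<dots> = emeasure lborel {max 0 (lo - ?c)<..<min m (hi - ?c)}" by simp
    also have "\<dots> = ennreal (K (?c + m) - K ?c)"
    proof (cases "max 0 (lo - ?c) \<le> min m (hi - ?c)")
      case True
      then have "lo \<le> ?c + m" "?c \<le> hi" by linarith+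
      then have "K (?c + m) - K ?c = min m (hi - ?c) - max 0 (lo - ?c)"
        using lh(2) unfolding K_def by linarith
      then show ?thesis using True by simp
    next
      case False
      then have "m < lo - ?c \<or> hi - ?c < 0" using lh(2) m(1) by linarith
      then have "K (?c + m) - K ?c = 0"
        using lh(2) m(1) unfolding K_def by linarith
      moreover have "min m (hi - ?c) \<le> max 0 (lo - ?c)" using False by linarith
      then have "{max 0 (lo - ?c)<..<min m (hi - ?c)} = {}" by (rule greaterThanLessThan_empty)
      ultimately show ?thesis by (simp only: emeasure_empty ennreal_0)
    qed
    also have "?c + m = real (Suc (Suc j)) * m" by (simp add: algebra_simps)
    finally show ?thesis .
  qed
  have "(\<Sum>j<Suc N. \<integral>\<^sup>+\<theta>. indicator {\<theta>. \<alpha>s \<theta> j < s \<and> s < \<beta>s \<theta> j} \<theta> * indicator {0<..<m} \<theta> \<partial>lborel)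
    = ennreal m + (\<Sum>j<N. ennreal (K (real (Suc (Suc j)) * m) - K (real (Suc j) * m)))"
    unfolding sum.lessThan_Suc_shift t0 by (intro arg_cong[where f = "(+) (ennreal m)"] sum.cong refl) (use tj in auto)
  also have "(\<Sum>j<N. ennreal (K (real (Suc (Suc j)) * m) - K (real (Suc j) * m))) = ennreal (\<Sum>j<N. K (real (Suc (Suc j)) * m) - K (real (Suc j) * m))"
    using m by (intro sum_ennreal) (auto intro!: Kmono mult_right_mono)
  also have "(\<Sum>j<N. K (real (Suc (Suc j)) * m) - K (real (Suc j) * m)) = K (real (Suc N) * m) - K (real (Suc 0) * m)"
    by (rule sum_lessThan_telescope[of "\<lambda>j. K (real (Suc j) * m)"])
  also have "\<dots> = hi - lo" using lh by (simp add: K_def)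
  also have "ennreal m + ennreal (hi - lo) = ennreal (f s)" using lh m by (simp add: ennreal_plus[symmetric] del: ennreal_plus)
  finally show ?thesis .
qed

lemma \<alpha>s_nonneg: "0 \<le> \<alpha>s \<theta> j" and \<beta>s_le: "\<beta>s \<theta> j \<le> T"
  by (simp_all add: \<alpha>s_def \<beta>s_def \<alpha>_nonneg \<beta>_le_T)

lemma measurable_J [measurable]: "J \<in> measurable borel (count_space UNIV)"
proof -
  have "(\<lambda>\<theta>. \<lfloor>(f0 - \<theta>) / m\<rfloor>) \<in> measurable borel (count_space UNIV)" by measurable
  then show ?thesis
    unfolding J_def[abs_def] by (rule measurable_compose) simp
qed

lemma measurable_h [measurable]: "(\<lambda>\<theta>. cyc_h N (J \<theta>) c k) \<in> borel_measurable borel"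
  by (rule measurable_compose[OF measurable_J, of "\<lambda>i. cyc_h N i c k"]) simp

lemma measurable_\<alpha>s [measurable]: "(\<lambda>\<theta>. \<alpha>s \<theta> k) \<in> borel_measurable borel"
  unfolding \<alpha>s_def by measurable

lemma measurable_\<beta>s [measurable]: "(\<lambda>\<theta>. \<beta>s \<theta> k) \<in> borel_measurable borel"
  unfolding \<beta>s_def by measurable

lemma measurable_p [measurable]: "(\<lambda>\<theta>. cyc_p N (J \<theta>) c (\<alpha>s \<theta>) (\<beta>s \<theta>) k) \<in> borel_measurable borel"
  unfolding cyc_p_def cyc_gap_def by measurable

lemma dens_AE:
  "AE s in lborel. (\<Sum>j\<in>{0..<int (Suc N)}. \<integral>\<^sup>+\<theta>. indicator {\<theta>. unroll N (\<alpha>s \<theta>) j < s \<and> s < unroll N (\<beta>s \<theta>) j} \<theta> * indicator {0<..<m} \<theta> \<partial>lborel) = ennreal (F s)"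
proof -
  have ae: "AE s in lborel. s \<notin> {s\<in>{0<..<T}. \<not> isCont U s} \<union> {s\<in>{0<..<T}. \<not> isCont D s}"
    using countable_imp_null_set_lborel[OF discont] by (rule AE_not_in)
  show ?thesis
  proof (rule eventually_mono[OF ae])
    fix s assume s: "s \<notin> {s\<in>{0<..<T}. \<not> isCont U s} \<union> {s\<in>{0<..<T}. \<not> isCont D s}"
    have "(\<Sum>j\<in>{0..<int (Suc N)}. \<integral>\<^sup>+\<theta>. indicator {\<theta>. unroll N (\<alpha>s \<theta>) j < s \<and> s < unroll N (\<beta>s \<theta>) j} \<theta> * indicator {0<..<m} \<theta> \<partial>lborel)
      = (\<Sum>j<Suc N. \<integral>\<^sup>+\<theta>. indicator {\<theta>. \<alpha>s \<theta> j < s \<and> s < \<beta>s \<theta> j} \<theta> * indicator {0<..<m} \<theta> \<partial>lborel)"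
      unfolding unroll_def by (rule sum_cycle_nat)
    also have "\<dots> = ennreal (F s)"
    proof (cases "s \<in> {0<..<T}")
      case True
      then show ?thesis using count_density[OF True] s by (simp add: F_def)
    next
      case False
      then have "\<not> (\<alpha>s \<theta> j < s \<and> s < \<beta>s \<theta> j)" for \<theta> j
        using \<alpha>s_nonneg[of \<theta> j] \<beta>s_le[of \<theta> j] by auto
      then have "{\<theta>. \<alpha>s \<theta> j < s \<and> s < \<beta>s \<theta> j} = {}" for j by blast
      then show ?thesis using False by (auto simp: F_def)
    qed
    finally show "(\<Sum>j\<in>{0..<int (Suc N)}. \<integral>\<^sup>+\<theta>. indicator {\<theta>. unroll N (\<alpha>s \<theta>) j < s \<and> s < unroll N (\<beta>s \<theta>) j} \<theta> * indicator {0<..<m} \<theta> \<partial>lborel) = ennreal (F s)" .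
  qed
qed

text \<open>The period is the total interval length plus c. Integrated over the levels this is, by
  Fubini, the integral of F plus c * m, that is, I + (1 - I).\<close>

lemma total_mass: "(\<integral>\<^sup>+\<theta>. ennreal (cyc_p N (J \<theta>) c (\<alpha>s \<theta>) (\<beta>s \<theta>) (Suc N)) * indicator {0<..<m} \<theta> \<partial>lborel) = 1"
proof -
  have L: "ennreal (cyc_p N (J \<theta>) c (\<alpha>s \<theta>) (\<beta>s \<theta>) (Suc N)) =
    (\<Sum>j\<in>{0..<int (Suc N)}. emeasure lborel (UNIV \<inter> {unroll N (\<alpha>s \<theta>) j<..<unroll N (\<beta>s \<theta>) j})) + ennreal c"
    if \<theta>: "\<theta> \<in> {0<..<m}" for \<theta>
  proof -
    interpret cycle N "J \<theta>" c T "\<alpha>s \<theta>" "\<beta>s \<theta>" by (rule cycle[OF \<theta>])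
    have "(\<Sum>j\<in>{0..<int (Suc N)}. emeasure lborel (UNIV \<inter> {unroll N (\<alpha>s \<theta>) j<..<unroll N (\<beta>s \<theta>) j}))
      = (\<Sum>j<Suc N. emeasure lborel (UNIV \<inter> {\<alpha>s \<theta> j<..<\<beta>s \<theta> j}))"
      unfolding unroll_def by (rule sum_cycle_nat)
    also have "\<dots> = (\<Sum>j\<le>N. ennreal (\<beta>s \<theta> j - \<alpha>s \<theta> j))"
      unfolding lessThan_Suc_atMost by (rule sum.cong) (auto simp: \<alpha>_le_\<beta>)
    also have "\<dots> = ennreal (\<Sum>j\<le>N. \<beta>s \<theta> j - \<alpha>s \<theta> j)"
      by (rule sum_ennreal) (simp add: \<alpha>_le_\<beta>)
    finally show ?thesis
      unfolding L_eq using c by (subst ennreal_plus) (auto intro!: sum_nonneg simp: \<alpha>_le_\<beta>)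
  qed
  have mS: "(\<lambda>\<theta>. (\<Sum>j\<in>{0..<int (Suc N)}. emeasure lborel (UNIV \<inter> {unroll N (\<alpha>s \<theta>) j<..<unroll N (\<beta>s \<theta>) j}))) \<in> borel_measurable borel"
  proof -
    have e: "emeasure lborel (UNIV \<inter> {x<..<y}) = ennreal (max 0 (y - x))" for x y :: real by (cases "x \<le> y") auto
    show ?thesis unfolding e unroll_def by measurable
  qed
  have "(\<integral>\<^sup>+\<theta>. ennreal (cyc_p N (J \<theta>) c (\<alpha>s \<theta>) (\<beta>s \<theta>) (Suc N)) * indicator {0<..<m} \<theta> \<partial>lborel)
    = (\<integral>\<^sup>+\<theta>. (\<Sum>j\<in>{0..<int (Suc N)}. emeasure lborel (UNIV \<inter> {unroll N (\<alpha>s \<theta>) j<..<unroll N (\<beta>s \<theta>) j})) * indicator {0<..<m} \<theta> + ennreal c * indicator {0<..<m} \<theta> \<partial>lborel)"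
    by (rule nn_integral_cong) (use L in \<open>auto simp: indicator_def\<close>)
  also have "\<dots> = (\<integral>\<^sup>+\<theta>. (\<Sum>j\<in>{0..<int (Suc N)}. emeasure lborel (UNIV \<inter> {unroll N (\<alpha>s \<theta>) j<..<unroll N (\<beta>s \<theta>) j})) * indicator {0<..<m} \<theta> \<partial>lborel) + ennreal c * ennreal m"
    using mS m by (subst nn_integral_add) (auto simp: nn_integral_cmult_indicator)
  also have "(\<integral>\<^sup>+\<theta>. (\<Sum>j\<in>{0..<int (Suc N)}. emeasure lborel (UNIV \<inter> {unroll N (\<alpha>s \<theta>) j<..<unroll N (\<beta>s \<theta>) j})) * indicator {0<..<m} \<theta> \<partial>lborel)
    = (\<integral>\<^sup>+s. indicator UNIV s * (\<Sum>j\<in>{0..<int (Suc N)}. \<integral>\<^sup>+\<theta>. indicator {\<theta>. unroll N (\<alpha>s \<theta>) j < s \<and> s < unroll N (\<beta>s \<theta>) j} \<theta> * indicator {0<..<m} \<theta> \<partial>lborel) \<partial>lborel)"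
    by (rule nn_integral_sum_intervals) (auto simp: unroll_def)
  also have "\<dots> = (\<integral>\<^sup>+s. ennreal (F s) \<partial>lborel)"
    by (rule nn_integral_cong_AE, rule eventually_mono[OF dens_AE]) simp
  also have "\<dots> = ennreal I" by (rule nn_integral_F)
  also have "ennreal I + ennreal c * ennreal m = 1"
  proof -
    have "0 \<le> indicator {0<..<T} x *\<^sub>R f x" for x
      using \<mu>(1) \<mu>(2)[of x] by (cases "x \<in> {0<..<T}") auto
    then have "0 \<le> I" unfolding I_def set_lebesgue_integral_def
      by (intro Bochner_Integration.integral_nonneg)
    moreover have "I + c * m = 1" using m by (simp add: c_def)
    ultimately show ?thesis using c m by (simp add: ennreal_mult[symmetric] ennreal_plus[symmetric] del: ennreal_plus)
  qed
  finally show ?thesis .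
qed

lemma ex_process:
  "\<exists>(M :: (real \<Rightarrow> real) measure) X. sample_continuous_process M X \<and> stationary_process M X \<and>
    assumption_U M X T \<and> assumption_L M X \<and> interior_density M X T f"
proof -
  interpret tent_family "int (Suc N)" m T "c / (2 * real N)" "\<lambda>\<theta>. cyc_p N (J \<theta>) c (\<alpha>s \<theta>) (\<beta>s \<theta>) (Suc N)" F
    "\<lambda>\<theta>. peak_pos N (J \<theta>) c (\<alpha>s \<theta>) (\<beta>s \<theta>)" "\<lambda>\<theta>. unroll N (cyc_h N (J \<theta>) c)" "\<lambda>\<theta>. unroll N (\<alpha>s \<theta>)" "\<lambda>\<theta>. unroll N (\<beta>s \<theta>)"
  proof (rule tent_family.intro)
    show "0 < m" "0 < c / (2 * real N)" "0 < T" using m c N T by auto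
    show "tents (peak_pos N (J \<theta>) c (\<alpha>s \<theta>) (\<beta>s \<theta>)) (unroll N (cyc_h N (J \<theta>) c)) (int (Suc N))
      (cyc_p N (J \<theta>) c (\<alpha>s \<theta>) (\<beta>s \<theta>) (Suc N)) T (unroll N (\<alpha>s \<theta>)) (unroll N (\<beta>s \<theta>))" if "\<theta> \<in> {0<..<m}" for \<theta>
      by (rule cycle.tents_cycle[OF cycle[OF that]])
    show "c / (2 * real N) \<le> peak_pos N (J \<theta>) c (\<alpha>s \<theta>) (\<beta>s \<theta>) (i + 1) - peak_pos N (J \<theta>) c (\<alpha>s \<theta>) (\<beta>s \<theta>) i" if "\<theta> \<in> {0<..<m}" for \<theta> i
      by (rule cycle.gap_ge[OF cycle[OF that]])
    show "(\<lambda>\<theta>. peak_pos N (J \<theta>) c (\<alpha>s \<theta>) (\<beta>s \<theta>) i) \<in> borel_measurable borel"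
      "(\<lambda>\<theta>. unroll N (cyc_h N (J \<theta>) c) i) \<in> borel_measurable borel"
      "(\<lambda>\<theta>. unroll N (\<alpha>s \<theta>) i) \<in> borel_measurable borel"
      "(\<lambda>\<theta>. unroll N (\<beta>s \<theta>) i) \<in> borel_measurable borel"
      "(\<lambda>\<theta>. cyc_p N (J \<theta>) c (\<alpha>s \<theta>) (\<beta>s \<theta>) (Suc N)) \<in> borel_measurable borel" "F \<in> borel_measurable borel" for i
      unfolding peak_pos_def unroll_def by measurable
    show "(\<integral>\<^sup>+\<theta>. ennreal (cyc_p N (J \<theta>) c (\<alpha>s \<theta>) (\<beta>s \<theta>) (Suc N)) * indicator {0<..<m} \<theta> \<partial>lborel) = 1"
      by (rule total_mass)
    show "AE s in lborel. s \<in> {0<..<T} \<longrightarrow> (\<Sum>j\<in>{0..<int (Suc N)}. \<integral>\<^sup>+\<theta>. indicator {\<theta>. unroll N (\<alpha>s \<theta>) j < s \<and> s < unroll N (\<beta>s \<theta>) j} \<theta> * indicator {0<..<m} \<theta> \<partial>lborel) = ennreal (F s)"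
      using dens_AE by eventually_elim simp
  qed
  show ?thesis by (rule ex_process) (simp add: F_def)
qed

end

section \<open>The two cases of the converse\<close>

lemma ex_uniform_process:
  assumes T: "0 < T" and f: "\<And>t. t \<in> {0<..<T} \<Longrightarrow> f t = 1 / T"
  shows "\<exists>(M :: (real \<Rightarrow> real) measure) X. sample_continuous_process M X \<and> stationary_process M X \<and>
    assumption_U M X T \<and> assumption_L M X \<and> interior_density M X T f"
proof -
  have tents: "tents (\<lambda>i. of_int i * T) (\<lambda>_. 0) 1 T T (\<lambda>_. 0) (\<lambda>_. T)"
  proof
    show "T \<le> of_int k * T - of_int i * T" if "i < k" for i k :: int
    proof -
      have "1 * T \<le> of_int (k - i) * T" using that T by (intro mult_right_mono) auto
      then show ?thesis by (simp add: algebra_simps)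
    qed
  qed (use T in \<open>auto simp: algebra_simps\<close>)
  interpret tent_family 1 "1 / T" T T "\<lambda>_. T" "\<lambda>_. 1 / T" "\<lambda>_ i. of_int i * T" "\<lambda>_ _. 0" "\<lambda>_ _. 0" "\<lambda>_ _. T"
  proof (rule tent_family.intro)
    show "tents (\<lambda>i. of_int i * T) (\<lambda>_. 0) 1 T T (\<lambda>_. 0) (\<lambda>_. T)" by (rule tents)
    show "(\<integral>\<^sup>+\<theta>. ennreal T * indicator {0<..<1 / T} \<theta> \<partial>lborel) = 1"
      using T by (subst nn_integral_cmult_indicator) (auto simp: ennreal_mult[symmetric])
    show "AE s in lborel. s \<in> {0<..<T} \<longrightarrow> (\<Sum>j\<in>{0..<1::int}. \<integral>\<^sup>+\<theta>. indicator {\<theta>. 0 < s \<and> s < T} \<theta> * indicator {0<..<1 / T} \<theta> \<partial>lborel) = ennreal (1 / T)"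
    proof (intro AE_I2 impI)
      fix s assume "s \<in> {0<..<T}"
      then have "{\<theta> :: real. 0 < s \<and> s < T} = UNIV" by auto
      moreover have "{0..<1::int} = {0}" by auto
      ultimately show "(\<Sum>j\<in>{0..<1::int}. \<integral>\<^sup>+\<theta>. indicator {\<theta>. 0 < s \<and> s < T} \<theta> * indicator {0<..<1 / T} \<theta> \<partial>lborel) = ennreal (1 / T)"
        using T by simp
    qed
  qed (use T in \<open>auto simp: algebra_simps\<close>)
  show ?thesis by (rule ex_process) (simp add: f)
qed

theorem ex_process_with_density:
  assumes T: "0 < T" and var: "variation_property T f" and inf: "(INF t\<in>{0<..<T}. f t) > 0"
    and nonneg: "\<forall>t\<in>{0<..<T}. 0 \<le> f t"
    and alt: "(\<forall>t\<in>{0<..<T}. f t = 1 / T) \<or> (LBINT t:{0<..<T}. f t) < 1"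
  shows "\<exists>(M :: (real \<Rightarrow> real) measure) X. sample_continuous_process M X \<and> stationary_process M X \<and>
    assumption_U M X T \<and> assumption_L M X \<and> interior_density M X T f"
  using alt
proof
  assume "\<forall>t\<in>{0<..<T}. f t = 1 / T"
  then show ?thesis by (intro ex_uniform_process[OF T]) blast
next
  assume less: "(LBINT t:{0<..<T}. f t) < 1"
  obtain f0 fT where lims: "(f \<longlongrightarrow> f0) (at_right 0)" "(f \<longlongrightarrow> fT) (at_left T)"
    and tv: "total_variation {0<..<T} f \<le> ereal (f0 + fT)"
    using var unfolding variation_property_def by blast
  define \<mu> where "\<mu> = (INF t\<in>{0<..<T}. f t)"
  have bdd: "bdd_below (f ` {0<..<T})" using nonneg by (intro bdd_belowI2[of _ 0]) blast
  \<comment> \<open>A large k makes the slices shorter than \<mu>. Taking the maximum with 1 below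
    leaves room for a valley index J between 1 and N.\<close>
  obtain k :: nat where k: "(f0 + fT) / \<mu> < real k" using reals_Archimedean2 by blast
  interpret density_data f T f0 fT \<mu> "max 1 k"
  proof
    show "path_var f l \<le> f0 + fT" if "sorted_wrt (<) l" "set l \<subseteq> {0<..<T}" for l
    proof -
      have "ereal (path_var f l) \<le> total_variation {0<..<T} f"
        unfolding total_variation_def path_var_def by (rule SUP_upper) (use that in simp)
      then show ?thesis using tv by (metis ereal_less_eq(3) order_trans)
    qed
    show "0 < \<mu>" using inf by (simp add: \<mu>_def)
    show "\<mu> \<le> f t" if "t \<in> {0<..<T}" for t unfolding \<mu>_def using that by (rule cINF_lower[OF bdd])
    show "(f0 + fT) / real (Suc (max 1 k)) < \<mu>"
    proof -
      have "(f0 + fT) / \<mu> < real (Suc (max 1 k))" using k by simp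
      then show ?thesis using inf unfolding \<mu>_def[symmetric] by (simp add: divide_less_eq mult.commute)
    qed
  qed (use T lims less in auto)
  show ?thesis by (rule ex_process)
qed

theorem theorem3p1:
  fixes T :: real
  assumes "T > 0"
  shows
    "(\<forall>(M :: 'a measure) X.
        sample_continuous_process M X \<and> stationary_process M X \<and>
        assumption_U M X T \<and> assumption_L M X \<longrightarrow>
        absolutely_continuous (restrict_space lborel {0<..<T})
          (restrict_space (sup_location_law M X T) {0<..<T}) \<and>
        (\<exists>f. (\<forall>t\<in>{0<..<T}. 0 \<le> f t) \<and> cadlag_interior T f \<and> interior_density M X T f \<and>
           variation_property T f \<and>
           (INF t\<in>{0<..<T}. f t) > 0 \<and>
           ((\<forall>t\<in>{0<..<T}. f t = 1 / T) \<or> (LBINT t:{0<..<T}. f t) < 1))) \<and>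
     (\<forall>f. (\<forall>t\<in>{0<..<T}. 0 \<le> f t) \<and> cadlag_interior T f \<and>
           variation_property T f \<and>
           (INF t\<in>{0<..<T}. f t) > 0 \<and>
           ((\<forall>t\<in>{0<..<T}. f t = 1 / T) \<or> (LBINT t:{0<..<T}. f t) < 1) \<longrightarrow>
        (\<exists>(M :: (real \<Rightarrow> real) measure) X.
           sample_continuous_process M X \<and> stationary_process M X \<and>
           assumption_U M X T \<and> assumption_L M X \<and> interior_density M X T f))"
proof (intro conjI allI impI)
  fix M :: "'a measure" and X
  assume a: "sample_continuous_process M X \<and> stationary_process M X \<and> assumption_U M X T \<and> assumption_L M X"
  then interpret stationary_L M X
    by (auto simp: stationary_L_def stationary_L_axioms_def stationary_cont_def stationary_cont_axioms_def
        sample_continuous_process_def)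
  have U: "assumption_U M X T" using a by blast
  show "absolutely_continuous (restrict_space lborel {0<..<T}) (restrict_space (sup_location_law M X T) {0<..<T})"
    using density_properties[OF assms U] by (rule conjunct1)
  show "\<exists>f. (\<forall>t\<in>{0<..<T}. 0 \<le> f t) \<and> cadlag_interior T f \<and> interior_density M X T f \<and>
           variation_property T f \<and>
           (INF t\<in>{0<..<T}. f t) > 0 \<and>
           ((\<forall>t\<in>{0<..<T}. f t = 1 / T) \<or> (LBINT t:{0<..<T}. f t) < 1)"
    using density_properties[OF assms U] by (rule conjunct2)
next
  fix f :: "real \<Rightarrow> real"
  assume a: "(\<forall>t\<in>{0<..<T}. 0 \<le> f t) \<and> cadlag_interior T f \<and>
           variation_property T f \<and>
           (INF t\<in>{0<..<T}. f t) > 0 \<and>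
           ((\<forall>t\<in>{0<..<T}. f t = 1 / T) \<or> (LBINT t:{0<..<T}. f t) < 1)"
  show "\<exists>(M :: (real \<Rightarrow> real) measure) X.
           sample_continuous_process M X \<and> stationary_process M X \<and>
           assumption_U M X T \<and> assumption_L M X \<and> interior_density M X T f"
    by (rule ex_process_with_density[OF assms]) (use a in blast)+
qed

end
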